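(* Let $(\mathfrak G,[-,-]_{\mathfrak G})$ be a Leibniz algebra, with Leibniz kernel $\mathrm{Leib}(\mathfrak G)$, inclusion $\mathfrak i:\mathrm{Leib}(\mathfrak G)\to\mathfrak G$ and projection $\mathrm{pr}:\mathfrak G\to\mathfrak G_{\mathrm{Lie}}$. For each antisymmetric representation $(V;\rho_V^L,0)$ of $\mathfrak G$ define $$\alpha_V:(\mathsf C_{\mathrm{Leib}(\mathfrak G)}\circ\mathcal I_a)(V;\rho_V^L,0)\to\mathsf C_{\mathfrak G}(V;\rho_V^L,0),\qquad \alpha_V(g)=\mathfrak i\circ g,\quad g\in\mathrm{Hom}(\otimes^nV,\mathrm{Leib}(\mathfrak G)),$$ $$\beta_V:\mathsf C_{\mathfrak G}(V;\rho_V^L,0)\to(\mathsf C_{\mathfrak G_{\mathrm{Lie}}}\circ\mathcal P_a)(V;\rho_V^L,0),\qquad \beta_V(f)=\mathrm{pr}\circ f,\quad f\in\mathrm{Hom}(\otimes^nV,\mathfrak G).$$ Then $\alpha$ is a natural transformation from the functor $\mathsf C_{\mathrm{Leib}(\mathfrak G)}\circ\mathcal I_a$ to $\mathsf C_{\mathfrak G}$, and $\beta$ is a natural transformation from the functor $\mathsf C_{\mathfrak G}$ to $\mathsf C_{\mathfrak G_{\mathrm{Lie}}}\circ\mathcal P_a$ (all regarded as contravariant functors from the category of antisymmetric representations of $\mathfrak G$ to the category of graded Lie algebras). Moreover, for any antisymmetric representation $(V;\rho_V^L,0)$ of $\mathfrak G$, there is a short exact sequence of graded Lie algebras $$0\to(\mathsf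 C_{\mathrm{Leib}(\mathfrak G)}\circ\mathcal I_a)(V;\rho_V^L,0)\xrightarrow{\alpha_V}\mathsf C_{\mathfrak G}(V;\rho_V^L,0)\xrightarrow{\beta_V}(\mathsf C_{\mathfrak G_{\mathrm{Lie}}}\circ\mathcal P_a)(V;\rho_V^L,0)\to0.$$
   Context: All vector spaces are finite-dimensional over an algebraically closed field $\mathbb K$ of characteristic $0$. A (left) Leibniz algebra is a vector space $\mathfrak G$ with a bilinear operation $[-,-]_{\mathfrak G}$ such that $[x,[y,z]_{\mathfrak G}]_{\mathfrak G}=[[x,y]_{\mathfrak G},z]_{\mathfrak G}+[y,[x,z]_{\mathfrak G}]_{\mathfrak G}$. A representation of $\mathfrak G$ is a triple $(V;\rho^L,\rho^R)$ with $\rho^L,\rho^R:\mathfrak G\to\mathfrak{gl}(V)$ linear such that for all $x,y\in\mathfrak G$: $\rho^L([x,y]_{\mathfrak G})=[\rho^L(x),\rho^L(y)]$, $\rho^R([x,y]_{\mathfrak G})=[\rho^L(x),\rho^R(y)]$, $\rho^R(y)\circ\rho^L(x)=-\rho^R(y)\circ\rho^R(x)$. It is antisymmetric if $\rho^R=0$. A homomorphism of representations $(W;\rho_W^L,\rho_W^R)\to(V;\rho_V^L,\rho_V^R)$ is a linear map $\phi:W\to V$ with $\phi(\rho_W^L(x)w)=\rho_V^L(x)\phi(w)$ and $\phi(\rho_W^R(x)w)=\rho_V^R(x)\phi(w)$ for all $x\in\mathfrak G$, $w\in W$. The Leibniz kernel $\mathrm{Leib}(\mathfrak G)$ is the span of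 all $[x,x]_{\mathfrak G}$, $x\in\mathfrak G$; it is an ideal, and $\mathfrak G_{\mathrm{Lie}}:=\mathfrak G/\mathrm{Leib}(\mathfrak G)$ is a Lie algebra (the canonical Lie algebra), with projection $\mathrm{pr}$, $\mathrm{pr}(x)=\bar x$. For a representation $(V;\rho_V^L,\rho_V^R)$ of $\mathfrak G$ one has $\rho_V^L(\mathrm{Leib}(\mathfrak G))=0$, and $\theta_V:\mathfrak G_{\mathrm{Lie}}\to\mathfrak{gl}(V)$, $\theta_V(\bar x)=\rho_V^L(x)$, is a representation of the Lie algebra $\mathfrak G_{\mathrm{Lie}}$. Balavoine bracket: for a vector space $E$, on $\oplus_{n\ge1}\mathrm{Hom}(\otimes^nE,E)$, for $P\in\mathrm{Hom}(\otimes^{p+1}E,E)$, $Q\in\mathrm{Hom}(\otimes^{q+1}E,E)$, set $[P,Q]_{\mathsf B}=P\bar\circ Q-(-1)^{pq}Q\bar\circ P$, where $P\bar\circ Q=\sum_{k=1}^{p+1}P\circ_kQ$ and $$(P\circ_kQ)(x_1,\dots,x_{p+q+1})=\sum_{\sigma}(-1)^{(k-1)q}(-1)^\sigma P(x_{\sigma(1)},\dots,x_{\sigma(k-1)},Q(x_{\sigma(k)},\dots,x_{\sigma(k+q-1)},x_{k+q}),x_{k+q+1},\dots,x_{p+q+1}),$$ the sum being over $(k-1,q)$-shuffles $\sigma$ of $\{1,\dots,k+q-1\}$, and $(-1)^\sigma$ the sign of $\sigma$. The graded Lie algebra $\mathsf C_{\mathfrak G}(V;\rho_V^L,\rho_V^R)$: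 for a representation $(V;\rho_V^L,\rho_V^R)$ of a Leibniz algebra $\mathfrak G$, let $\mu$ be the Leibniz multiplication on $\mathfrak G\oplus V$ given by $\mu(x+u,y+v)=[x,y]_{\mathfrak G}+\rho_V^L(x)v+\rho_V^R(y)u$. Let $C^*(V,\mathfrak G)=\oplus_{n\ge1}\mathrm{Hom}(\otimes^nV,\mathfrak G)$, with elements of $\mathrm{Hom}(\otimes^nV,\mathfrak G)$ of degree $n$. Regarding elements of $\mathrm{Hom}(\otimes^nV,\mathfrak G)$ as elements of $\mathrm{Hom}(\otimes^n(\mathfrak G\oplus V),\mathfrak G\oplus V)$ by extending by zero, the graded Lie bracket is $\{g_1,g_2\}_V=(-1)^{m-1}[[\mu,g_1]_{\mathsf B},g_2]_{\mathsf B}$ for $g_1\in\mathrm{Hom}(\otimes^mV,\mathfrak G)$, $g_2\in\mathrm{Hom}(\otimes^nV,\mathfrak G)$. It is known that this is a graded Lie algebra; set $\mathsf C_{\mathfrak G}(V;\rho_V^L,\rho_V^R)=(C^*(V,\mathfrak G),\{-,-\}_V)$. On a homomorphism $\phi:W\to V$ of representations, $\mathsf C_{\mathfrak G}(\phi):C^*(V,\mathfrak G)\to C^*(W,\mathfrak G)$ is $f\mapsto f\circ\phi^{\otimes n}$ for $f\in\mathrm{Hom}(\otimes^nV,\mathfrak G)$. This makes $\mathsf C_{\mathfrak G}$ a contravariant functor from representations of $\mathfrak G$ to graded Lie algebras; the same notation is used for the Leibniz algebras $\mathrm{Leib}(\mathfrak G)$ (with the restricted bracket) and $\mathfrak G_{\mathrm{Lie}}$.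 Functors on antisymmetric representations of $\mathfrak G$: $\mathcal I_a(V;\rho_V^L,0)=(V;\rho_V^L\circ\mathfrak i,0)$, an antisymmetric representation of $\mathrm{Leib}(\mathfrak G)$; $\mathcal P_a(V;\rho_V^L,0)=(V;\theta_V,0)$, an antisymmetric representation of $\mathfrak G_{\mathrm{Lie}}$; both are the identity $\phi\mapsto\phi$ on morphisms. *)

theory Defs
  imports
    "HOL-Algebra.QuotRing"
    "HOL-Algebra.Algebraic_Closure"
    "HOL-Combinatorics.Permutations"
    "Jordan_Normal_Form.Missing_VectorSpace"
begin

text \<open>Vector spaces are \<^locale>\<open>vectorspace\<close>s over a field given by its carrier; in all the
  records below the fields \<open>mult\<close> and \<open>one\<close> that modules inherit from rings play no role.\<close>

definition char_zero :: "('k, 'c) ring_scheme \<Rightarrow> bool" where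
  "char_zero K \<longleftrightarrow> (\<forall>n::nat. n > 0 \<longrightarrow> [n] \<cdot>\<^bsub>K\<^esub> \<one>\<^bsub>K\<^esub> \<noteq> \<zero>\<^bsub>K\<^esub>)"

definition fd_vectorspace :: "('k, 'c) ring_scheme \<Rightarrow> ('k, 'v, 'd) module_scheme \<Rightarrow> bool" where
  "fd_vectorspace K V \<longleftrightarrow> vectorspace K V \<and> vectorspace.fin_dim K V"

definition bilinear_on ::
    "('k, 'c) ring_scheme \<Rightarrow> ('k, 'u, 'd) module_scheme \<Rightarrow> ('k, 'v, 'e) module_scheme \<Rightarrow>
     ('k, 'w, 'f) module_scheme \<Rightarrow> ('u \<Rightarrow> 'v \<Rightarrow> 'w) \<Rightarrow> bool" where
  "bilinear_on K U V W b \<longleftrightarrow>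
     (\<forall>u \<in> carrier U. (\<lambda>v. b u v) \<in> module_hom K V W) \<and>
     (\<forall>v \<in> carrier V. (\<lambda>u. b u v) \<in> module_hom K U W)"


section \<open>Leibniz algebras, the Leibniz kernel and the canonical Lie algebra\<close>

record ('k, 'g) leibniz = "('k, 'g) module" +
  bracket :: "'g \<Rightarrow> 'g \<Rightarrow> 'g"

definition leibniz_algebra :: "('k, 'c) ring_scheme \<Rightarrow> ('k, 'g) leibniz \<Rightarrow> bool" where
  "leibniz_algebra K G \<longleftrightarrow>
     fd_vectorspace K G \<and>
     bilinear_on K G G G (bracket G) \<and>
     (\<forall>x \<in> carrier G. \<forall>y \<in> carrier G. \<forall>z \<in> carrier G.
        bracket G x (bracket G y z) =
          bracket G (bracket G x y) z \<oplus>\<^bsub>G\<^esub> bracket G y (bracket G x z))"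

definition leib_kernel :: "('k, 'c) ring_scheme \<Rightarrow> ('k, 'g) leibniz \<Rightarrow> 'g set" where
  "leib_kernel K G = module.span K G {bracket G x x | x. x \<in> carrier G}"

definition leib_algebra :: "('k, 'c) ring_scheme \<Rightarrow> ('k, 'g) leibniz \<Rightarrow> ('k, 'g) leibniz" where
  "leib_algebra K G = G\<lparr>carrier := leib_kernel K G\<rparr>"

definition leib_incl :: "('k, 'c) ring_scheme \<Rightarrow> ('k, 'g) leibniz \<Rightarrow> 'g \<Rightarrow> 'g" where
  "leib_incl K G = (\<lambda>x \<in> leib_kernel K G. x)"

text \<open>The quotient by the Leibniz kernel consists of cosets, with the operations on
  representatives expressed as in \<^const>\<open>FactRing\<close>.\<close>

definition lie_quotient ::
    "('k, 'c) ring_scheme \<Rightarrow> ('k, 'g) leibniz \<Rightarrow> ('k, 'g set) leibniz" where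
  "lie_quotient K G = (let I = leib_kernel K G in
     \<lparr>carrier = a_rcosets\<^bsub>G\<^esub> I, monoid.mult = undefined, one = undefined,
      zero = I, add = set_add G,
      smult = (\<lambda>c A. \<Union>a\<in>A. I +>\<^bsub>G\<^esub> (c \<odot>\<^bsub>G\<^esub> a)),
      bracket = (\<lambda>A B. \<Union>a\<in>A. \<Union>b\<in>B. I +>\<^bsub>G\<^esub> bracket G a b)\<rparr>)"

definition lie_proj :: "('k, 'c) ring_scheme \<Rightarrow> ('k, 'g) leibniz \<Rightarrow> 'g \<Rightarrow> 'g set" where
  "lie_proj K G x = leib_kernel K G +>\<^bsub>G\<^esub> x"


section \<open>Representations\<close>

record ('k, 'g, 'v) representation =
  space :: "('k, 'v) module"
  rhoL :: "'g \<Rightarrow> 'v \<Rightarrow> 'v"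
  rhoR :: "'g \<Rightarrow> 'v \<Rightarrow> 'v"

text \<open>Bilinearity of \<open>(x, v) \<mapsto> \<rho> x v\<close> says that \<open>\<rho>\<close> is a linear map into \<open>gl(V)\<close>.\<close>

definition leibniz_rep ::
    "('k, 'c) ring_scheme \<Rightarrow> ('k, 'g) leibniz \<Rightarrow> ('k, 'g, 'v) representation \<Rightarrow> bool" where
  "leibniz_rep K G V \<longleftrightarrow>
     fd_vectorspace K (space V) \<and>
     bilinear_on K G (space V) (space V) (rhoL V) \<and>
     bilinear_on K G (space V) (space V) (rhoR V) \<and>
     (\<forall>x \<in> carrier G. \<forall>y \<in> carrier G. \<forall>v \<in> carrier (space V).
        rhoL V (bracket G x y) v =
          rhoL V x (rhoL V y v) \<ominus>\<^bsub>space V\<^esub> rhoL V y (rhoL V x v) \<and>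
        rhoR V (bracket G x y) v =
          rhoL V x (rhoR V y v) \<ominus>\<^bsub>space V\<^esub> rhoR V y (rhoL V x v) \<and>
        rhoR V y (rhoL V x v) = \<ominus>\<^bsub>space V\<^esub> rhoR V y (rhoR V x v))"

definition antisymmetric_rep ::
    "('k, 'c) ring_scheme \<Rightarrow> ('k, 'g) leibniz \<Rightarrow> ('k, 'g, 'v) representation \<Rightarrow> bool" where
  "antisymmetric_rep K G V \<longleftrightarrow>
     leibniz_rep K G V \<and>
     (\<forall>x \<in> carrier G. \<forall>v \<in> carrier (space V). rhoR V x v = \<zero>\<^bsub>space V\<^esub>)"

definition rep_hom ::
    "('k, 'c) ring_scheme \<Rightarrow> ('k, 'g) leibniz \<Rightarrow> ('k, 'g, 'w) representation \<Rightarrow>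
     ('k, 'g, 'v) representation \<Rightarrow> ('w \<Rightarrow> 'v) set" where
  "rep_hom K G W V =
     {\<phi> \<in> module_hom K (space W) (space V) \<inter> extensional (carrier (space W)).
        \<forall>x \<in> carrier G. \<forall>w \<in> carrier (space W).
          \<phi> (rhoL W x w) = rhoL V x (\<phi> w) \<and> \<phi> (rhoR W x w) = rhoR V x (\<phi> w)}"


section \<open>Multilinear maps and the Balavoine bracket\<close>

definition tuples :: "nat \<Rightarrow> ('k, 'e, 'd) module_scheme \<Rightarrow> 'e list set" where
  "tuples n E = {xs. length xs = n \<and> set xs \<subseteq> carrier E}"

text \<open>\<open>Hom(\<otimes>\<^sup>n E, F)\<close> as the space of \<open>n\<close>-linear maps; the value on the \<open>n\<close>-tuple
  \<open>(x\<^sub>1, \<dots>, x\<^sub>n)\<close> is the value on the list of its entries.\<close>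

definition multilinear_maps ::
    "('k, 'c) ring_scheme \<Rightarrow> nat \<Rightarrow> ('k, 'e, 'd) module_scheme \<Rightarrow> ('k, 'f, 'h) module_scheme \<Rightarrow>
     ('e list \<Rightarrow> 'f) set" where
  "multilinear_maps K n E F =
     {f \<in> tuples n E \<rightarrow>\<^sub>E carrier F.
        \<forall>xs \<in> tuples n E. \<forall>i < n. (\<lambda>v. f (xs[i := v])) \<in> module_hom K E F}"

definition hom_space ::
    "('k, 'c) ring_scheme \<Rightarrow> nat \<Rightarrow> ('k, 'e, 'd) module_scheme \<Rightarrow> ('k, 'f, 'h) module_scheme \<Rightarrow>
     ('k, 'e list \<Rightarrow> 'f) module" where
  "hom_space K n E F =
     \<lparr>carrier = multilinear_maps K n E F, monoid.mult = undefined, one = undefined,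
      zero = (\<lambda>xs \<in> tuples n E. \<zero>\<^bsub>F\<^esub>),
      add = (\<lambda>f g. \<lambda>xs \<in> tuples n E. f xs \<oplus>\<^bsub>F\<^esub> g xs),
      smult = (\<lambda>c f. \<lambda>xs \<in> tuples n E. c \<odot>\<^bsub>F\<^esub> f xs)\<rparr>"

definition shuffle_perms :: "nat \<Rightarrow> nat \<Rightarrow> (nat \<Rightarrow> nat) set" where
  "shuffle_perms a b =
     {\<sigma>. \<sigma> permutes {1..a + b} \<and> strict_mono_on {1..a} \<sigma> \<and> strict_mono_on {a + 1..a + b} \<sigma>}"

text \<open>In the next three definitions \<open>P\<close> takes \<open>p + 1\<close> and \<open>Q\<close> takes \<open>q + 1\<close> arguments. Argument
  positions are numbered from 1, so \<open>x\<^sub>i\<close> is \<open>xs ! (i - 1)\<close>.\<close>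

definition partial_circ ::
    "('k, 'e) module \<Rightarrow> nat \<Rightarrow> nat \<Rightarrow> nat \<Rightarrow> ('e list \<Rightarrow> 'e) \<Rightarrow> ('e list \<Rightarrow> 'e) \<Rightarrow> 'e list \<Rightarrow> 'e" where
  "partial_circ E p q k P Q = (\<lambda>xs \<in> tuples (p + q + 1) E.
     \<Oplus>\<^bsub>E\<^esub>\<sigma> \<in> shuffle_perms (k - 1) q.
       [((-1) ^ ((k - 1) * q) * sign \<sigma> :: int)] \<cdot>\<^bsub>E\<^esub>
         P (map (\<lambda>i. xs ! (\<sigma> i - 1)) [1..<k] @
            [Q (map (\<lambda>i. xs ! (\<sigma> i - 1)) [k..<k + q] @ [xs ! (k + q - 1)])] @
            drop (k + q) xs))"

definition circ ::
    "('k, 'e) module \<Rightarrow> nat \<Rightarrow> nat \<Rightarrow> ('e list \<Rightarrow> 'e) \<Rightarrow> ('e list \<Rightarrow> 'e) \<Rightarrow> 'e list \<Rightarrow> 'e" where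
  "circ E p q P Q = (\<lambda>xs \<in> tuples (p + q + 1) E.
     \<Oplus>\<^bsub>E\<^esub>k \<in> {1..p + 1}. partial_circ E p q k P Q xs)"

definition balavoine ::
    "('k, 'e) module \<Rightarrow> nat \<Rightarrow> nat \<Rightarrow> ('e list \<Rightarrow> 'e) \<Rightarrow> ('e list \<Rightarrow> 'e) \<Rightarrow> 'e list \<Rightarrow> 'e" where
  "balavoine E p q P Q = (\<lambda>xs \<in> tuples (p + q + 1) E.
     circ E p q P Q xs \<ominus>\<^bsub>E\<^esub> [((-1) ^ (p * q) :: int)] \<cdot>\<^bsub>E\<^esub> circ E q p Q P xs)"


section \<open>Graded Lie algebras\<close>

text \<open>A graded vector space, concentrated in positive degrees, is given by its homogeneous
  components, and a homomorphism by its restrictions to them. The value of \<open>component\<close> at 0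
  is never used.\<close>

record ('k, 'a) graded_algebra =
  component :: "nat \<Rightarrow> ('k, 'a) module"
  gbracket :: "nat \<Rightarrow> nat \<Rightarrow> 'a \<Rightarrow> 'a \<Rightarrow> 'a"

definition graded_lie_algebra :: "('k, 'c) ring_scheme \<Rightarrow> ('k, 'a) graded_algebra \<Rightarrow> bool" where
  "graded_lie_algebra K L \<longleftrightarrow>
     (\<forall>n\<ge>1. vectorspace K (component L n)) \<and>
     (\<forall>m\<ge>1. \<forall>n\<ge>1. bilinear_on K (component L m) (component L n) (component L (m + n))
        (gbracket L m n)) \<and>
     (\<forall>m\<ge>1. \<forall>n\<ge>1. \<forall>x \<in> carrier (component L m). \<forall>y \<in> carrier (component L n).
        gbracket L m n x y =
          \<ominus>\<^bsub>component L (m + n)\<^esub>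
            ([((-1) ^ (m * n) :: int)] \<cdot>\<^bsub>component L (m + n)\<^esub> gbracket L n m y x)) \<and>
     (\<forall>m\<ge>1. \<forall>n\<ge>1. \<forall>k\<ge>1. \<forall>x \<in> carrier (component L m). \<forall>y \<in> carrier (component L n).
        \<forall>z \<in> carrier (component L k).
          gbracket L m (n + k) x (gbracket L n k y z) =
            gbracket L (m + n) k (gbracket L m n x y) z
            \<oplus>\<^bsub>component L (m + n + k)\<^esub>
            [((-1) ^ (m * n) :: int)] \<cdot>\<^bsub>component L (m + n + k)\<^esub>
              gbracket L n (m + k) y (gbracket L m k x z))"

definition gla_hom ::
    "('k, 'c) ring_scheme \<Rightarrow> ('k, 'a) graded_algebra \<Rightarrow> ('k, 'b) graded_algebra \<Rightarrow>
     (nat \<Rightarrow> 'a \<Rightarrow> 'b) set" where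
  "gla_hom K L M =
     {f. (\<forall>n\<ge>1. f n \<in> module_hom K (component L n) (component M n)) \<and>
         (\<forall>m\<ge>1. \<forall>n\<ge>1. \<forall>x \<in> carrier (component L m). \<forall>y \<in> carrier (component L n).
            f (m + n) (gbracket L m n x y) = gbracket M m n (f m x) (f n y))}"

definition gla_short_exact ::
    "('k, 'c) ring_scheme \<Rightarrow> ('k, 'a) graded_algebra \<Rightarrow> ('k, 'b) graded_algebra \<Rightarrow>
     ('k, 'd) graded_algebra \<Rightarrow> (nat \<Rightarrow> 'a \<Rightarrow> 'b) \<Rightarrow> (nat \<Rightarrow> 'b \<Rightarrow> 'd) \<Rightarrow> bool" where
  "gla_short_exact K L M N f g \<longleftrightarrow>
     graded_lie_algebra K L \<and> graded_lie_algebra K M \<and> graded_lie_algebra K N \<and>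
     f \<in> gla_hom K L M \<and> g \<in> gla_hom K M N \<and>
     (\<forall>n\<ge>1. inj_on (f n) (carrier (component L n)) \<and>
        f n ` carrier (component L n) =
          {y \<in> carrier (component M n). g n y = \<zero>\<^bsub>component N n\<^esub>} \<and>
        g n ` carrier (component M n) = carrier (component N n))"


section \<open>Contravariant functors to graded Lie algebras\<close>

text \<open>Arrows are untyped, so \<open>Cmp C A B D g f\<close> is the composite of \<open>f : A \<rightarrow> B\<close> and
  \<open>g : B \<rightarrow> D\<close>, and functors take the source and target of an arrow as arguments.\<close>

record ('o, 'm) category =
  Ob :: "'o set"
  Arr :: "'o \<Rightarrow> 'o \<Rightarrow> 'm set"
  Id :: "'o \<Rightarrow> 'm"
  Cmp :: "'o \<Rightarrow> 'o \<Rightarrow> 'o \<Rightarrow> 'm \<Rightarrow> 'm \<Rightarrow> 'm"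

definition is_category :: "('o, 'm) category \<Rightarrow> bool" where
  "is_category C \<longleftrightarrow>
     (\<forall>A \<in> Ob C. Id C A \<in> Arr C A A) \<and>
     (\<forall>A \<in> Ob C. \<forall>B \<in> Ob C. \<forall>D \<in> Ob C. \<forall>f \<in> Arr C A B. \<forall>g \<in> Arr C B D.
        Cmp C A B D g f \<in> Arr C A D) \<and>
     (\<forall>A \<in> Ob C. \<forall>B \<in> Ob C. \<forall>f \<in> Arr C A B.
        Cmp C A A B f (Id C A) = f \<and> Cmp C A B B (Id C B) f = f) \<and>
     (\<forall>A \<in> Ob C. \<forall>B \<in> Ob C. \<forall>D \<in> Ob C. \<forall>E \<in> Ob C.
        \<forall>f \<in> Arr C A B. \<forall>g \<in> Arr C B D. \<forall>h \<in> Arr C D E.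
          Cmp C A D E h (Cmp C A B D g f) = Cmp C A B E (Cmp C B D E h g) f)"

record ('o, 'm, 'p, 'n) functor_data =
  obj_map :: "'o \<Rightarrow> 'p"
  arr_map :: "'o \<Rightarrow> 'o \<Rightarrow> 'm \<Rightarrow> 'n"

definition functor_comp ::
    "('p, 'n, 'q, 'r) functor_data \<Rightarrow> ('o, 'm, 'p, 'n) functor_data \<Rightarrow>
     ('o, 'm, 'q, 'r) functor_data" (infixl \<open>\<circ>\<^sub>F\<close> 55) where
  "F \<circ>\<^sub>F H =
     \<lparr>obj_map = (\<lambda>A. obj_map F (obj_map H A)),
      arr_map = (\<lambda>A B f. arr_map F (obj_map H A) (obj_map H B) (arr_map H A B f))\<rparr>"

definition contravariant_gla_functor ::
    "('k, 'c) ring_scheme \<Rightarrow> ('o, 'm) category \<Rightarrow>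
     ('o, 'm, ('k, 'a) graded_algebra, nat \<Rightarrow> 'a \<Rightarrow> 'a) functor_data \<Rightarrow> bool" where
  "contravariant_gla_functor K C F \<longleftrightarrow>
     is_category C \<and>
     (\<forall>A \<in> Ob C. graded_lie_algebra K (obj_map F A)) \<and>
     (\<forall>A \<in> Ob C. \<forall>B \<in> Ob C. \<forall>f \<in> Arr C A B.
        arr_map F A B f \<in> gla_hom K (obj_map F B) (obj_map F A)) \<and>
     (\<forall>A \<in> Ob C. \<forall>n\<ge>1. \<forall>a \<in> carrier (component (obj_map F A) n).
        arr_map F A A (Id C A) n a = a) \<and>
     (\<forall>A \<in> Ob C. \<forall>B \<in> Ob C. \<forall>D \<in> Ob C. \<forall>f \<in> Arr C A B. \<forall>g \<in> Arr C B D.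
        \<forall>n\<ge>1. \<forall>a \<in> carrier (component (obj_map F D) n).
          arr_map F A D (Cmp C A B D g f) n a = arr_map F A B f n (arr_map F B D g n a))"

text \<open>The graded Lie algebras that are the values of \<open>F\<close> and \<open>H\<close> may have elements of different
  HOL types; both functors are regarded as functors to the category of all graded Lie algebras
  over \<open>K\<close>.\<close>

definition gla_natural_transformation ::
    "('k, 'c) ring_scheme \<Rightarrow> ('o, 'm) category \<Rightarrow>
     ('o, 'm, ('k, 'a) graded_algebra, nat \<Rightarrow> 'a \<Rightarrow> 'a) functor_data \<Rightarrow>
     ('o, 'm, ('k, 'b) graded_algebra, nat \<Rightarrow> 'b \<Rightarrow> 'b) functor_data \<Rightarrow>
     ('o \<Rightarrow> nat \<Rightarrow> 'a \<Rightarrow> 'b) \<Rightarrow> bool" where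
  "gla_natural_transformation K C F H \<eta> \<longleftrightarrow>
     contravariant_gla_functor K C F \<and> contravariant_gla_functor K C H \<and>
     (\<forall>A \<in> Ob C. \<eta> A \<in> gla_hom K (obj_map F A) (obj_map H A)) \<and>
     (\<forall>A \<in> Ob C. \<forall>B \<in> Ob C. \<forall>f \<in> Arr C A B.
        \<forall>n\<ge>1. \<forall>a \<in> carrier (component (obj_map F B) n).
          arr_map H A B f n (\<eta> B n a) = \<eta> A n (arr_map F A B f n a))"


section \<open>The functor from representations to graded Lie algebras\<close>

definition semidirect_mult ::
    "('k, 'g) leibniz \<Rightarrow> ('k, 'g, 'v) representation \<Rightarrow> ('g \<times> 'v) list \<Rightarrow> 'g \<times> 'v" where
  "semidirect_mult G V = (\<lambda>zs \<in> tuples 2 (direct_sum G (space V)).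
     let (x, u) = zs ! 0; (y, v) = zs ! 1
     in (bracket G x y, rhoL V x v \<oplus>\<^bsub>space V\<^esub> rhoR V y u))"

definition extend_by_zero ::
    "('k, 'g) leibniz \<Rightarrow> ('k, 'g, 'v) representation \<Rightarrow> nat \<Rightarrow> ('v list \<Rightarrow> 'g) \<Rightarrow>
     ('g \<times> 'v) list \<Rightarrow> 'g \<times> 'v" where
  "extend_by_zero G V n g =
     (\<lambda>zs \<in> tuples n (direct_sum G (space V)). (g (map snd zs), \<zero>\<^bsub>space V\<^esub>))"

text \<open>The iterated Balavoine bracket \<open>[[\<mu>, g\<^sub>1], g\<^sub>2]\<close> is an extension by zero; the element of
  \<open>Hom(\<otimes>\<^sup>m\<^sup>+\<^sup>n V, G)\<close> that it extends is recovered by restricting the arguments to \<open>V\<close> and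
  projecting to \<open>G\<close>. Maps with \<open>m\<close> arguments have degree \<open>m - 1\<close> for the Balavoine bracket.\<close>

definition derived_bracket ::
    "('k, 'g) leibniz \<Rightarrow> ('k, 'g, 'v) representation \<Rightarrow> nat \<Rightarrow> nat \<Rightarrow>
     ('v list \<Rightarrow> 'g) \<Rightarrow> ('v list \<Rightarrow> 'g) \<Rightarrow> 'v list \<Rightarrow> 'g" where
  "derived_bracket G V m n g1 g2 = (let E = direct_sum G (space V) in
     (\<lambda>vs \<in> tuples (m + n) (space V).
       fst ([((-1) ^ (m - 1) :: int)] \<cdot>\<^bsub>E\<^esub>
         balavoine E m (n - 1)
           (balavoine E 1 (m - 1) (semidirect_mult G V) (extend_by_zero G V m g1))
           (extend_by_zero G V n g2)
           (map (\<lambda>v. (\<zero>\<^bsub>G\<^esub>, v)) vs))))"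

definition controlling_gla ::
    "('k, 'c) ring_scheme \<Rightarrow> ('k, 'g) leibniz \<Rightarrow> ('k, 'g, 'v) representation \<Rightarrow>
     ('k, 'v list \<Rightarrow> 'g) graded_algebra" where
  "controlling_gla K G V =
     \<lparr>component = (\<lambda>n. hom_space K n (space V) G), gbracket = derived_bracket G V\<rparr>"

definition C_functor ::
    "('k, 'c) ring_scheme \<Rightarrow> ('k, 'g) leibniz \<Rightarrow>
     (('k, 'g, 'v) representation, 'v \<Rightarrow> 'v, ('k, 'v list \<Rightarrow> 'g) graded_algebra,
      nat \<Rightarrow> ('v list \<Rightarrow> 'g) \<Rightarrow> ('v list \<Rightarrow> 'g)) functor_data" where
  "C_functor K G =
     \<lparr>obj_map = controlling_gla K G,
      arr_map = (\<lambda>W V \<phi> n f. \<lambda>ws \<in> tuples n (space W). f (map \<phi> ws))\<rparr>"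


section \<open>Antisymmetric representations\<close>

definition antisym_reps ::
    "('k, 'c) ring_scheme \<Rightarrow> ('k, 'g) leibniz \<Rightarrow>
     (('k, 'g, 'v) representation, 'v \<Rightarrow> 'v) category" where
  "antisym_reps K G =
     \<lparr>Ob = {V. antisymmetric_rep K G V},
      Arr = rep_hom K G,
      Id = (\<lambda>V. \<lambda>v \<in> carrier (space V). v),
      Cmp = (\<lambda>U V W \<psi> \<phi>. compose (carrier (space U)) \<psi> \<phi>)\<rparr>"

definition I_a ::
    "('k, 'c) ring_scheme \<Rightarrow> ('k, 'g) leibniz \<Rightarrow>
     (('k, 'g, 'v) representation, 'v \<Rightarrow> 'v, ('k, 'g, 'v) representation, 'v \<Rightarrow> 'v) functor_data"
  where
  "I_a K G =
     \<lparr>obj_map = (\<lambda>V. \<lparr>space = space V, rhoL = rhoL V \<circ> leib_incl K G,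
                      rhoR = (\<lambda>x v. \<zero>\<^bsub>space V\<^esub>)\<rparr>),
      arr_map = (\<lambda>W V \<phi>. \<phi>)\<rparr>"

text \<open>\<open>\<theta>\<^sub>V\<close> is given on a coset \<open>A\<close> by the common value of \<open>\<rho>\<^sup>L\<close> on its representatives.\<close>

definition theta :: "('k, 'g, 'v) representation \<Rightarrow> 'g set \<Rightarrow> 'v \<Rightarrow> 'v" where
  "theta V A v = the_elem ((\<lambda>x. rhoL V x v) ` A)"

definition P_a ::
    "(('k, 'g, 'v) representation, 'v \<Rightarrow> 'v, ('k, 'g set, 'v) representation, 'v \<Rightarrow> 'v)
     functor_data" where
  "P_a =
     \<lparr>obj_map = (\<lambda>V. \<lparr>space = space V, rhoL = theta V, rhoR = (\<lambda>A v. \<zero>\<^bsub>space V\<^esub>)\<rparr>),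
      arr_map = (\<lambda>W V \<phi>. \<phi>)\<rparr>"

definition alpha ::
    "('k, 'c) ring_scheme \<Rightarrow> ('k, 'g) leibniz \<Rightarrow> ('k, 'g, 'v) representation \<Rightarrow>
     nat \<Rightarrow> ('v list \<Rightarrow> 'g) \<Rightarrow> 'v list \<Rightarrow> 'g" where
  "alpha K G V n g = compose (tuples n (space V)) (leib_incl K G) g"

definition beta ::
    "('k, 'c) ring_scheme \<Rightarrow> ('k, 'g) leibniz \<Rightarrow> ('k, 'g, 'v) representation \<Rightarrow>
     nat \<Rightarrow> ('v list \<Rightarrow> 'g) \<Rightarrow> 'v list \<Rightarrow> 'g set" where
  "beta K G V n f = compose (tuples n (space V)) (lie_proj K G) f"

end

theory Submission
  imports Defs
begin

text \<open>Feeding a vector of \<open>V\<close> as first argument is an odd derivation of the Balavoine bracket. When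
  \<open>\<rho>\<^sup>R = 0\<close> it kills the semidirect multiplication, so it is an odd derivation of the derived bracket
  as well. Hence the derived bracket obeys a recursion on the number of arguments whose base cases
  are the Leibniz bracket and the diagonal action of \<open>G\<close> on multilinear maps; antisymmetry, the Jacobi
  identity and compatibility with homomorphisms all follow from it by induction, with no shuffles
  left. Exactness is clear except for the surjectivity of \<open>\<beta>\<close>, for which maps are lifted along a
  linear section of the projection, given by a vector space complement of the Leibniz kernel.\<close>

section \<open>Signs in abelian groups\<close>

text \<open>A sum over permutations offers no direct handle for induction. The first argument
  provides one: every insertion either hands it to the outer map or lets the inner map swallow it,
  and the first alternative costs a sign given by the degree of the inner map. The price is paid in
  degree 0, where the bracket is the given Leibniz bracket: antisymmetry is claimed only if some
  argument is left, whereas the Jacobi identity, in its left Leibniz form, holds in all degrees.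

  Feeding vectors of V alone loses nothing, because the derived bracket is evaluated on V only;
  elements of G enter through the base cases. That such a feed kills the multiplication is the
  computation mu((0, v), (y, w)) = ([0, y], rho^L(0) w + rho^R(y) v) = 0.

  The recursive bracket takes its entries in the opposite order: {g1, g2} is the recursive bracket
  of g2 and g1. The choice matters for the base case, where an element on the left acts by the
  diagonal action.\<close>

definition alt :: "('e, 'd) ring_scheme \<Rightarrow> nat \<Rightarrow> 'e \<Rightarrow> 'e" where
  "alt E k a = (if even k then a else \<ominus>\<^bsub>E\<^esub> a)"

context abelian_group
begin

lemma alt_closed [simp, intro]: "a \<in> carrier G \<Longrightarrow> alt G k a \<in> carrier G"
  by (simp add: alt_def)

lemma alt_0 [simp]: "alt G 0 a = a" and alt_Suc_0: "alt G (Suc 0) a = \<ominus> a"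
  by (simp_all add: alt_def)

lemma alt_zero [simp]: "alt G k \<zero> = \<zero>"
  by (simp add: alt_def)

lemma alt_add: "a \<in> carrier G \<Longrightarrow> b \<in> carrier G \<Longrightarrow> alt G k (a \<oplus> b) = alt G k a \<oplus> alt G k b"
  by (simp add: alt_def minus_add)

lemma alt_alt: "a \<in> carrier G \<Longrightarrow> alt G k (alt G l a) = alt G (k + l) a"
  by (auto simp: alt_def)

lemma add_pow_neg1_int: "a \<in> carrier G \<Longrightarrow> [(- 1 :: int)] \<cdot> a = \<ominus> a"
  by (simp add: add_pow_int_lt)

text \<open>The definitions express signs as integer multiples. From here on they are parities,
  which a case distinction on \<open>even\<close> decides.\<close>

lemma add_pow_alt: "a \<in> carrier G \<Longrightarrow> [((- 1) ^ k :: int)] \<cdot> a = alt G k a"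
  by (auto simp: alt_def add_pow_neg1_int uminus_power_if add_pow_int_ge)

lemma add_pow_int_mult:
  "a \<in> carrier G \<Longrightarrow> [(s * t :: int)] \<cdot> a = [s] \<cdot> ([t] \<cdot> a)"
  by (metis add.int_pow_pow mult.commute)

lemma alt_finsum:
  "f \<in> A \<rightarrow> carrier G \<Longrightarrow> alt G k (finsum G f A) = (\<Oplus>x\<in>A. alt G k (f x))"
proof (induction A rule: infinite_finite_induct)
  case (insert x F)
  then show ?case by (simp add: alt_add finsum_insert Pi_def)
qed (auto simp: finsum_infinite)

text \<open>This identity and the next two are the additive bookkeeping in the induction steps of
  \<open>act_act\<close>, \<open>act_rec_bracket\<close> and \<open>rec_bracket_jacobi\<close>. For
  arbitrary elements they need only commutativity and, in the latter two, the parities of the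
  exponents. Here \<open>u\<close> is the term that occurs with both signs on the right and
  cancels.\<close>

lemma act_act_identity:
  assumes "p \<in> carrier G" "q \<in> carrier G" "r \<in> carrier G" "s \<in> carrier G" "t \<in> carrier G" "u \<in> carrier G"
  shows "(p \<oplus> q) \<ominus> r \<ominus> (s \<ominus> t) = (p \<ominus> (u \<ominus> t)) \<oplus> (q \<ominus> s \<ominus> (r \<ominus> u))"
proof -
  have "(p \<ominus> (u \<ominus> t)) \<oplus> (q \<ominus> s \<ominus> (r \<ominus> u)) = ((p \<oplus> q) \<ominus> r \<ominus> (s \<ominus> t)) \<oplus> (u \<oplus> \<ominus> u)"
    using assms by (simp add: a_minus_def minus_add a_ac del: r_neg l_neg r_neg1 r_neg2)
  then show ?thesis using assms by (simp add: r_neg)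
qed

lemma derivation_identity:
  assumes "p1 \<in> carrier G" "p2 \<in> carrier G" "q1 \<in> carrier G" "q2 \<in> carrier G" "r1 \<in> carrier G" "r2 \<in> carrier G"
  shows "((p1 \<oplus> p2) \<oplus> alt G m (q1 \<oplus> q2)) \<ominus> (r1 \<oplus> alt G m r2) =
    ((p1 \<ominus> r1) \<oplus> alt G m q1) \<oplus> (p2 \<oplus> alt G m (q2 \<ominus> r2))"
  using assms by (simp add: alt_def a_minus_def minus_add a_ac)

lemma jacobi_identity:
  assumes "p1 \<in> carrier G" "p2 \<in> carrier G" "q1 \<in> carrier G" "q2 \<in> carrier G" "r1 \<in> carrier G" "r2 \<in> carrier G"
    and "m = Suc m'" "n = Suc n'"
  shows "(p1 \<oplus> alt G (m' * n) p2) \<oplus> alt G m ((q1 \<oplus> alt G (m * n') q2) \<oplus> alt G n (r1 \<oplus> alt G (m * n) r2)) =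
    ((p1 \<oplus> alt G m q1) \<oplus> alt G (m + n) r1) \<oplus> alt G (m * n) (q2 \<oplus> alt G n (p2 \<oplus> alt G m r2))"
  using assms(1-6) unfolding assms(7,8)
  by (cases "even m'"; cases "even n'") (simp_all add: alt_def minus_add a_ac)

end

section \<open>Signed sums over shuffles\<close>

text \<open>The signed sum of \<open>F ys zs\<close> over all ways to split \<open>xs\<close> into a
  subsequence \<open>ys\<close> of length \<open>a\<close> and the complementary subsequence
  \<open>zs\<close>. If the head joins \<open>zs\<close>, it has to pass all \<open>Suc a\<close>
  letters of \<open>ys\<close>; this is the sign.\<close>

fun shf :: "('e, 'd) ring_scheme \<Rightarrow> nat \<Rightarrow> nat \<Rightarrow> ('a list \<Rightarrow> 'a list \<Rightarrow> 'e) \<Rightarrow> 'a list \<Rightarrow> 'e" where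
  "shf E 0 b F xs = F [] xs"
| "shf E (Suc a) 0 F xs = F xs []"
| "shf E (Suc a) (Suc b) F xs =
     shf E a (Suc b) (\<lambda>ys zs. F (hd xs # ys) zs) (tl xs) \<oplus>\<^bsub>E\<^esub>
     alt E (Suc a) (shf E (Suc a) b (\<lambda>ys zs. F ys (hd xs # zs)) (tl xs))"

lemma shf_0_right [simp]: "shf E a 0 F xs = F xs []" if "length xs = a"
  using that by (cases a) auto

context abelian_group
begin

lemma shf_closed:
  assumes "length xs = a + b"
    and "\<And>ys zs. length ys = a \<Longrightarrow> length zs = b \<Longrightarrow> set ys \<union> set zs \<subseteq> set xs \<Longrightarrow> F ys zs \<in> carrier G"
  shows "shf G a b F xs \<in> carrier G"
  using assms
proof (induction "a + b" arbitrary: a b xs F)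
  case 0
  then show ?case by auto
next
  case (Suc n)
  show ?case
  proof (cases "a = 0 \<or> b = 0")
    case True
    then show ?thesis using Suc.prems by (cases a) auto
  next
    case False
    then obtain a' b' where ab: "a = Suc a'" "b = Suc b'" by (meson not0_implies_Suc)
    obtain x xs' where xs: "xs = x # xs'" using Suc.prems ab by (cases xs) auto
    show ?thesis
      unfolding ab xs using Suc.hyps(2) Suc.prems(1) ab xs
      by (auto intro!: a_closed alt_closed Suc.hyps(1) Suc.prems(2))
  qed
qed

text \<open>The recursion read from the right end: a last letter that joins \<open>ys\<close> has to
  pass all \<open>Suc b\<close> letters of \<open>zs\<close>. Peeling the head off both sides yields
  the same four terms. Shuffle permutations split conveniently at the largest index, while the
  circle product is to be peeled at its first argument; this lemma connects the two.\<close>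

lemma shf_snoc:
  assumes "length xs = a + b + 1"
    and "\<And>ys zs. length ys = Suc a \<Longrightarrow> length zs = Suc b \<Longrightarrow> set ys \<union> set zs \<subseteq> insert x (set xs) \<Longrightarrow>
      F ys zs \<in> carrier G"
  shows "shf G (Suc a) (Suc b) F (xs @ [x]) =
     shf G (Suc a) b (\<lambda>ys zs. F ys (zs @ [x])) xs \<oplus>
     alt G (Suc b) (shf G a (Suc b) (\<lambda>ys zs. F (ys @ [x]) zs) xs)"
  using assms
proof (induction "a + b" arbitrary: a b xs F rule: less_induct)
  case less
  obtain y xs' where xs: "xs = y # xs'" using less.prems by (cases xs) auto
  have F: "length ys = Suc a \<Longrightarrow> length zs = Suc b \<Longrightarrow> set ys \<union> set zs \<subseteq> insert x (insert y (set xs')) \<Longrightarrow>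
      F ys zs \<in> carrier G" for ys zs
    using less.prems(2) unfolding xs by simp
  have len: "length xs' = a + b" using less.prems xs by simp
  let ?F1 = "\<lambda>ys zs. F (y # ys) zs" and ?F2 = "\<lambda>ys zs. F ys (y # zs)"
  define P where "P = shf G a b (\<lambda>ys zs. F (y # ys @ [x]) zs)"
  \<comment> \<open>When a count is 0, some of the four inner sums degenerate to a single value of
    \<open>F\<close> through the boundary equations of \<open>shf\<close>.\<close>
  consider (z) "a = 0" "b = 0" | (a) b' where "a = 0" "b = Suc b'" | (b) a' where "a = Suc a'" "b = 0"
    | (s) a' b' where "a = Suc a'" "b = Suc b'"
    by (metis not0_implies_Suc)
  then show ?case
  proof cases
    case z
    then show ?thesis using len xs F[of "[y]" "[x]"] F[of "[x]" "[y]"]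
      by (simp add: alt_Suc_0)
  next
    case a
    have 1: "shf G (Suc a) b ?F2 (xs' @ [x]) =
        shf G (Suc a) b' (\<lambda>ys zs. F ys (y # zs @ [x])) xs' \<oplus> 
        alt G b (shf G a b (\<lambda>ys zs. F (ys @ [x]) (y # zs)) xs')"
      unfolding a(2) by (rule less.hyps[of a b' xs' ?F2]) (use a len in \<open>auto intro!: F\<close>)
    have "shf G (Suc a) b' (\<lambda>ys zs. F ys (y # zs @ [x])) xs' \<in> carrier G"
      using a len by (auto intro!: shf_closed F)
    moreover have "F [x] (y # xs') \<in> carrier G" "F [y] (xs' @ [x]) \<in> carrier G"
      using a len by (auto intro!: F)
    moreover have "shf G (Suc a) (Suc b) F (xs @ [x]) =
        F [y] (xs' @ [x]) \<oplus> alt G (Suc a) (shf G (Suc a) b ?F2 (xs' @ [x]))"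
      by (simp add: xs a(1))
    moreover have "shf G (Suc a) b (\<lambda>ys zs. F ys (zs @ [x])) xs =
        F [y] (xs' @ [x]) \<oplus> alt G (Suc a) (shf G (Suc a) b' (\<lambda>ys zs. F ys (y # zs @ [x])) xs')"
      by (simp add: xs a)
    moreover have "shf G a b (\<lambda>ys zs. F (ys @ [x]) (y # zs)) xs' = F [x] (y # xs')"
      "shf G a (Suc b) (\<lambda>ys zs. F (ys @ [x]) zs) xs = F [x] (y # xs')"
      by (simp_all add: a(1) xs)
    ultimately show ?thesis unfolding 1 by (simp add: a(1) alt_def minus_add a_ac)
  next
    case b
    have 1: "shf G a (Suc b) ?F1 (xs' @ [x]) =
        shf G a b (\<lambda>ys zs. F (y # ys) (zs @ [x])) xs' \<oplus> 
        alt G (Suc b) (shf G a' (Suc b) (\<lambda>ys zs. F (y # ys @ [x]) zs) xs')"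
      unfolding b(1) by (rule less.hyps[of a' b xs' ?F1]) (use b len in \<open>auto intro!: F\<close>)
    have "shf G a' (Suc b) (\<lambda>ys zs. F (y # ys @ [x]) zs) xs' \<in> carrier G"
      using b len by (auto intro!: shf_closed F)
    moreover have "F (xs' @ [x]) [y] \<in> carrier G" "F (y # xs') [x] \<in> carrier G"
      using b len by (auto intro!: F)
    moreover have "shf G (Suc a) (Suc b) F (xs @ [x]) =
        shf G a (Suc b) ?F1 (xs' @ [x]) \<oplus> alt G (Suc a) (F (xs' @ [x]) [y])"
      using len by (simp add: xs b(2))
    moreover have "shf G a (Suc b) (\<lambda>ys zs. F (ys @ [x]) zs) xs =
        shf G a' (Suc b) (\<lambda>ys zs. F (y # ys @ [x]) zs) xs' \<oplus> alt G a (F (xs' @ [x]) [y])"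
      using len by (simp add: xs b)
    moreover have "shf G a b (\<lambda>ys zs. F (y # ys) (zs @ [x])) xs' = F (y # xs') [x]"
      "shf G (Suc a) b (\<lambda>ys zs. F ys (zs @ [x])) xs = F (y # xs') [x]"
      using len by (simp_all add: b(2) xs)
    ultimately show ?thesis unfolding 1 by (simp add: b(2) alt_def minus_add a_ac)
  next
    case s
    have 1: "shf G a (Suc b) ?F1 (xs' @ [x]) =
        shf G a b (\<lambda>ys zs. F (y # ys) (zs @ [x])) xs' \<oplus> 
        alt G (Suc b) (shf G a' (Suc b) (\<lambda>ys zs. F (y # ys @ [x]) zs) xs')"
      unfolding s(1) by (rule less.hyps[of a' b xs' ?F1]) (use s len in \<open>auto intro!: F\<close>)
    have 2: "shf G (Suc a) b ?F2 (xs' @ [x]) =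
        shf G (Suc a) b' (\<lambda>ys zs. F ys (y # zs @ [x])) xs' \<oplus> 
        alt G b (shf G a b (\<lambda>ys zs. F (ys @ [x]) (y # zs)) xs')"
      unfolding s(2) by (rule less.hyps[of a b' xs' ?F2]) (use s len in \<open>auto intro!: F\<close>)
    have c: "shf G a' (Suc b) (\<lambda>ys zs. F (y # ys @ [x]) zs) xs' \<in> carrier G"
      "shf G a b (\<lambda>ys zs. F (y # ys) (zs @ [x])) xs' \<in> carrier G"
      "shf G (Suc a) b' (\<lambda>ys zs. F ys (y # zs @ [x])) xs' \<in> carrier G"
      "shf G a b (\<lambda>ys zs. F (ys @ [x]) (y # zs)) xs' \<in> carrier G"
      using s len by (auto simp del: shf.simps intro!: shf_closed F)
    have "shf G (Suc a) (Suc b) F (xs @ [x]) = shf G a (Suc b) ?F1 (xs' @ [x]) \<oplus>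
        alt G (Suc a) (shf G (Suc a) b ?F2 (xs' @ [x]))"
      by (simp add: xs)
    moreover have "shf G (Suc a) b (\<lambda>ys zs. F ys (zs @ [x])) xs =
       shf G a b (\<lambda>ys zs. F (y # ys) (zs @ [x])) xs' \<oplus>
       alt G (Suc a) (shf G (Suc a) b' (\<lambda>ys zs. F ys (y # zs @ [x])) xs')"
      by (simp add: s xs)
    moreover have "shf G a (Suc b) (\<lambda>ys zs. F (ys @ [x]) zs) xs =
       shf G a' (Suc b) (\<lambda>ys zs. F (y # ys @ [x]) zs) xs' \<oplus>
       alt G a (shf G a b (\<lambda>ys zs. F (ys @ [x]) (y # zs)) xs')"
      by (simp add: s xs)
    ultimately show ?thesis unfolding 1 2 using c 
      by (simp add: alt_add alt_alt a_ac add_ac)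
  qed
qed

end

section \<open>Shuffle permutations, sorted by the block that contains the largest value\<close>

fun cyc :: "nat \<Rightarrow> nat \<Rightarrow> nat \<Rightarrow> nat" where
  "cyc a 0 = id"
| "cyc a (Suc k) = transpose (a + k) (a + Suc k) \<circ> cyc a k"

text \<open>The cycle carries position \<open>a\<close> to the end of a window of length k + 1.
  Building it from adjacent transpositions makes both its support and its sign inductive; afterwards
  it is evaluated only through this pointwise form.\<close>

lemma cyc_apply: "cyc a k i = (if i = a then a + k else if a < i \<and> i \<le> a + k then i - 1 else i)"
  by (induction k) (auto simp: transpose_def)

lemma cyc_permutes: "1 \<le> a \<Longrightarrow> a + k \<le> n \<Longrightarrow> cyc a k permutes {1..n}"
  by (induction k) (auto intro!: permutes_compose permutes_swap_id permutes_id)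

lemma sign_cyc: "sign (cyc a k) = (- 1) ^ k"
proof (induction k)
  case (Suc k)
  have "permutation (cyc a k)"
    by (induction k) (simp_all add: permutation_compose permutation_swap_id del: comp_apply o_apply)
  then show ?case
    using Suc by (simp add: sign_compose permutation_swap_id sign_swap_id del: comp_apply o_apply)
qed simp

declare cyc.simps [simp del]

text \<open>Strict increase forces i \<le> \<sigma> i, and a permutation of {1..b} with this
  property is the identity. This settles the shuffles with an empty block.\<close>

lemma strict_mono_on_permutes_eq_id:
  fixes \<sigma> :: "nat \<Rightarrow> nat"
  assumes p: "\<sigma> permutes {1..b}" and m: "strict_mono_on {1..b} \<sigma>"
  shows "\<sigma> = id"
proof -
  have i: "i \<le> \<sigma> i" if "i \<in> {1..b}" for i
    using that
  proof (induction i)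
    case (Suc i)
    show ?case
    proof (cases "i = 0")
      case True
      then show ?thesis using permutes_in_image[OF p, of "Suc i"] Suc.prems by auto
    next
      case False
      then have "i \<le> \<sigma> i" "\<sigma> i < \<sigma> (Suc i)" 
        using Suc m by (auto simp: strict_mono_on_def)
      then show ?thesis by simp
    qed
  qed simp
  show ?thesis by (rule permutes_natset_ge[OF p]) (use i in auto)
qed

lemma shuffle_perms_0_left: "shuffle_perms 0 b = {id}"
  using strict_mono_on_permutes_eq_id
  by (auto simp: shuffle_perms_def permutes_id strict_mono_on_def simp del: One_nat_def)

lemma shuffle_perms_0_right: "shuffle_perms a 0 = {id}"
  using strict_mono_on_permutes_eq_id
  by (auto simp: shuffle_perms_def permutes_id strict_mono_on_def simp del: One_nat_def)

lemma finite_shuffle_perms: "finite (shuffle_perms a b)"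
  by (rule finite_subset[OF _ finite_permutations[of "{1..a + b}"]]) (auto simp: shuffle_perms_def)

lemma shuffle_perms_Suc_Suc:
  "shuffle_perms (Suc a) (Suc b) =
     shuffle_perms (Suc a) b \<union> (\<lambda>\<tau>. \<tau> \<circ> cyc (Suc a) (Suc b)) ` shuffle_perms a (Suc b)"
  (is "?S = ?A \<union> ?f ` ?B")
proof (intro subset_antisym subsetI)
  let ?N = "Suc (Suc (a + b))" and ?c = "cyc (Suc a) (Suc b)"
  have c: "?c permutes {1..?N}" by (rule cyc_permutes) auto
  fix \<sigma> assume S: "\<sigma> \<in> ?S"
  have p: "\<sigma> permutes {1..?N}" using S by (simp add: shuffle_perms_def)
  have m1: "\<sigma> i < \<sigma> j" if "1 \<le> i" "i < j" "j \<le> Suc a" for i j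
    using S that by (auto simp: shuffle_perms_def strict_mono_on_def)
  have m2: "\<sigma> i < \<sigma> j" if "Suc (Suc a) \<le> i" "i < j" "j \<le> ?N" for i j
    using S that by (auto simp: shuffle_perms_def strict_mono_on_def)
  have le: "\<sigma> i \<le> ?N" if "1 \<le> i" "i \<le> ?N" for i
    using permutes_in_image[OF p, of i] that by auto
  obtain i where i: "\<sigma> i = ?N" using permutes_surj[OF p] by (metis surjD)
  have i': "1 \<le> i" "i \<le> ?N" using permutes_in_image[OF p, of i] i by auto
  show "\<sigma> \<in> ?A \<union> ?f ` ?B"
  proof (cases "i \<le> Suc a")
    case False
    \<comment> \<open>An increasing block can reach the overall maximum only at its last
      index.\<close>
    then have "i = ?N" using m2[of i ?N] le[of ?N] i i' by (cases "i = ?N") auto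
    then have "\<sigma> permutes {1..Suc (a + b)}" using i
      by (intro permutes_superset[OF p]) (auto simp: le_Suc_eq)
    then show ?thesis using S by (auto simp: shuffle_perms_def strict_mono_on_def)
  next
    case True
    then have ia: "i = Suc a" using m1[of i "Suc a"] le[of "Suc a"] i i' by (cases "i = Suc a") auto
    \<comment> \<open>Undoing the cycle moves position \<open>Suc a\<close> to the very end and the
      second block one place to the left.\<close>
    define \<tau> where "\<tau> = \<sigma> \<circ> Hilbert_Choice.inv ?c"
    have tc: "\<tau> (?c j) = \<sigma> j" for j using permutes_inverses[OF c] by (simp add: \<tau>_def)
    have 1: "\<tau> j = \<sigma> j" if "j \<le> a" for j using tc[of j] that by (simp add: cyc_apply)
    have 2: "\<tau> j = \<sigma> (Suc j)" if "Suc a \<le> j" "j < ?N" for j using tc[of "Suc j"] that by (simp add: cyc_apply)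
    have 3: "\<tau> ?N = ?N" using tc[of "Suc a"] i ia by (simp add: cyc_apply)
    have "\<tau> permutes {1..?N}" unfolding \<tau>_def by (intro permutes_compose permutes_inv c p)
    then have "\<tau> permutes {1..a + Suc b}" using 3
      by (rule_tac permutes_superset) (auto simp: le_Suc_eq)
    moreover have "strict_mono_on {1..a} \<tau>" using 1 m1 by (auto simp: strict_mono_on_def)
    moreover have "strict_mono_on {a + 1..a + Suc b} \<tau>" using 2 m2 by (auto simp: strict_mono_on_def)
    moreover have "\<sigma> = \<tau> \<circ> ?c" using tc by auto
    ultimately show ?thesis by (auto simp: shuffle_perms_def)
  qed
next
  let ?N = "Suc (Suc (a + b))" and ?c = "cyc (Suc a) (Suc b)"
  have c: "?c permutes {1..?N}" by (rule cyc_permutes) auto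
  fix \<sigma> assume "\<sigma> \<in> ?A \<union> ?f ` ?B"
  then consider "\<sigma> \<in> ?A" | \<tau> where "\<tau> \<in> ?B" "\<sigma> = \<tau> \<circ> ?c" by auto
  then show "\<sigma> \<in> ?S"
  proof cases
    case 1
    then have p: "\<sigma> permutes {1..Suc (a + b)}" by (simp add: shuffle_perms_def)
    have N: "\<sigma> ?N = ?N" by (rule permutes_not_in[OF p]) auto
    have le: "\<sigma> i < ?N" if "1 \<le> i" "i < ?N" for i
      using permutes_in_image[OF p, of i] that by auto
    have "\<sigma> permutes {1..?N}" by (rule permutes_subset[OF p]) auto
    then show ?thesis using 1 N le by (auto simp: shuffle_perms_def strict_mono_on_def le_Suc_eq)
  next
    case 2
    then have p: "\<tau> permutes {1..Suc (a + b)}" by (simp add: shuffle_perms_def)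
    have N: "\<tau> ?N = ?N" by (rule permutes_not_in[OF p]) auto
    have le: "\<tau> i < ?N" if "1 \<le> i" "i < ?N" for i
      using permutes_in_image[OF p, of i] that by auto
    have t: "\<tau> permutes {1..?N}" by (rule permutes_subset[OF p]) auto
    have "\<sigma> permutes {1..?N}" unfolding 2 by (intro permutes_compose c t)
    moreover have "strict_mono_on {1..Suc a} \<sigma>"
      using 2 N le by (auto simp: shuffle_perms_def strict_mono_on_def cyc_apply)
    moreover have "strict_mono_on {Suc a + 1..Suc a + Suc b} \<sigma>"
    proof (rule strict_mono_onI)
      fix i j assume ij: "i \<in> {Suc a + 1..Suc a + Suc b}" "j \<in> {Suc a + 1..Suc a + Suc b}" "i < j"
      have "strict_mono_on {a + 1..a + Suc b} \<tau>" using 2 by (simp add: shuffle_perms_def)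
      moreover have "i - 1 \<in> {a + 1..a + Suc b}" "j - 1 \<in> {a + 1..a + Suc b}" "i - 1 < j - 1"
        using ij by auto
      ultimately have "\<tau> (i - 1) < \<tau> (j - 1)" unfolding strict_mono_on_def by blast
      then show "\<sigma> i < \<sigma> j" using ij unfolding 2 by (simp add: cyc_apply)
    qed
    ultimately show ?thesis by (simp add: shuffle_perms_def)
  qed
qed

abbreviation (input) pick :: "'a list \<Rightarrow> (nat \<Rightarrow> nat) \<Rightarrow> nat \<Rightarrow> nat \<Rightarrow> 'a list" where
  "pick xs \<sigma> i j \<equiv> map (\<lambda>k. xs ! (\<sigma> k - 1)) [i..<j]"

text \<open>Peeling the last letter of \<open>xs\<close>, the two pieces of
  \<open>shuffle_perms_Suc_Suc\<close> become the two summands of \<open>shf_snoc\<close>; the sign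
  of the cycle is the sign in front of the second summand.\<close>

lemma (in abelian_group) finsum_shuffle_perms:
  assumes "length xs = a + b"
    and "\<And>ys zs. length ys = a \<Longrightarrow> length zs = b \<Longrightarrow> set ys \<union> set zs \<subseteq> set xs \<Longrightarrow> F ys zs \<in> carrier G"
  shows "(\<Oplus>\<sigma>\<in>shuffle_perms a b. [sign \<sigma>] \<cdot>
      F (pick xs \<sigma> 1 (a + 1)) (pick xs \<sigma> (a + 1) (a + b + 1))) =
    shf G a b F xs"
  using assms
proof (induction "a + b" arbitrary: a b xs F rule: less_induct)
  case less
  have id: "map (\<lambda>i. zs ! (i - 1)) [1..<length zs + 1] = zs" for zs :: "'c list"
    by (rule nth_equalityI) (auto simp del: upt_Suc)
  consider "a = 0" | "b = 0" | (s) a' b' where "a = Suc a'" "b = Suc b'"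
    by (metis not0_implies_Suc)
  then show ?case
  proof cases
    case 1
    then show ?thesis using less.prems id[of xs] by (simp add: shuffle_perms_0_left)
  next
    case 2
    then show ?thesis using less.prems id[of xs] by (simp add: shuffle_perms_0_right)
  next
    case s
    let ?N = "Suc (Suc (a' + b'))" and ?c = "cyc a b"
    obtain xs' x where xs: "xs = xs' @ [x]" using less.prems(1) s
      by (metis add_Suc_right length_0_conv nat.distinct(1) rev_exhaust)
    have len: "length xs' = Suc (a' + b')" using xs less.prems(1) s by simp
    have F: "length ys = a \<Longrightarrow> length zs = b \<Longrightarrow> set ys \<union> set zs \<subseteq> insert x (set xs') \<Longrightarrow>
      F ys zs \<in> carrier G" for ys zs
      using less.prems(2)[of ys zs] by (simp add: xs)
    let ?t = "\<lambda>\<sigma>. [sign \<sigma>] \<cdot> F (pick xs \<sigma> 1 (a + 1)) (pick xs \<sigma> (a + 1) (a + b + 1))"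
    have tc: "?t \<sigma> \<in> carrier G" if "\<sigma> \<in> shuffle_perms a b" for \<sigma>
    proof -
      have "\<sigma> permutes {1..a + b}" using that by (simp add: shuffle_perms_def)
      then have "\<sigma> i \<in> {1..a + b}" if "i \<in> {1..a + b}" for i using that by (simp only: permutes_in_image)
      then have "xs ! (\<sigma> i - 1) \<in> set xs" if "i \<in> {1..a + b}" for i
        using that less.prems(1) by (intro nth_mem) fastforce
      then show ?thesis
        by (intro add.int_pow_closed less.prems(2)) (auto simp del: One_nat_def)
    qed
    let ?A = "shuffle_perms a b'" and ?B = "shuffle_perms a' b"
    have S: "shuffle_perms a b = ?A \<union> (\<lambda>\<tau>. \<tau> \<circ> ?c) ` ?B"
      unfolding s by (rule shuffle_perms_Suc_Suc)
    have pA: "\<sigma> permutes {1..Suc (a' + b')}" if "\<sigma> \<in> ?A" for \<sigma> using that s by (simp add: shuffle_perms_def)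
    have pB: "\<sigma> permutes {1..Suc (a' + b')}" if "\<sigma> \<in> ?B" for \<sigma> using that s by (simp add: shuffle_perms_def)
    have NA: "\<sigma> ?N = ?N" if "\<sigma> \<in> ?A" for \<sigma> by (rule permutes_not_in[OF pA[OF that]]) auto
    have NB: "\<sigma> ?N = ?N" if "\<sigma> \<in> ?B" for \<sigma> by (rule permutes_not_in[OF pB[OF that]]) auto
    have lA: "\<sigma> i \<in> {1..Suc (a' + b')}" if "\<sigma> \<in> ?A" "1 \<le> i" "i < ?N" for \<sigma> i
      using permutes_in_image[OF pA[OF that(1)], of i] that by auto
    have lB: "\<sigma> i \<in> {1..Suc (a' + b')}" if "\<sigma> \<in> ?B" "1 \<le> i" "i < ?N" for \<sigma> i
      using permutes_in_image[OF pB[OF that(1)], of i] that by auto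
    have c: "?c permutes {1..?N}" unfolding s by (rule cyc_permutes) auto
    have inj: "inj_on (\<lambda>\<tau>. \<tau> \<circ> ?c) ?B"
      by (rule inj_onI) (metis fun.map_comp comp_id permutes_inv_o(1)[OF c])
    have disj: "?A \<inter> (\<lambda>\<tau>. \<tau> \<circ> ?c) ` ?B = {}"
    proof -
      \<comment> \<open>The first piece fixes the largest index, the second sends it to a smaller
        one.\<close>
      have "(\<tau> \<circ> ?c) ?N \<noteq> ?N" if "\<tau> \<in> ?B" for \<tau>
        using lB[OF that, of "Suc (a' + b')"] s by (simp add: cyc_apply)
      then show ?thesis using NA by blast
    qed
    have sumA: "(\<Oplus>\<sigma>\<in>?A. ?t \<sigma>) = shf G a b' (\<lambda>ys zs. F ys (zs @ [x])) xs'"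
    proof -
      have "?t \<sigma> = [sign \<sigma>] \<cdot> F (pick xs' \<sigma> 1 (a + 1))
          (pick xs' \<sigma> (a + 1) (a + b' + 1) @ [x])" if "\<sigma> \<in> ?A" for \<sigma>
      proof -
        have e: "xs ! (\<sigma> i - 1) = xs' ! (\<sigma> i - 1)" if "1 \<le> i" "i < ?N" for i
          using lA[OF \<open>\<sigma> \<in> ?A\<close> that] len by (auto simp: xs nth_append)
        have "pick xs \<sigma> 1 (a + 1) = pick xs' \<sigma> 1 (a + 1)"
          by (rule map_cong) (use e s in auto)
        moreover have "pick xs \<sigma> (a + 1) (a + b' + 1) = pick xs' \<sigma> (a + 1) (a + b' + 1)"
          by (rule map_cong) (use e s in auto)
        moreover have "xs ! (\<sigma> ?N - 1) = x" using NA[OF that] len by (simp add: xs nth_append)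
        moreover have "[a + 1..<a + b + 1] = [a + 1..<a + b' + 1] @ [?N]"
          using upt_Suc_append[of "a + 1" "a + b' + 1"] s by (simp del: upt_Suc)
        ultimately show ?thesis by (simp only: map_append list.map)
      qed
      note tA = this
      have "[sign \<sigma>] \<cdot> F (pick xs' \<sigma> 1 (a + 1))
          (pick xs' \<sigma> (a + 1) (a + b' + 1) @ [x]) \<in> carrier G" if "\<sigma> \<in> ?A" for \<sigma>
        using tc[of \<sigma>] unfolding tA[OF that] using S that by blast
      then have "(\<Oplus>\<sigma>\<in>?A. ?t \<sigma>) = (\<Oplus>\<sigma>\<in>?A. [sign \<sigma>] \<cdot> F (pick xs' \<sigma> 1 (a + 1))
          (pick xs' \<sigma> (a + 1) (a + b' + 1) @ [x]))"
        using tA by (intro finsum_cong') (simp_all del: One_nat_def upt_Suc)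
      also have "\<dots> = shf G a b' (\<lambda>ys zs. F ys (zs @ [x])) xs'"
        by (rule less.hyps) (use s len in \<open>auto intro!: F\<close>)
      finally show ?thesis .
    qed
    have sumB: "(\<Oplus>\<tau>\<in>?B. ?t (\<tau> \<circ> ?c)) = alt G b (shf G a' b (\<lambda>ys zs. F (ys @ [x]) zs) xs')"
    proof -
      let ?u = "\<lambda>\<tau>. [sign \<tau>] \<cdot> F (pick xs' \<tau> 1 (a' + 1) @ [x])
            (pick xs' \<tau> (a' + 1) (a' + b + 1))"
      have u: "?u \<tau> \<in> carrier G" if "\<tau> \<in> ?B" for \<tau>
      proof -
        have "xs' ! (\<tau> i - 1) \<in> set xs'" if "1 \<le> i" "i < ?N" for i
          using lB[OF \<open>\<tau> \<in> ?B\<close> that] len by (intro nth_mem) fastforce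
        then show ?thesis using s
          by (intro add.int_pow_closed F) (auto simp del: One_nat_def)
      qed
      have "?t (\<tau> \<circ> ?c) = alt G b (?u \<tau>)" if "\<tau> \<in> ?B" for \<tau>
      proof -
        have e: "xs ! (\<tau> i - 1) = xs' ! (\<tau> i - 1)" if "1 \<le> i" "i < ?N" for i
          using lB[OF \<open>\<tau> \<in> ?B\<close> that] len by (auto simp: xs nth_append)
        have "pick xs (\<tau> \<circ> ?c) 1 (a' + 1) = pick xs' \<tau> 1 (a' + 1)"
          by (rule map_cong) (use e s in \<open>auto simp: cyc_apply\<close>)
        moreover have "xs ! ((\<tau> \<circ> ?c) a - 1) = x"
          using NB[OF that] len s by (simp add: xs nth_append cyc_apply)
        \<comment> \<open>Beyond position \<open>a\<close> the cycle lowers indices by one, so the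
          second block a + 1, ..., a + b is read at a' + 1, ..., a' + b.\<close>
        moreover have "pick xs (\<tau> \<circ> ?c) (a + 1) (a + b + 1) = pick xs' \<tau> (a' + 1) (a' + b + 1)"
          (is "?l = ?r")
        proof (rule nth_equalityI)
          fix i assume "i < length ?l"
          then have "i < b" by (simp del: upt_Suc)
          then show "?l ! i = ?r ! i" using e[of "a + i"] s 
            by (simp add: cyc_apply del: upt_Suc)
        qed (simp add: s del: upt_Suc)
        moreover have "[1..<a + 1] = [1..<a' + 1] @ [a]"
          using upt_Suc_append[of 1 "a' + 1"] s by (simp del: upt_Suc)
        ultimately have "?t (\<tau> \<circ> ?c) = [sign (\<tau> \<circ> ?c)] \<cdot> F (pick xs' \<tau> 1 (a' + 1) @ [x])
            (pick xs' \<tau> (a' + 1) (a' + b + 1))"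
          by (simp only: map_append list.map)
        moreover have "sign (\<tau> \<circ> ?c) = (- 1) ^ b * sign \<tau>"
          using pB[OF that] c
          by (subst sign_compose) (auto simp: sign_cyc permutation_permutes)
        moreover have "F (pick xs' \<tau> 1 (a' + 1) @ [x])
            (pick xs' \<tau> (a' + 1) (a' + b + 1)) \<in> carrier G"
        proof -
          have "xs' ! (\<tau> i - 1) \<in> set xs'" if "1 \<le> i" "i < ?N" for i
            using lB[OF \<open>\<tau> \<in> ?B\<close> that] len by (intro nth_mem) fastforce
          then show ?thesis using s
            by (intro F) (auto simp del: One_nat_def)
        qed
        ultimately show ?thesis by (simp only: add_pow_int_mult) (simp add: add_pow_alt)
      qed
      then have "(\<Oplus>\<tau>\<in>?B. ?t (\<tau> \<circ> ?c)) = (\<Oplus>\<tau>\<in>?B. alt G b (?u \<tau>))"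
        using u by (intro finsum_cong') (auto simp del: One_nat_def)
      also have "\<dots> = alt G b (\<Oplus>\<tau>\<in>?B. ?u \<tau>)"
        by (rule alt_finsum[symmetric]) (use u in auto)
      also have "(\<Oplus>\<tau>\<in>?B. ?u \<tau>) = shf G a' b (\<lambda>ys zs. F (ys @ [x]) zs) xs'"
        by (rule less.hyps) (use s len in \<open>auto intro!: F\<close>)
      finally show ?thesis .
    qed
    have "(\<Oplus>\<sigma>\<in>shuffle_perms a b. ?t \<sigma>) = (\<Oplus>\<sigma>\<in>?A. ?t \<sigma>) \<oplus> (\<Oplus>\<sigma>\<in>(\<lambda>\<tau>. \<tau> \<circ> ?c) ` ?B. ?t \<sigma>)"
      unfolding S by (rule finsum_Un_disjoint[OF finite_shuffle_perms finite_imageI[OF finite_shuffle_perms] disj])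
        (use tc S in blast)+
    also have "(\<Oplus>\<sigma>\<in>(\<lambda>\<tau>. \<tau> \<circ> ?c) ` ?B. ?t \<sigma>) = (\<Oplus>\<tau>\<in>?B. ?t (\<tau> \<circ> ?c))"
      by (rule finsum_reindex[OF _ inj]) (use tc S in blast)
    also have "(\<Oplus>\<sigma>\<in>?A. ?t \<sigma>) \<oplus> (\<Oplus>\<tau>\<in>?B. ?t (\<tau> \<circ> ?c)) = shf G a b F xs"
      unfolding sumA sumB unfolding s xs 
      by (rule shf_snoc[symmetric]) (use s len in \<open>auto intro!: F\<close>)
    finally show ?thesis .
  qed
qed

text \<open>Mirrors the defining equations of \<open>pre_lie\<close> and \<open>rec_bracket\<close>,
  in which either argument count may run out first.\<close>

lemma nat_pair_cases [case_names 1 2 s]: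
  fixes m n :: nat
  obtains "m = 0" | m' where "m = Suc m'" "n = 0" | m' n' where "m = Suc m'" "n = Suc n'"
  by (metis not0_implies_Suc)

section \<open>A recursion for the circle product\<close>

lemma tuples_0 [simp]: "tuples 0 E = {[]}"
  by (auto simp: tuples_def)

lemma Cons_in_tuples [simp]: "x # xs \<in> tuples (Suc n) E \<longleftrightarrow> x \<in> carrier E \<and> xs \<in> tuples n E"
  by (auto simp: tuples_def)

lemma tuples_SucE:
  assumes "xs \<in> tuples (Suc n) E"
  obtains y ys where "xs = y # ys" "y \<in> carrier E" "ys \<in> tuples n E"
  using assms by (cases xs) (auto simp: tuples_def)

lemma tuples_length: "xs \<in> tuples n E \<Longrightarrow> length xs = n"
  by (simp add: tuples_def)

abbreviation (input) feed :: "'a \<Rightarrow> ('a list \<Rightarrow> 'b) \<Rightarrow> 'a list \<Rightarrow> 'b" where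
  "feed x f \<equiv> \<lambda>xs. f (x # xs)"

text \<open>The k-th summand of the circle product for k = j + 1, with its shuffle sum in recursive
  form. The first \<open>j + q\<close> arguments are shuffled, and \<open>xs ! (j + q)\<close> is
  the argument x_(k+q) that always remains last inside \<open>Q\<close>.\<close>

definition ins_term ::
    "('e, 'd) ring_scheme \<Rightarrow> nat \<Rightarrow> nat \<Rightarrow> ('e list \<Rightarrow> 'e) \<Rightarrow> ('e list \<Rightarrow> 'e) \<Rightarrow> 'e list \<Rightarrow> 'e" where
  "ins_term E j q P Q xs =
     alt E (j * q) (shf E j q
       (\<lambda>ys zs. P (ys @ [Q (zs @ [xs ! (j + q)])] @ drop (j + q + 1) xs)) (take (j + q) xs))"

text \<open>Here \<open>a\<close> and \<open>b\<close> are the numbers of arguments of \<open>P\<close> and \<open>Q\<close>; unlike in \<^const>\<open>circ\<close>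
  they may be 0.\<close>

fun pre_lie :: "('e, 'd) ring_scheme \<Rightarrow> nat \<Rightarrow> nat \<Rightarrow> ('e list \<Rightarrow> 'e) \<Rightarrow> ('e list \<Rightarrow> 'e) \<Rightarrow> 'e list \<Rightarrow> 'e" where
  "pre_lie E 0 b P Q xs = \<zero>\<^bsub>E\<^esub>"
| "pre_lie E (Suc a) 0 P Q xs = P (Q [] # xs)"
| "pre_lie E (Suc a) (Suc b) P Q xs =
     pre_lie E (Suc a) b P (feed (hd xs) Q) (tl xs) \<oplus>\<^bsub>E\<^esub>
     alt E b (pre_lie E a (Suc b) (feed (hd xs) P) Q (tl xs))"

text \<open>\<open>P\<close> is evaluated only at tuples into which a value of \<open>Q\<close> has
  been inserted; with these values in the carrier, agreement on tuples suffices.\<close>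

lemma pre_lie_cong:
  assumes "xs \<in> tuples (a + b - 1) E"
    and "\<And>ys. ys \<in> tuples a E \<Longrightarrow> P ys = P' ys"
    and "\<And>ys. ys \<in> tuples b E \<Longrightarrow> Q ys = Q' ys"
    and "\<And>ys. ys \<in> tuples b E \<Longrightarrow> Q ys \<in> carrier E"
  shows "pre_lie E a b P Q xs = pre_lie E a b P' Q' xs"
  using assms
proof (induction E a b P Q xs arbitrary: P' Q' rule: pre_lie.induct)
  case (2 E a P Q xs)
  then show ?case by auto
next
  case (3 E a b P Q xs)
  obtain x xs' where xs: "xs = x # xs'" "x \<in> carrier E" "xs' \<in> tuples (a + b) E"
    using "3.prems"(1) by (auto elim: tuples_SucE)
  have "pre_lie E (Suc a) b P (feed x Q) xs' = pre_lie E (Suc a) b P' (feed x Q') xs'"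
    using "3.IH"(1)[of P' "feed x Q'"] "3.prems" xs by auto
  moreover have "pre_lie E a (Suc b) (feed x P) Q xs' = pre_lie E a (Suc b) (feed x P') Q' xs'"
    using "3.IH"(2)[of "feed x P'" Q'] "3.prems" xs by auto
  ultimately show ?case by (simp add: xs)
qed auto

locale abelian_module_group = abelian_group E for E :: "('k, 'e) module" (structure)
begin

lemma pre_lie_closed:
  assumes "xs \<in> tuples (a + b - 1) E"
    and "\<And>ys. ys \<in> tuples a E \<Longrightarrow> P ys \<in> carrier E"
    and "\<And>ys. ys \<in> tuples b E \<Longrightarrow> Q ys \<in> carrier E"
  shows "pre_lie E a b P Q xs \<in> carrier E"
  using assms
proof (induction "a + b" arbitrary: a b P Q xs rule: less_induct)
  case less
  show ?case
  proof (cases rule: nat_pair_cases[where m = a and n = b])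
    case (s a' b')
    obtain x xs' where xs: "xs = x # xs'" "x \<in> carrier E" "xs' \<in> tuples (a' + b') E"
      using less.prems(1) s by (auto elim: tuples_SucE)
    show ?thesis
      using less.prems(2,3) xs s
      by (auto intro!: a_closed alt_closed less.hyps)
  qed (use less.prems in auto)
qed

text \<open>The head is shuffled either into the arguments of \<open>Q\<close> or into those of
  \<open>P\<close> that precede \<open>Q\<close>. If nothing is shuffled, that is j = q = 0, the
  head is itself the pinned last argument of \<open>Q\<close>.\<close>

lemma ins_term_Cons:
  assumes "x # xs \<in> tuples (p + q + 1) E" "j \<le> p"
    and P: "\<And>ys. ys \<in> tuples (Suc p) E \<Longrightarrow> P ys \<in> carrier E"
    and Q: "\<And>ys. ys \<in> tuples (Suc q) E \<Longrightarrow> Q ys \<in> carrier E"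
  shows "ins_term E j q P Q (x # xs) =
    (if q = 0 then if j = 0 then P (Q [x] # xs) else ins_term E (j - 1) q (feed x P) Q xs
     else if j = 0 then ins_term E j (q - 1) P (feed x Q) xs
     else ins_term E j (q - 1) P (feed x Q) xs \<oplus>
       alt E q (ins_term E (j - 1) q (feed x P) Q xs))"
proof (cases "q = 0 \<or> j = 0")
  case True
  have "length xs = p + q" using assms(1) by (auto dest: tuples_length)
  then show ?thesis using True assms(2) 
    by (cases j; cases q) (auto simp: ins_term_def)
next
  case False
  then obtain j' q' where jq: "j = Suc j'" "q = Suc q'" by (meson not0_implies_Suc)
  have xs: "x \<in> carrier E" "xs \<in> tuples (p + q) E" using assms(1) by auto
  then have len: "length xs = p + q" and sub: "set xs \<subseteq> carrier E" by (auto simp: tuples_def)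
  let ?l = "take (j + q') xs"
  let ?F = "\<lambda>ys zs. P (ys @ [Q (zs @ [xs ! (j + q')])] @ drop (j + q' + 1) xs)"
  have ll: "length ?l = j' + q" using len jq assms(2) by simp
  have F: "?F ys zs \<in> carrier E" if "ys \<in> tuples j E" "zs \<in> tuples q E" for ys zs
  proof -
    have "xs ! (j + q') \<in> carrier E" using sub len assms(2) jq by (intro subsetD[OF sub] nth_mem) auto
    then have "Q (zs @ [xs ! (j + q')]) \<in> carrier E" using that by (intro Q) (auto simp: tuples_def)
    moreover have "set (drop (j + q' + 1) xs) \<subseteq> carrier E" using sub set_drop_subset by fast
    ultimately show ?thesis using that assms(2) jq len by (intro P) (auto simp: tuples_def)
  qed
  have l: "set ?l \<subseteq> carrier E" using sub set_take_subset by fast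
  have c: "shf E j' q (\<lambda>ys zs. ?F (x # ys) zs) ?l \<in> carrier E" 
    using ll l jq xs(1) by (intro shf_closed F) (auto simp: tuples_def)
  have d: "shf E j q' (\<lambda>ys zs. ?F ys (x # zs)) ?l \<in> carrier E" 
    using ll l jq xs(1) by (intro shf_closed F) (auto simp: tuples_def)
  have "ins_term E j q P Q (x # xs) = alt E (j * q) (shf E j q ?F (x # ?l))"
    by (simp add: ins_term_def jq del: shf.simps)
  also have "shf E j q ?F (x # ?l) = shf E j' q (\<lambda>ys zs. ?F (x # ys) zs) ?l \<oplus>
      alt E j (shf E j q' (\<lambda>ys zs. ?F ys (x # zs)) ?l)"
    unfolding jq by simp
  \<comment> \<open>The prefactor (-1)^(jq) absorbs the shuffle signs: jq + j has the parity of j(q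
    - 1), and jq = (j - 1)q + q leaves (-1)^q in front of the branch through
    \<open>P\<close>.\<close>
  also have "alt E (j * q) \<dots> = alt E (j * q') (shf E j q' (\<lambda>ys zs. ?F ys (x # zs)) ?l) \<oplus>
      alt E q (alt E (j' * q) (shf E j' q (\<lambda>ys zs. ?F (x # ys) zs) ?l))"
  proof -
    have "alt E (j * q) (u \<oplus> alt E j v) = alt E (j * q') v \<oplus> alt E q (alt E (j' * q) u)"
      if "u \<in> carrier E" "v \<in> carrier E" for u v
      using that a_comm[of u v] a_comm[of "\<ominus> u" v] a_comm[of u "\<ominus> v"] a_comm[of "\<ominus> u" "\<ominus> v"]
      by (cases "even j'"; cases "even q'") (simp_all add: alt_def jq minus_add)
    then show ?thesis using c d .
  qed
  also have "\<dots> = ins_term E j q' P (feed x Q) xs \<oplus>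
      alt E q (ins_term E j' q (feed x P) Q xs)"
    by (simp add: ins_term_def jq del: shf.simps)
  finally show ?thesis using jq by simp
qed

lemma ins_term_closed:
  assumes "xs \<in> tuples (p + q + 1) E" "j \<le> p"
    and P: "\<And>ys. ys \<in> tuples (Suc p) E \<Longrightarrow> P ys \<in> carrier E"
    and Q: "\<And>ys. ys \<in> tuples (Suc q) E \<Longrightarrow> Q ys \<in> carrier E"
  shows "ins_term E j q P Q xs \<in> carrier E"
proof -
  have len: "length xs = p + q + 1" and sub: "set xs \<subseteq> carrier E" using assms(1) by (auto simp: tuples_def)
  have x: "xs ! (j + q) \<in> carrier E" using sub len assms(2) by (intro subsetD[OF sub] nth_mem) auto
  have d: "set (drop (j + q + 1) xs) \<subseteq> carrier E" using sub set_drop_subset by fast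
  have t: "set (take (j + q) xs) \<subseteq> carrier E" using sub set_take_subset by fast
  show ?thesis unfolding ins_term_def
  proof (intro alt_closed shf_closed)
    fix ys zs assume "length ys = j" "length zs = q" "set ys \<union> set zs \<subseteq> set (take (j + q) xs)"
    moreover from this have "Q (zs @ [xs ! (j + q)]) \<in> carrier E" using x t 
      by (intro Q) (auto simp: tuples_def)
    ultimately show "P (ys @ [Q (zs @ [xs ! (j + q)])] @ drop (j + q + 1) xs) \<in> carrier E"
      using x t d len assms(2) by (intro P) (auto simp: tuples_def)
  qed (use len assms(2) in auto)
qed

text \<open>Summing \<open>ins_term_Cons\<close> over \<open>j\<close> produces the recursion of
  \<open>pre_lie\<close>. The branch through \<open>P\<close> lowers the insertion index by one, so
  after reindexing both families are again complete sums. The term j = 0 has no such branch and is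
  split off; for q = 0 it is the base case in which \<open>Q\<close> has run out of
  arguments.\<close>

lemma finsum_ins_term:
  assumes "xs \<in> tuples (a + q) E"
    and "\<And>ys. ys \<in> tuples a E \<Longrightarrow> P ys \<in> carrier E"
    and "\<And>ys. ys \<in> tuples (Suc q) E \<Longrightarrow> Q ys \<in> carrier E"
  shows "(\<Oplus>j\<in>{..<a}. ins_term E j q P Q xs) = pre_lie E a (Suc q) P Q xs"
  using assms
proof (induction "a + q" arbitrary: a q P Q xs rule: less_induct)
  case less
  show ?case
  proof (cases a)
    case 0
    then show ?thesis by simp
  next
    case (Suc p)
    obtain x xs' where xs: "xs = x # xs'" "x \<in> carrier E" "xs' \<in> tuples (p + q) E"
      using less.prems(1) Suc by (auto elim: tuples_SucE)
    have P: "\<And>ys. ys \<in> tuples (Suc p) E \<Longrightarrow> P ys \<in> carrier E" using less.prems(2) Suc by simp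
    let ?P = "feed x P" and ?Q = "feed x Q"
    have P': "\<And>ys. ys \<in> tuples p E \<Longrightarrow> ?P ys \<in> carrier E" using P xs by simp
    have T: "ins_term E j q P Q xs =
      (if q = 0 then if j = 0 then P (Q [x] # xs') else ins_term E (j - 1) q ?P Q xs'
       else if j = 0 then ins_term E j (q - 1) P ?Q xs'
       else ins_term E j (q - 1) P ?Q xs' \<oplus> alt E q (ins_term E (j - 1) q ?P Q xs'))"
      if "j \<le> p" for j
      unfolding xs(1) by (rule ins_term_Cons) (use that xs P less.prems(3) in auto)
    have I1: "(\<Oplus>j\<in>{..<p}. ins_term E j q ?P Q xs') = pre_lie E p (Suc q) ?P Q xs'"
      using Suc xs P' less.prems(3) by (intro less.hyps) auto
    have cl1: "ins_term E j q ?P Q xs' \<in> carrier E" if "j < p" for j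
      using that xs P' less.prems(3) by (intro ins_term_closed[of _ "p - 1"]) auto
    have split: "{..<a} = insert 0 (Suc ` {..<p})" 
      unfolding Suc by (rule lessThan_Suc_eq_insert_0)
    show ?thesis
    proof (cases q)
      case 0
      have T0: "ins_term E 0 q P Q xs = P (Q [x] # xs')" using T[of 0] 0 by simp
      have TS: "ins_term E (Suc j) q P Q xs = ins_term E j q ?P Q xs'" if "j < p" for j
        using T[of "Suc j"] that 0 by simp
      have z: "P (Q [x] # xs') \<in> carrier E" using P xs less.prems(3)[of "[x]"] 0 by simp
      have "(\<Oplus>j\<in>{..<a}. ins_term E j q P Q xs) =
          P (Q [x] # xs') \<oplus> (\<Oplus>j\<in>Suc ` {..<p}. ins_term E j q P Q xs)"
        unfolding split using cl1 z by (subst finsum_insert) (auto simp: T0 TS)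
      also have "(\<Oplus>j\<in>Suc ` {..<p}. ins_term E j q P Q xs) = (\<Oplus>j\<in>{..<p}. ins_term E (Suc j) q P Q xs)"
        using cl1 by (intro finsum_reindex) (auto simp: T0 TS)
      also have "\<dots> = (\<Oplus>j\<in>{..<p}. ins_term E j q ?P Q xs')"
        using cl1 by (intro finsum_cong') (auto simp: T0 TS)
      finally show ?thesis unfolding I1 by (simp add: 0 Suc xs)
    next
      case (Suc q')
      have T0: "ins_term E 0 q P Q xs = ins_term E 0 q' P ?Q xs'" using T[of 0] Suc by simp
      have TS: "ins_term E (Suc j) q P Q xs =
          ins_term E (Suc j) q' P ?Q xs' \<oplus> alt E q (ins_term E j q ?P Q xs')" if "j < p" for j
        using T[of "Suc j"] that Suc by simp
      have cl2: "ins_term E j q' P ?Q xs' \<in> carrier E" if "j \<le> p" for j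
        using that xs P less.prems(3) Suc by (intro ins_term_closed[of _ p]) auto
      have I2: "(\<Oplus>j\<in>{..<a}. ins_term E j q' P ?Q xs') = pre_lie E a (Suc q') P ?Q xs'"
        using Suc \<open>a = Suc p\<close> xs P less.prems(3) by (intro less.hyps) auto
      have "(\<Oplus>j\<in>{..<a}. ins_term E j q P Q xs) =
          ins_term E 0 q' P ?Q xs' \<oplus> (\<Oplus>j\<in>Suc ` {..<p}. ins_term E j q P Q xs)"
        unfolding split using cl1 cl2 by (subst finsum_insert) (auto simp: T0 TS)
      also have "(\<Oplus>j\<in>Suc ` {..<p}. ins_term E j q P Q xs) = (\<Oplus>j\<in>{..<p}. ins_term E (Suc j) q P Q xs)"
        using cl1 cl2 by (intro finsum_reindex) (auto simp: T0 TS)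
      also have "\<dots> = (\<Oplus>j\<in>{..<p}. ins_term E (Suc j) q' P ?Q xs' \<oplus> alt E q (ins_term E j q ?P Q xs'))"
        using cl1 cl2 by (intro finsum_cong') (auto simp: T0 TS)
      also have "\<dots> = (\<Oplus>j\<in>{..<p}. ins_term E (Suc j) q' P ?Q xs') \<oplus>
          (\<Oplus>j\<in>{..<p}. alt E q (ins_term E j q ?P Q xs'))"
        using cl1 cl2 by (intro finsum_addf) auto
      also have "(\<Oplus>j\<in>{..<p}. alt E q (ins_term E j q ?P Q xs')) = alt E q (pre_lie E p (Suc q) ?P Q xs')"
        unfolding I1[symmetric] using cl1 by (intro alt_finsum[symmetric]) auto
      also have "(\<Oplus>j\<in>{..<p}. ins_term E (Suc j) q' P ?Q xs') = (\<Oplus>j\<in>Suc ` {..<p}. ins_term E j q' P ?Q xs')"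
        using cl2 by (intro finsum_reindex[symmetric]) auto
      also have "ins_term E 0 q' P ?Q xs' \<oplus> ((\<Oplus>j\<in>Suc ` {..<p}. ins_term E j q' P ?Q xs') \<oplus>
          alt E q (pre_lie E p (Suc q) ?P Q xs')) = 
          (ins_term E 0 q' P ?Q xs' \<oplus> (\<Oplus>j\<in>Suc ` {..<p}. ins_term E j q' P ?Q xs')) \<oplus>
          alt E q (pre_lie E p (Suc q) ?P Q xs')"
        using cl2 xs P' less.prems(3)
        by (intro a_assoc[symmetric] alt_closed pre_lie_closed finsum_closed) auto
      also have "ins_term E 0 q' P ?Q xs' \<oplus> (\<Oplus>j\<in>Suc ` {..<p}. ins_term E j q' P ?Q xs') =
          (\<Oplus>j\<in>{..<a}. ins_term E j q' P ?Q xs')"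
        unfolding split using cl2 by (intro finsum_insert[symmetric]) auto
      finally show ?thesis unfolding I2 using Suc \<open>a = Suc p\<close> by (simp add: xs)
    qed
  qed
qed

text \<open>The permutations touch only the first \<open>j + q\<close> positions, so
  \<open>finsum_shuffle_perms\<close> applies to this prefix once the common sign (-1)^(jq) is
  pulled out of the sum.\<close>

lemma partial_circ_eq_ins_term:
  assumes xs: "xs \<in> tuples (p + q + 1) E" and j: "j \<le> p"
    and P: "\<And>ys. ys \<in> tuples (Suc p) E \<Longrightarrow> P ys \<in> carrier E"
    and Q: "\<And>ys. ys \<in> tuples (Suc q) E \<Longrightarrow> Q ys \<in> carrier E"
  shows "partial_circ E p q (Suc j) P Q xs = ins_term E j q P Q xs"
proof -
  have len: "length xs = p + q + 1" and sub: "set xs \<subseteq> carrier E" using xs by (auto simp: tuples_def)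
  have x: "xs ! (j + q) \<in> carrier E" using sub len j by (intro subsetD[OF sub] nth_mem) auto
  have d: "set (drop (j + q + 1) xs) \<subseteq> carrier E" using sub set_drop_subset by fast
  have t: "set (take (j + q) xs) \<subseteq> carrier E" using sub set_take_subset by fast
  let ?F = "\<lambda>ys zs. P (ys @ [Q (zs @ [xs ! (j + q)])] @ drop (j + q + 1) xs)"
  have F: "?F ys zs \<in> carrier E" if "ys \<in> tuples j E" "zs \<in> tuples q E" for ys zs
  proof -
    have "Q (zs @ [xs ! (j + q)]) \<in> carrier E" using x that by (intro Q) (auto simp: tuples_def)
    then show ?thesis using that d len j by (intro P) (auto simp: tuples_def)
  qed
  let ?l = "take (j + q) xs"
  let ?y = "\<lambda>\<sigma>. pick ?l \<sigma> 1 (j + 1)" and ?z = "\<lambda>\<sigma>. pick ?l \<sigma> (j + 1) (j + q + 1)"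
  have ll: "length ?l = j + q" using len j by simp
  have lt: "\<sigma> i - 1 < j + q" if "\<sigma> \<in> shuffle_perms j q" "1 \<le> i" "i \<le> j + q" for \<sigma> i
    using that permutes_in_image[of \<sigma> "{1..j + q}" i] by (auto simp: shuffle_perms_def)
  have Fc: "?F (?y \<sigma>) (?z \<sigma>) \<in> carrier E" if "\<sigma> \<in> shuffle_perms j q" for \<sigma>
  proof -
    have "?l ! (\<sigma> i - 1) \<in> carrier E" if "1 \<le> i" "i \<le> j + q" for i
      using lt[OF \<open>\<sigma> \<in> _\<close> that] ll by (intro subsetD[OF t] nth_mem) simp
    then show ?thesis by (intro F) (auto simp: tuples_def simp del: upt_Suc nth_take)
  qed
  have "partial_circ E p q (Suc j) P Q xs = (\<Oplus>\<sigma>\<in>shuffle_perms j q. [((- 1) ^ (j * q) * sign \<sigma> :: int)] \<cdot>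
      ?F (pick xs \<sigma> 1 (j + 1)) (pick xs \<sigma> (j + 1) (j + q + 1)))"
    using xs by (simp add: partial_circ_def del: upt_Suc)
  also have "\<dots> = (\<Oplus>\<sigma>\<in>shuffle_perms j q. alt E (j * q) ([sign \<sigma>] \<cdot> ?F (?y \<sigma>) (?z \<sigma>)))"
  proof (rule finsum_cong')
    fix \<sigma> assume s: "\<sigma> \<in> shuffle_perms j q"
    have 1: "pick xs \<sigma> 1 (j + 1) = ?y \<sigma>" "pick xs \<sigma> (j + 1) (j + q + 1) = ?z \<sigma>"
      using lt[OF s] by (auto simp del: upt_Suc)
    show "[((- 1) ^ (j * q) * sign \<sigma> :: int)] \<cdot>
      ?F (pick xs \<sigma> 1 (j + 1)) (pick xs \<sigma> (j + 1) (j + q + 1)) =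
      alt E (j * q) ([sign \<sigma>] \<cdot> ?F (?y \<sigma>) (?z \<sigma>))"
      unfolding 1 by (subst add_pow_int_mult[OF Fc[OF s]], subst add_pow_alt[OF add.int_pow_closed[OF Fc[OF s]]]) (rule refl)
  qed (use Fc in \<open>auto simp del: upt_Suc nth_take\<close>)
  also have "\<dots> = alt E (j * q) (\<Oplus>\<sigma>\<in>shuffle_perms j q. [sign \<sigma>] \<cdot> ?F (?y \<sigma>) (?z \<sigma>))"
    using Fc by (intro alt_finsum[symmetric]) (auto simp del: upt_Suc nth_take)
  also have "(\<Oplus>\<sigma>\<in>shuffle_perms j q. [sign \<sigma>] \<cdot> ?F (?y \<sigma>) (?z \<sigma>)) = shf E j q ?F ?l"
    by (rule finsum_shuffle_perms[OF ll]) (intro F; use t in \<open>auto simp: tuples_def\<close>)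
  finally show ?thesis by (simp add: ins_term_def)
qed

lemma circ_eq_pre_lie:
  assumes xs: "xs \<in> tuples (p + q + 1) E"
    and P: "\<And>ys. ys \<in> tuples (Suc p) E \<Longrightarrow> P ys \<in> carrier E"
    and Q: "\<And>ys. ys \<in> tuples (Suc q) E \<Longrightarrow> Q ys \<in> carrier E"
  shows "circ E p q P Q xs = pre_lie E (Suc p) (Suc q) P Q xs"
proof -
  have c: "ins_term E j q P Q xs \<in> carrier E" if "j \<le> p" for j
    by (rule ins_term_closed) (use that assms in auto)
  have i: "{1..p + 1} = Suc ` {..<Suc p}" by (auto simp: image_iff Suc_le_eq gr0_conv_Suc)
  have "circ E p q P Q xs = (\<Oplus>k\<in>{1..p + 1}. partial_circ E p q k P Q xs)"
    using xs by (simp add: circ_def)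
  also have "\<dots> = (\<Oplus>j\<in>{..<Suc p}. partial_circ E p q (Suc j) P Q xs)"
    unfolding i using c assms by (intro finsum_reindex) (auto simp: partial_circ_eq_ins_term)
  also have "\<dots> = (\<Oplus>j\<in>{..<Suc p}. ins_term E j q P Q xs)"
    using c assms by (intro finsum_cong') (auto simp: partial_circ_eq_ins_term)
  finally show ?thesis using assms by (simp add: finsum_ins_term del: pre_lie.simps)
qed

lemma balavoine_eq_pre_lie:
  assumes xs: "xs \<in> tuples (p + q + 1) E"
    and P: "\<And>ys. ys \<in> tuples (Suc p) E \<Longrightarrow> P ys \<in> carrier E"
    and Q: "\<And>ys. ys \<in> tuples (Suc q) E \<Longrightarrow> Q ys \<in> carrier E"
  shows "balavoine E p q P Q xs =
    pre_lie E (Suc p) (Suc q) P Q xs \<ominus> alt E (p * q) (pre_lie E (Suc q) (Suc p) Q P xs)"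
proof -
  have "xs \<in> tuples (q + p + 1) E" using xs by (simp add: add.commute)
  then show ?thesis using assms
    by (simp add: balavoine_def circ_eq_pre_lie add_pow_alt pre_lie_closed del: pre_lie.simps)
qed

end

declare pre_lie.simps(3) [simp del]

lemma pre_lie_Cons [simp]:
  "pre_lie E (Suc a) (Suc b) P Q (x # xs) =
     pre_lie E (Suc a) b P (feed x Q) xs \<oplus>\<^bsub>E\<^esub>
     alt E b (pre_lie E a (Suc b) (feed x P) Q xs)"
  by (simp add: pre_lie.simps(3))

section \<open>Degenerate circle products and the sign of the derivation property\<close>

context abelian_module_group
begin

lemma pre_lie_zero_left:
  assumes "xs \<in> tuples (a + b - 1) E"
    and "\<And>ys. ys \<in> tuples a E \<Longrightarrow> P ys = \<zero>"
    and "\<And>ys. ys \<in> tuples b E \<Longrightarrow> Q ys \<in> carrier E"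
  shows "pre_lie E a b P Q xs = \<zero>"
  using assms
proof (induction "a + b" arbitrary: a b P Q xs rule: less_induct)
  case less
  show ?case
  proof (cases rule: nat_pair_cases[where m = a and n = b])
    case (s a' b')
    obtain x xs' where xs: "xs = x # xs'" "x \<in> carrier E" "xs' \<in> tuples (a' + b') E"
      using less.prems(1) s by (auto elim: tuples_SucE)
    have "pre_lie E a b' P (feed x Q) xs' = \<zero>"
      by (rule less.hyps) (use less.prems xs s in auto)
    moreover have "pre_lie E a' b (feed x P) Q xs' = \<zero>"
      by (rule less.hyps) (use less.prems xs s in auto)
    ultimately show ?thesis by (simp add: s xs)
  qed (use less.prems in auto)
qed

text \<open>The hypothesis on \<open>P\<close> is what multilinearity contributes: it is preserved
  by feeding an argument, and in the base case the zero value of \<open>Q\<close> is inserted into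
  \<open>P\<close>.\<close>

lemma pre_lie_zero_right:
  assumes "xs \<in> tuples (a + b - 1) E"
    and "\<And>ys. ys \<in> tuples a E \<Longrightarrow> \<zero> \<in> set ys \<Longrightarrow> P ys = \<zero>"
    and "\<And>ys. ys \<in> tuples b E \<Longrightarrow> Q ys = \<zero>"
  shows "pre_lie E a b P Q xs = \<zero>"
  using assms
proof (induction "a + b" arbitrary: a b P Q xs rule: less_induct)
  case less
  show ?case
  proof (cases rule: nat_pair_cases[where m = a and n = b])
    case (s a' b')
    obtain x xs' where xs: "xs = x # xs'" "x \<in> carrier E" "xs' \<in> tuples (a' + b') E"
      using less.prems(1) s by (auto elim: tuples_SucE)
    have "pre_lie E a b' P (feed x Q) xs' = \<zero>"
      by (rule less.hyps) (use less.prems xs s in auto)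
    moreover have "pre_lie E a' b (feed x P) Q xs' = \<zero>"
      by (rule less.hyps) (use less.prems xs s in auto)
    ultimately show ?thesis by (simp add: s xs)
  qed (use less.prems in auto)
qed

text \<open>A unary outer map has a single slot, which \<open>Q\<close> occupies; feeding an
  argument to \<open>P\<close> instead leaves an empty sum.\<close>

lemma pre_lie_1_left:
  assumes "xs \<in> tuples b E"
    and "\<And>ys. ys \<in> tuples 1 E \<Longrightarrow> P ys \<in> carrier E"
    and "\<And>ys. ys \<in> tuples b E \<Longrightarrow> Q ys \<in> carrier E"
  shows "pre_lie E (Suc 0) b P Q xs = P [Q xs]"
  using assms
proof (induction b arbitrary: Q xs)
  case (Suc b)
  obtain x xs' where xs: "xs = x # xs'" "x \<in> carrier E" "xs' \<in> tuples b E"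
    using Suc.prems(1) by (auto elim: tuples_SucE)
  have "pre_lie E (Suc 0) b P (feed x Q) xs' = P [Q (x # xs')]"
    using Suc xs by auto
  moreover have "P [Q (x # xs')] \<in> carrier E"
    using Suc.prems xs by simp
  ultimately show ?case by (simp add: xs)
qed simp

text \<open>The signs behind the derivation property: feeding a vector to [[mu, g1], g2] gives the
  bracket with g2 fed plus (-1)^(n') times the bracket with [mu, g1] fed. The latter consists of the
  terms \<open>p'\<close> and \<open>q'\<close>.\<close>

lemma bracket_sign_identity:
  assumes "p \<in> carrier E" "p' \<in> carrier E" "q \<in> carrier E" "q' \<in> carrier E" "m = Suc m'" "n = Suc n'"
  shows "(p \<oplus> alt E n' p') \<ominus> alt E (m * Suc n) (q' \<oplus> alt E m q) =
    (p \<ominus> alt E (m * Suc n') q) \<oplus> alt E n' (p' \<ominus> alt E (m' * Suc n) q')"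
  using assms(1-4) unfolding assms(5,6)
  by (cases "even m'"; cases "even n'") (simp_all add: alt_def a_minus_def minus_add a_ac)

end

section \<open>A recursive model of the derived bracket\<close>

text \<open>Multilinearity without extensionality, because the maps produced by the recursions take
  arbitrary values outside the tuples.\<close>

definition multilinear :: "('k, 'c) ring_scheme \<Rightarrow> nat \<Rightarrow> ('k, 'e, 'd) module_scheme \<Rightarrow>
    ('k, 'f, 'h) module_scheme \<Rightarrow> ('e list \<Rightarrow> 'f) \<Rightarrow> bool" where
  "multilinear K n E F f \<longleftrightarrow> (\<forall>xs \<in> tuples n E. f xs \<in> carrier F) \<and>
     (\<forall>xs \<in> tuples n E. \<forall>i < n. (\<lambda>v. f (xs[i := v])) \<in> module_hom K E F)"

lemma multilinear_maps_iff:
  "f \<in> multilinear_maps K n E F \<longleftrightarrow> multilinear K n E F f \<and> f \<in> extensional (tuples n E)"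
  by (auto simp: multilinear_maps_def multilinear_def PiE_def)

lemma multilinear_closed: "multilinear K n E F f \<Longrightarrow> xs \<in> tuples n E \<Longrightarrow> f xs \<in> carrier F"
  by (simp add: multilinear_def)

lemma multilinear_0 [simp]: "multilinear K 0 E F f \<longleftrightarrow> f [] \<in> carrier F"
  by (simp add: multilinear_def)

lemma list_update_in_tuples: "xs \<in> tuples n E \<Longrightarrow> v \<in> carrier E \<Longrightarrow> xs[i := v] \<in> tuples n E"
  by (auto simp: tuples_def dest!: subsetD[OF set_update_subset_insert])

text \<open>The inductive form of multilinearity, which fits recursions that consume one argument at
  a time.\<close>

lemma multilinear_Suc:
  "multilinear K (Suc n) E F f \<longleftrightarrow>
     (\<forall>x \<in> carrier E. multilinear K n E F (feed x f)) \<and>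
     (\<forall>xs \<in> tuples n E. (\<lambda>x. f (x # xs)) \<in> module_hom K E F)" (is "?l \<longleftrightarrow> ?r")
proof
  assume l: ?l
  have "(\<lambda>x. f (x # xs)) \<in> module_hom K E F" if "xs \<in> tuples n E" for xs
  \<comment> \<open>Linearity in the first slot is read off by updating an existing tuple, so some
    first entry must exist; over an empty carrier the claim is vacuous.\<close>
  proof (cases "carrier E = {}")
    case True
    then show ?thesis by (simp add: module_hom_def)
  next
    case False
    then obtain y where "y \<in> carrier E" by auto
    then have "(\<lambda>v. f ((y # xs)[0 := v])) \<in> module_hom K E F"
      using l that unfolding multilinear_def by (metis Cons_in_tuples zero_less_Suc)
    then show ?thesis by simp
  qed
  moreover have "(\<lambda>v. f (x # xs[i := v])) \<in> module_hom K E F"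
    if "x \<in> carrier E" "xs \<in> tuples n E" "i < n" for x xs i
  proof -
    have "(\<lambda>v. f ((x # xs)[Suc i := v])) \<in> module_hom K E F"
      using l that unfolding multilinear_def by (metis Cons_in_tuples Suc_less_eq)
    then show ?thesis by simp
  qed
  ultimately show ?r using l by (auto simp: multilinear_def)
next
  assume r: ?r
  show ?l unfolding multilinear_def
  proof (intro conjI ballI allI impI)
    fix xs assume "xs \<in> tuples (Suc n) E"
    then obtain y ys where xs: "xs = y # ys" "y \<in> carrier E" "ys \<in> tuples n E" by (rule tuples_SucE)
    then show "f xs \<in> carrier F" using r by (auto simp: multilinear_def)
    fix i assume "i < Suc n"
    then show "(\<lambda>v. f (xs[i := v])) \<in> module_hom K E F"
      using r xs by (cases i) (auto simp: multilinear_def)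
  qed
qed

lemma multilinear_Cons: "multilinear K (Suc n) E F f \<Longrightarrow> x \<in> carrier E \<Longrightarrow> multilinear K n E F (feed x f)"
  by (simp add: multilinear_Suc)

lemma multilinear_hd: "multilinear K (Suc n) E F f \<Longrightarrow> xs \<in> tuples n E \<Longrightarrow> (\<lambda>x. f (x # xs)) \<in> module_hom K E F"
  by (simp add: multilinear_Suc)

text \<open>The natural action of c on Hom(V^n, G): the value is [c, f(v_1, ..., v_n)] minus the sum
  over i of f(v_1, ..., rho(c) v_i, ..., v_n).\<close>

primrec diag_act :: "('k, 'g) leibniz \<Rightarrow> ('k, 'g, 'v) representation \<Rightarrow> nat \<Rightarrow> 'g \<Rightarrow> ('v list \<Rightarrow> 'g) \<Rightarrow> 'v list \<Rightarrow> 'g"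
  where
  "diag_act G R 0 c f xs = bracket G c (f [])"
| "diag_act G R (Suc n) c f xs =
     diag_act G R n c (feed (hd xs) f) (tl xs) \<ominus>\<^bsub>G\<^esub> f (rhoL R c (hd xs) # tl xs)"

text \<open>Maps without arguments, that is, elements of \<open>G\<close>, are included; with them one obtains a graded
  Leibniz algebra, which is not antisymmetric in degree 0.\<close>

fun rec_bracket :: "('k, 'g) leibniz \<Rightarrow> ('k, 'g, 'v) representation \<Rightarrow> nat \<Rightarrow> nat \<Rightarrow>
     ('v list \<Rightarrow> 'g) \<Rightarrow> ('v list \<Rightarrow> 'g) \<Rightarrow> 'v list \<Rightarrow> 'g" where
  "rec_bracket G R 0 n g f xs = diag_act G R n (g []) f xs"
| "rec_bracket G R (Suc m) 0 g f xs = \<ominus>\<^bsub>G\<^esub> diag_act G R (Suc m) (f []) g xs"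
| "rec_bracket G R (Suc m) (Suc n) g f xs =
     rec_bracket G R m (Suc n) (feed (hd xs) g) f (tl xs) \<oplus>\<^bsub>G\<^esub>
     alt G (Suc m) (rec_bracket G R (Suc m) n g (feed (hd xs) f) (tl xs))"

declare rec_bracket.simps(3) [simp del]

lemma rec_bracket_Cons:
  "m = Suc m' \<Longrightarrow> n = Suc n' \<Longrightarrow> rec_bracket G R m n g f (x # xs) =
     rec_bracket G R m' n (feed x g) f xs \<oplus>\<^bsub>G\<^esub>
     alt G m (rec_bracket G R m n' g (feed x f) xs)"
  by (simp add: rec_bracket.simps(3))

lemma diag_act_Cons:
  "m = Suc m' \<Longrightarrow> diag_act G R m c f (x # xs) =
     diag_act G R m' c (feed x f) xs \<ominus>\<^bsub>G\<^esub> f (rhoL R c x # xs)"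
  by simp

lemma rec_bracket_0_right: "m > 0 \<Longrightarrow> rec_bracket G R m 0 g f xs = \<ominus>\<^bsub>G\<^esub> diag_act G R m (f []) g xs"
  by (cases m) auto

text \<open>Formulated over modules, so that the Leibniz kernel and the quotient by it become
  instances as soon as their module laws and structure identities are known.\<close>

locale antisym_rep = G: module K G + V: module K "space R"
  for K :: "('k, 'c) ring_scheme" and G :: "('k, 'g) leibniz" and R :: "('k, 'g, 'v) representation" +
  assumes bracket_bilinear: "bilinear_on K G G G (bracket G)"
    and bracket_leibniz: "\<And>x y z. x \<in> carrier G \<Longrightarrow> y \<in> carrier G \<Longrightarrow> z \<in> carrier G \<Longrightarrow>
      bracket G x (bracket G y z) = bracket G (bracket G x y) z \<oplus>\<^bsub>G\<^esub> bracket G y (bracket G x z)"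
    and rhoL_bilinear: "bilinear_on K G (space R) (space R) (rhoL R)"
    and rhoL_bracket: "\<And>x y v. x \<in> carrier G \<Longrightarrow> y \<in> carrier G \<Longrightarrow> v \<in> carrier (space R) \<Longrightarrow>
      rhoL R (bracket G x y) v =
        rhoL R x (rhoL R y v) \<ominus>\<^bsub>space R\<^esub> rhoL R y (rhoL R x v)"
    and rhoR_zero: "\<And>x v. x \<in> carrier G \<Longrightarrow> v \<in> carrier (space R) \<Longrightarrow> rhoR R x v = \<zero>\<^bsub>space R\<^esub>"
begin

abbreviation "V \<equiv> space R"
abbreviation "br \<equiv> bracket G"
abbreviation "\<rho> \<equiv> rhoL R"
abbreviation "act \<equiv> diag_act G R"
abbreviation "B \<equiv> rec_bracket G R"
abbreviation "mlin n f \<equiv> multilinear K n V G f"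

abbreviation (input) addG (infixl "\<oplus>\<^sub>G" 65) where "x \<oplus>\<^sub>G y \<equiv> x \<oplus>\<^bsub>G\<^esub> y"
abbreviation (input) diffG (infixl "\<ominus>\<^sub>G" 65) where "x \<ominus>\<^sub>G y \<equiv> x \<ominus>\<^bsub>G\<^esub> y"
abbreviation (input) negG ("\<ominus>\<^sub>G _" [81] 80) where "\<ominus>\<^sub>G x \<equiv> \<ominus>\<^bsub>G\<^esub> x"
abbreviation (input) smultG (infixl "\<odot>\<^sub>G" 70) where "a \<odot>\<^sub>G x \<equiv> a \<odot>\<^bsub>G\<^esub> x"
abbreviation (input) zeroG ("\<zero>\<^sub>G") where "\<zero>\<^sub>G \<equiv> \<zero>\<^bsub>G\<^esub>"
abbreviation (input) addV (infixl "\<oplus>\<^sub>V" 65) where "x \<oplus>\<^sub>V y \<equiv> x \<oplus>\<^bsub>V\<^esub> y"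
abbreviation (input) diffV (infixl "\<ominus>\<^sub>V" 65) where "x \<ominus>\<^sub>V y \<equiv> x \<ominus>\<^bsub>V\<^esub> y"
abbreviation (input) negV ("\<ominus>\<^sub>V _" [81] 80) where "\<ominus>\<^sub>V x \<equiv> \<ominus>\<^bsub>V\<^esub> x"
abbreviation (input) smultV (infixl "\<odot>\<^sub>V" 70) where "a \<odot>\<^sub>V x \<equiv> a \<odot>\<^bsub>V\<^esub> x"
abbreviation (input) zeroV ("\<zero>\<^sub>V") where "\<zero>\<^sub>V \<equiv> \<zero>\<^bsub>V\<^esub>"

lemma hom_zero:
  assumes "f \<in> module_hom K V G" shows "f \<zero>\<^sub>V = \<zero>\<^sub>G"
proof -
  interpret mod_hom K V G f by unfold_locales (rule assms)
  show ?thesis by simp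
qed

lemma hom_diff:
  assumes "f \<in> module_hom K V G" "x \<in> carrier V" "y \<in> carrier V"
  shows "f (x \<ominus>\<^sub>V y) = f x \<ominus>\<^sub>G f y"
proof -
  interpret mod_hom K V G f by unfold_locales (rule assms)
  show ?thesis using assms by simp
qed

lemma hom_lin:
  assumes "f \<in> module_hom K M N" "module K M" "x \<in> carrier M" "y \<in> carrier M" "a \<in> carrier K" "b \<in> carrier K"
  shows "f (a \<odot>\<^bsub>M\<^esub> x \<oplus>\<^bsub>M\<^esub> b \<odot>\<^bsub>M\<^esub> y) = a \<odot>\<^bsub>N\<^esub> f x \<oplus>\<^bsub>N\<^esub> b \<odot>\<^bsub>N\<^esub> f y"
  using assms by (simp add: module_hom_add module_hom_smult module.smult_closed)

lemma br_hom: "x \<in> carrier G \<Longrightarrow> (\<lambda>y. br x y) \<in> module_hom K G G" "y \<in> carrier G \<Longrightarrow> (\<lambda>x. br x y) \<in> module_hom K G G"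
  using bracket_bilinear by (auto simp: bilinear_on_def)

lemma rho_hom: "x \<in> carrier G \<Longrightarrow> (\<lambda>y. \<rho> x y) \<in> module_hom K V V" "y \<in> carrier V \<Longrightarrow> (\<lambda>x. \<rho> x y) \<in> module_hom K G V"
  using rhoL_bilinear by (auto simp: bilinear_on_def)

lemma br_closed [simp, intro]: "x \<in> carrier G \<Longrightarrow> y \<in> carrier G \<Longrightarrow> br x y \<in> carrier G"
  using module_hom_closed[OF br_hom(1)] by auto

lemma rho_closed [simp, intro]: "x \<in> carrier G \<Longrightarrow> v \<in> carrier V \<Longrightarrow> \<rho> x v \<in> carrier V"
  using module_hom_closed[OF rho_hom(1)] by auto

lemma br_lin:
  assumes "x \<in> carrier G" "y \<in> carrier G" "z \<in> carrier G" "a \<in> carrier K" "b \<in> carrier K"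
  shows "br (a \<odot>\<^sub>G x \<oplus>\<^sub>G b \<odot>\<^sub>G y) z = a \<odot>\<^sub>G br x z \<oplus>\<^sub>G b \<odot>\<^sub>G br y z"
    and "br z (a \<odot>\<^sub>G x \<oplus>\<^sub>G b \<odot>\<^sub>G y) = a \<odot>\<^sub>G br z x \<oplus>\<^sub>G b \<odot>\<^sub>G br z y"
  using hom_lin[OF br_hom(1) G.module_axioms] hom_lin[OF br_hom(2) G.module_axioms] assms by auto

lemma rho_lin:
  assumes "x \<in> carrier G" "y \<in> carrier G" "v \<in> carrier V" "w \<in> carrier V" "a \<in> carrier K" "b \<in> carrier K"
  shows "\<rho> (a \<odot>\<^sub>G x \<oplus>\<^sub>G b \<odot>\<^sub>G y) v = a \<odot>\<^sub>V \<rho> x v \<oplus>\<^sub>V b \<odot>\<^sub>V \<rho> y v"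
    and "\<rho> x (a \<odot>\<^sub>V v \<oplus>\<^sub>V b \<odot>\<^sub>V w) = a \<odot>\<^sub>V \<rho> x v \<oplus>\<^sub>V b \<odot>\<^sub>V \<rho> x w"
  using hom_lin[OF rho_hom(1) V.module_axioms] hom_lin[OF rho_hom(2) G.module_axioms] assms by auto

lemma mlin_lin:
  assumes "mlin (Suc n) f" "xs \<in> tuples n V" "v \<in> carrier V" "w \<in> carrier V" "a \<in> carrier K" "b \<in> carrier K"
  shows "f ((a \<odot>\<^sub>V v \<oplus>\<^sub>V b \<odot>\<^sub>V w) # xs) = a \<odot>\<^sub>G f (v # xs) \<oplus>\<^sub>G b \<odot>\<^sub>G f (w # xs)"
  using hom_lin[OF multilinear_hd[OF assms(1,2)] V.module_axioms] assms by auto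

lemma module_homI:
  assumes M: "module K M" and N: "module K N"
    and c: "\<And>x. x \<in> carrier M \<Longrightarrow> f x \<in> carrier N"
    and l: "\<And>a b x y. a \<in> carrier K \<Longrightarrow> b \<in> carrier K \<Longrightarrow> x \<in> carrier M \<Longrightarrow> y \<in> carrier M \<Longrightarrow>
      f (a \<odot>\<^bsub>M\<^esub> x \<oplus>\<^bsub>M\<^esub> b \<odot>\<^bsub>M\<^esub> y) = a \<odot>\<^bsub>N\<^esub> f x \<oplus>\<^bsub>N\<^esub> b \<odot>\<^bsub>N\<^esub> f y"
  shows "f \<in> module_hom K M N"
proof -
  interpret M: module K M by fact
  interpret N: module K N by fact
  have "f (x \<oplus>\<^bsub>M\<^esub> y) = f x \<oplus>\<^bsub>N\<^esub> f y" if "x \<in> carrier M" "y \<in> carrier M" for x y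
    using l[of "\<one>\<^bsub>K\<^esub>" "\<one>\<^bsub>K\<^esub>" x y] that c by simp
  moreover have "f (a \<odot>\<^bsub>M\<^esub> x) = a \<odot>\<^bsub>N\<^esub> f x" if "x \<in> carrier M" "a \<in> carrier K" for x a
    using l[of a "\<zero>\<^bsub>K\<^esub>" x x] that c by simp
  ultimately show ?thesis using c by (auto simp: module_hom_def)
qed

section \<open>Closure, linearity and antisymmetry of the recursive bracket\<close>

lemma act_closed:
  "mlin n f \<Longrightarrow> c \<in> carrier G \<Longrightarrow> xs \<in> tuples n V \<Longrightarrow> act n c f xs \<in> carrier G"
proof (induction n arbitrary: f xs)
  case (Suc n)
  obtain x xs' where xs: "xs = x # xs'" "x \<in> carrier V" "xs' \<in> tuples n V"
    using Suc.prems by (auto elim: tuples_SucE)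
  have "f (\<rho> c x # xs') \<in> carrier G"
    using Suc.prems xs by (simp add: multilinear_closed)
  then show ?case 
    using Suc.IH[OF multilinear_Cons[OF Suc.prems(1) xs(2)] Suc.prems(2) xs(3)] by (simp add: xs)
qed simp

lemma rec_bracket_closed:
  "mlin m g \<Longrightarrow> mlin n f \<Longrightarrow> xs \<in> tuples (m + n) V \<Longrightarrow> B m n g f xs \<in> carrier G"
proof (induction "m + n" arbitrary: m n g f xs)
  case 0
  then show ?case by simp
next
  case (Suc d)
  show ?case
  proof (cases rule: nat_pair_cases[where m = m and n = n])
    case (s m' n')
    obtain x xs' where xs: "xs = x # xs'" "x \<in> carrier V" "xs' \<in> tuples (m' + n) V"
      using Suc.prems(3) s by (auto elim: tuples_SucE)
    show ?thesis unfolding xs rec_bracket_Cons[OF s]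
      using Suc.prems(1,2) s xs Suc.hyps(2)
      by (intro G.M.a_closed G.M.alt_closed Suc.hyps(1)) (auto intro: multilinear_Cons)
  qed (use Suc.prems in \<open>auto intro!: act_closed simp del: diag_act.simps\<close>)
qed

lemma lin_comb_simps:
  assumes "x \<in> carrier G" "y \<in> carrier G" "a \<in> carrier K" "b \<in> carrier K"
  shows "\<ominus>\<^sub>G (a \<odot>\<^sub>G x \<oplus>\<^sub>G b \<odot>\<^sub>G y) = a \<odot>\<^sub>G (\<ominus>\<^sub>G x) \<oplus>\<^sub>G b \<odot>\<^sub>G (\<ominus>\<^sub>G y)"
    and "alt G k (a \<odot>\<^sub>G x \<oplus>\<^sub>G b \<odot>\<^sub>G y) = a \<odot>\<^sub>G (alt G k x) \<oplus>\<^sub>G b \<odot>\<^sub>G (alt G k y)"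
    and "u \<in> carrier G \<Longrightarrow> v \<in> carrier G \<Longrightarrow>
      (a \<odot>\<^sub>G x \<oplus>\<^sub>G b \<odot>\<^sub>G y) \<oplus>\<^sub>G (a \<odot>\<^sub>G u \<oplus>\<^sub>G b \<odot>\<^sub>G v) = a \<odot>\<^sub>G (x \<oplus>\<^sub>G u) \<oplus>\<^sub>G b \<odot>\<^sub>G (y \<oplus>\<^sub>G v)"
    and "u \<in> carrier G \<Longrightarrow> v \<in> carrier G \<Longrightarrow>
      (a \<odot>\<^sub>G x \<oplus>\<^sub>G b \<odot>\<^sub>G y) \<ominus>\<^sub>G (a \<odot>\<^sub>G u \<oplus>\<^sub>G b \<odot>\<^sub>G v) = a \<odot>\<^sub>G (x \<ominus>\<^sub>G u) \<oplus>\<^sub>G b \<odot>\<^sub>G (y \<ominus>\<^sub>G v)"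
  using assms by (simp_all add: a_minus_def alt_def G.M.a_ac G.smult_r_distr G.smult_r_minus G.M.minus_add)

lemma act_lin_elt:
  assumes "mlin n f" "c \<in> carrier G" "d \<in> carrier G" "a \<in> carrier K" "b \<in> carrier K" "xs \<in> tuples n V"
  shows "act n (a \<odot>\<^sub>G c \<oplus>\<^sub>G b \<odot>\<^sub>G d) f xs = a \<odot>\<^sub>G act n c f xs \<oplus>\<^sub>G b \<odot>\<^sub>G act n d f xs"
  using assms
proof (induction n arbitrary: f xs)
  case 0
  then show ?case by (simp add: br_lin)
next
  case (Suc n)
  obtain x xs' where xs: "xs = x # xs'" "x \<in> carrier V" "xs' \<in> tuples n V"
    using Suc.prems by (auto elim: tuples_SucE)
  have m: "mlin n (feed x f)" using Suc.prems xs by (intro multilinear_Cons)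
  have c: "f (\<rho> z x # xs') \<in> carrier G" if "z \<in> carrier G" for z
    using Suc.prems(1) that xs by (intro multilinear_closed) auto
  show ?case using Suc xs m c
    by (simp add: rho_lin mlin_lin lin_comb_simps act_closed)
qed

text \<open>The combination is a separate map \<open>h\<close> that needs to agree with it on tuples
  only. This form is stable under feeding an argument, and congruence rules come out of it as
  special cases.\<close>

lemma act_lin:
  assumes "mlin n f" "mlin n g" "mlin n h" "c \<in> carrier G" "a \<in> carrier K" "b \<in> carrier K" "xs \<in> tuples n V"
    and "\<And>ys. ys \<in> tuples n V \<Longrightarrow> h ys = a \<odot>\<^sub>G f ys \<oplus>\<^sub>G b \<odot>\<^sub>G g ys"
  shows "act n c h xs = a \<odot>\<^sub>G act n c f xs \<oplus>\<^sub>G b \<odot>\<^sub>G act n c g xs"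
  using assms
proof (induction n arbitrary: f g h xs)
  case 0
  then show ?case by (simp add: br_lin)
next
  case (Suc n)
  obtain x xs' where xs: "xs = x # xs'" "x \<in> carrier V" "xs' \<in> tuples n V"
    using Suc.prems by (auto elim: tuples_SucE)
  have m: "mlin n (feed x f)" "mlin n (feed x g)" "mlin n (feed x h)"
    using Suc.prems xs by (auto intro: multilinear_Cons)
  have c: "f (\<rho> c x # xs') \<in> carrier G" "g (\<rho> c x # xs') \<in> carrier G"
    using Suc.prems xs by (simp_all add: multilinear_closed)
  have "act n c (feed x h) xs' = a \<odot>\<^sub>G act n c (feed x f) xs' \<oplus>\<^sub>G b \<odot>\<^sub>G act n c (feed x g) xs'"
    by (rule Suc.IH) (use m Suc.prems xs in auto)
  then show ?case using Suc.prems xs m c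
    by (simp add: lin_comb_simps act_closed)
qed

lemma rec_bracket_lin_left:
  assumes "mlin m g" "mlin m g'" "mlin m h" "mlin n f" "a \<in> carrier K" "b \<in> carrier K" "xs \<in> tuples (m + n) V"
    and "\<And>ys. ys \<in> tuples m V \<Longrightarrow> h ys = a \<odot>\<^sub>G g ys \<oplus>\<^sub>G b \<odot>\<^sub>G g' ys"
  shows "B m n h f xs = a \<odot>\<^sub>G B m n g f xs \<oplus>\<^sub>G b \<odot>\<^sub>G B m n g' f xs"
  using assms
proof (induction "m + n" arbitrary: m n g g' h f xs rule: less_induct)
  case less
  show ?case
  proof (cases rule: nat_pair_cases[where m = m and n = n])
    case 1
    then show ?thesis using less.prems by (simp add: act_lin_elt)
  next
    case (2 m')
    have "act m (f []) h xs = a \<odot>\<^sub>G act m (f []) g xs \<oplus>\<^sub>G b \<odot>\<^sub>G act m (f []) g' xs"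
      by (rule act_lin) (use less.prems 2 in auto)
    then show ?thesis using less.prems 2 
      by (simp add: lin_comb_simps act_closed del: diag_act.simps)
  next
    case (s m' n')
    obtain x xs' where xs: "xs = x # xs'" "x \<in> carrier V" "xs' \<in> tuples (m' + n) V"
      using less.prems s by (auto elim: tuples_SucE)
    have m: "mlin m' (feed x g)" "mlin m' (feed x g')" "mlin m' (feed x h)" 
      "mlin n' (feed x f)"
      using less.prems xs s by (auto intro: multilinear_Cons)
    have t: "xs' \<in> tuples (m + n') V" using xs s by simp
    have 1: "B m' n (feed x h) f xs' = 
        a \<odot>\<^sub>G B m' n (feed x g) f xs' \<oplus>\<^sub>G b \<odot>\<^sub>G B m' n (feed x g') f xs'"
      by (rule less.hyps) (use less.prems xs s m in auto)
    have 2: "B m n' h (feed x f) xs' = 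
        a \<odot>\<^sub>G B m n' g (feed x f) xs' \<oplus>\<^sub>G b \<odot>\<^sub>G B m n' g' (feed x f) xs'"
      by (rule less.hyps) (use less.prems xs s m in auto)
    show ?thesis unfolding xs rec_bracket_Cons[OF s] 1 2 using less.prems xs m t
      by (simp add: lin_comb_simps rec_bracket_closed)
  qed
qed

text \<open>Two elements of \<open>G\<close> are paired by the Leibniz bracket, which is not
  antisymmetric in general; hence at least one argument is required. If only one map has arguments,
  the claim is built into the equations of \<open>rec_bracket\<close>; otherwise both sides peel to
  the same two terms in opposite order.\<close>

lemma rec_bracket_antisym:
  assumes "mlin m g" "mlin n f" "xs \<in> tuples (m + n) V" "m + n > 0"
  shows "B m n g f xs = \<ominus>\<^sub>G alt G (m * n) (B n m f g xs)"
  using assms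
proof (induction "m + n" arbitrary: m n g f xs rule: less_induct)
  case less
  show ?case
  proof (cases rule: nat_pair_cases[where m = m and n = n])
    case 1
    then show ?thesis using less.prems by (simp add: rec_bracket_0_right act_closed)
  next
    case (2 m')
    then show ?thesis using less.prems by simp
  next
    case (s m' n')
    obtain x xs' where xs: "xs = x # xs'" "x \<in> carrier V" "xs' \<in> tuples (m' + n) V"
      using less.prems s by (auto elim: tuples_SucE)
    have t: "xs' \<in> tuples (m + n') V" "xs' \<in> tuples (n + m') V" "xs' \<in> tuples (n' + m) V"
      using xs s by (auto simp: add.commute)
    have m: "mlin n' (feed x f)" "mlin m' (feed x g)"
      using less.prems xs s by (auto intro: multilinear_Cons)
    have 1: "B m' n (feed x g) f xs' = \<ominus>\<^sub>G alt G (m' * n) (B n m' f (feed x g) xs')"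
      by (rule less.hyps) (use less.prems xs s m in auto)
    have 2: "B m n' g (feed x f) xs' = \<ominus>\<^sub>G alt G (m * n') (B n' m (feed x f) g xs')"
      by (rule less.hyps) (use less.prems xs s m t in auto)
    have c: "B n m' f (feed x g) xs' \<in> carrier G" "B n' m (feed x f) g xs' \<in> carrier G"
      using less.prems xs s m t by (auto intro!: rec_bracket_closed)
    have "\<ominus>\<^sub>G alt G (m' * n) u \<oplus>\<^sub>G alt G m (\<ominus>\<^sub>G alt G (m * n') v) = 
       \<ominus>\<^sub>G alt G (m * n) (v \<oplus>\<^sub>G alt G n u)" if "u \<in> carrier G" "v \<in> carrier G" for u v
      using that by (cases "even m'"; cases "even n'") (simp_all add: s alt_def G.M.minus_add G.M.a_comm)
    then show ?thesis unfolding xs rec_bracket_Cons[OF s] rec_bracket_Cons[OF s(2,1)] 1 2 using c by simp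
  qed
qed

text \<open>Carried over from the other slot by antisymmetry. For two elements of \<open>G\<close>
  it is the bilinearity of the Leibniz bracket.\<close>

lemma rec_bracket_lin_right:
  assumes g: "mlin m g" and f: "mlin n f" "mlin n f'" "mlin n h" and ab: "a \<in> carrier K" "b \<in> carrier K"
    and xs: "xs \<in> tuples (m + n) V"
    and h: "\<And>ys. ys \<in> tuples n V \<Longrightarrow> h ys = a \<odot>\<^sub>G f ys \<oplus>\<^sub>G b \<odot>\<^sub>G f' ys"
  shows "B m n g h xs = a \<odot>\<^sub>G B m n g f xs \<oplus>\<^sub>G b \<odot>\<^sub>G B m n g f' xs"
proof (cases "m + n > 0")
  case True
  have xs': "xs \<in> tuples (n + m) V" using xs by (simp add: add.commute)
  note anti = rec_bracket_antisym[OF g _ xs True]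
  have "B n m h g xs = a \<odot>\<^sub>G B n m f g xs \<oplus>\<^sub>G b \<odot>\<^sub>G B n m f' g xs"
    by (rule rec_bracket_lin_left[OF f g ab xs']) (rule h)
  then show ?thesis
    unfolding anti[OF f(1)] anti[OF f(2)] anti[OF f(3)]
    using ab rec_bracket_closed[OF f(1) g xs'] rec_bracket_closed[OF f(2) g xs'] by (simp add: lin_comb_simps)
next
  case False
  then show ?thesis using assms by (simp add: br_lin)
qed

text \<open>Linearity with coefficients 1 and (-1)^k, the shape of the right-hand side of
  \<open>rec_bracket_Cons\<close>: it expands a fed bracket inside another bracket.\<close>

lemma rec_bracket_add_alt_left:
  assumes "mlin m g" "mlin m g'" "mlin m h" "mlin n f" "xs \<in> tuples (m + n) V"
    and "\<And>ys. ys \<in> tuples m V \<Longrightarrow> h ys = g ys \<oplus>\<^sub>G alt G k (g' ys)"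
  shows "B m n h f xs = B m n g f xs \<oplus>\<^sub>G alt G k (B m n g' f xs)"
  using rec_bracket_lin_left[of m g g' h n f "\<one>\<^bsub>K\<^esub>" "if even k then \<one>\<^bsub>K\<^esub> else \<ominus>\<^bsub>K\<^esub> \<one>\<^bsub>K\<^esub>" xs] assms
  by (simp add: alt_def multilinear_closed rec_bracket_closed G.smult_l_minus split: if_splits)

lemma rec_bracket_add_alt_right:
  assumes "mlin m g" "mlin n f" "mlin n f'" "mlin n h" "xs \<in> tuples (m + n) V"
    and "\<And>ys. ys \<in> tuples n V \<Longrightarrow> h ys = f ys \<oplus>\<^sub>G alt G k (f' ys)"
  shows "B m n g h xs = B m n g f xs \<oplus>\<^sub>G alt G k (B m n g f' xs)"
  using rec_bracket_lin_right[of m g n f f' h "\<one>\<^bsub>K\<^esub>" "if even k then \<one>\<^bsub>K\<^esub> else \<ominus>\<^bsub>K\<^esub> \<one>\<^bsub>K\<^esub>" xs] assms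
  by (simp add: alt_def multilinear_closed rec_bracket_closed G.smult_l_minus split: if_splits)

lemma rec_bracket_alt_left:
  assumes "mlin m g" "mlin m h" "mlin n f" "xs \<in> tuples (m + n) V"
    and "\<And>ys. ys \<in> tuples m V \<Longrightarrow> h ys = alt G k (g ys)"
  shows "B m n h f xs = alt G k (B m n g f xs)"
  using rec_bracket_lin_left[of m g g h n f "if even k then \<one>\<^bsub>K\<^esub> else \<ominus>\<^bsub>K\<^esub> \<one>\<^bsub>K\<^esub>" "\<zero>\<^bsub>K\<^esub>" xs] assms
  by (simp add: alt_def multilinear_closed rec_bracket_closed G.smult_l_minus split: if_splits)

lemma rec_bracket_alt_right:
  assumes "mlin m g" "mlin n f" "mlin n h" "xs \<in> tuples (m + n) V"
    and "\<And>ys. ys \<in> tuples n V \<Longrightarrow> h ys = alt G k (f ys)"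
  shows "B m n g h xs = alt G k (B m n g f xs)"
  using rec_bracket_lin_right[of m g n f f h "if even k then \<one>\<^bsub>K\<^esub> else \<ominus>\<^bsub>K\<^esub> \<one>\<^bsub>K\<^esub>" "\<zero>\<^bsub>K\<^esub>" xs] assms
  by (simp add: alt_def multilinear_closed rec_bracket_closed G.smult_l_minus split: if_splits)

lemma act_diff:
  assumes "mlin n f" "mlin n g" "mlin n h" "c \<in> carrier G" "xs \<in> tuples n V"
    and "\<And>ys. ys \<in> tuples n V \<Longrightarrow> h ys = f ys \<ominus>\<^sub>G g ys"
  shows "act n c h xs = act n c f xs \<ominus>\<^sub>G act n c g xs"
  using act_lin[of n f g h c "\<one>\<^bsub>K\<^esub>" "\<ominus>\<^bsub>K\<^esub> \<one>\<^bsub>K\<^esub>" xs] assms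
  by (simp add: a_minus_def multilinear_closed act_closed G.smult_l_minus)

lemma act_neg:
  assumes "mlin n f" "mlin n h" "c \<in> carrier G" "xs \<in> tuples n V"
    and "\<And>ys. ys \<in> tuples n V \<Longrightarrow> h ys = \<ominus>\<^sub>G f ys"
  shows "act n c h xs = \<ominus>\<^sub>G act n c f xs"
  using act_lin[of n f f h c "\<ominus>\<^bsub>K\<^esub> \<one>\<^bsub>K\<^esub>" "\<zero>\<^bsub>K\<^esub>" xs] assms
  by (simp add: a_minus_def multilinear_closed act_closed G.smult_l_minus)

section \<open>Multilinearity of the diagonal action and of the recursive bracket\<close>

lemma mlin_lincomb:
  assumes "mlin n f" "mlin n g" "a \<in> carrier K" "b \<in> carrier K"
  shows "mlin n (\<lambda>xs. a \<odot>\<^sub>G f xs \<oplus>\<^sub>G b \<odot>\<^sub>G g xs)"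
  using assms(1,2)
proof (induction n arbitrary: f g)
  case (Suc n)
  show ?case unfolding multilinear_Suc
  proof (intro conjI ballI)
    fix xs assume xs: "xs \<in> tuples n V"
    have "f (x # xs) \<in> carrier G" "g (x # xs) \<in> carrier G" if "x \<in> carrier V" for x
      using that xs Suc.prems by (simp_all add: multilinear_closed)
    then show "(\<lambda>x. a \<odot>\<^sub>G f (x # xs) \<oplus>\<^sub>G b \<odot>\<^sub>G g (x # xs)) \<in> module_hom K V G"
      using assms(3,4) Suc.prems xs
      by (intro module_homI V.module_axioms G.module_axioms)
        (simp_all add: mlin_lin G.smult_r_distr G.M.a_ac G.smult_assoc1[symmetric] G.R.m_comm)
  qed (use Suc in \<open>auto intro: multilinear_Cons\<close>)
qed (use assms in auto)

lemma mlin_cong: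
  assumes "mlin n f" "\<And>xs. xs \<in> tuples n V \<Longrightarrow> f xs = g xs"
  shows "mlin n g"
proof -
  have "g xs \<in> carrier G" if "xs \<in> tuples n V" for xs using assms that by (metis multilinear_closed)
  moreover have "(\<lambda>v. g (xs[i := v])) \<in> module_hom K V G" if "xs \<in> tuples n V" "i < n" for xs i
  proof -
    have "(\<lambda>v. f (xs[i := v])) \<in> module_hom K V G" using assms(1) that by (simp add: multilinear_def)
    moreover have "g (xs[i := v]) = f (xs[i := v])" if "v \<in> carrier V" for v
      using assms(2) list_update_in_tuples[OF \<open>xs \<in> _\<close> that] by simp
    ultimately show ?thesis by (simp add: module_hom_def Pi_def)
  qed
  ultimately show ?thesis by (simp add: multilinear_def)
qed

lemma mlin_add_alt:
  assumes "mlin n f" "mlin n g"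
  shows "mlin n (\<lambda>xs. f xs \<oplus>\<^sub>G alt G k (g xs))"
  by (rule mlin_cong[OF mlin_lincomb[OF assms, of "\<one>\<^bsub>K\<^esub>" "if even k then \<one>\<^bsub>K\<^esub> else \<ominus>\<^bsub>K\<^esub> \<one>\<^bsub>K\<^esub>"]])
    (use assms in \<open>auto simp: alt_def multilinear_closed G.smult_l_minus\<close>)

lemma mlin_diff: "mlin n f \<Longrightarrow> mlin n g \<Longrightarrow> mlin n (\<lambda>xs. f xs \<ominus>\<^sub>G g xs)"
  using mlin_add_alt[of n f g 1] by (simp add: a_minus_def alt_def)

lemma mlin_neg: 
  assumes "mlin n f" shows "mlin n (\<lambda>xs. \<ominus>\<^sub>G f xs)"
  by (rule mlin_cong[OF mlin_lincomb[OF assms assms, of "\<ominus>\<^bsub>K\<^esub> \<one>\<^bsub>K\<^esub>" "\<zero>\<^bsub>K\<^esub>"]])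
    (use assms in \<open>auto simp: multilinear_closed G.smult_l_minus\<close>)

lemma mlin_act: "mlin n f \<Longrightarrow> c \<in> carrier G \<Longrightarrow> mlin n (act n c f)"
proof (induction n arbitrary: f)
  case (Suc n)
  show ?case unfolding multilinear_Suc diag_act.simps list.sel
  proof (intro conjI ballI)
    fix x assume x: "x \<in> carrier V"
    show "mlin n (\<lambda>xs. act n c (feed x f) xs \<ominus>\<^sub>G f (\<rho> c x # xs))"
      using Suc x by (intro mlin_diff) (auto intro: multilinear_Cons)
  next
    fix xs assume xs: "xs \<in> tuples n V"
    have c: "act n c (feed x f) xs \<in> carrier G" "f (\<rho> c x # xs) \<in> carrier G" if "x \<in> carrier V" for x
      using that xs Suc.prems by (simp_all add: multilinear_closed act_closed multilinear_Cons)
    show "(\<lambda>x. act n c (feed x f) xs \<ominus>\<^sub>G f (\<rho> c x # xs)) \<in> module_hom K V G"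
    proof (intro module_homI V.module_axioms G.module_axioms)
      fix a b x y assume h: "a \<in> carrier K" "b \<in> carrier K" "x \<in> carrier V" "y \<in> carrier V"
      have "act n c (\<lambda>ys. f ((a \<odot>\<^sub>V x \<oplus>\<^sub>V b \<odot>\<^sub>V y) # ys)) xs =
          a \<odot>\<^sub>G act n c (feed x f) xs \<oplus>\<^sub>G b \<odot>\<^sub>G act n c (feed y f) xs"
        by (rule act_lin) (use Suc.prems h xs in \<open>auto intro: multilinear_Cons simp: mlin_lin\<close>)
      then show "act n c (\<lambda>ys. f ((a \<odot>\<^sub>V x \<oplus>\<^sub>V b \<odot>\<^sub>V y) # ys)) xs \<ominus>\<^sub>G
          f (\<rho> c (a \<odot>\<^sub>V x \<oplus>\<^sub>V b \<odot>\<^sub>V y) # xs) =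
        a \<odot>\<^sub>G (act n c (feed x f) xs \<ominus>\<^sub>G f (\<rho> c x # xs)) \<oplus>\<^sub>G
        b \<odot>\<^sub>G (act n c (feed y f) xs \<ominus>\<^sub>G f (\<rho> c y # xs))"
        using h Suc.prems xs c by (simp add: rho_lin mlin_lin lin_comb_simps)
    qed (use c in auto)
  qed
qed simp

text \<open>A fed bracket is a signed sum of smaller brackets, and linearity in the fed vector is
  linearity of these brackets in the map that receives it.\<close>

lemma mlin_rec_bracket: "mlin m g \<Longrightarrow> mlin n f \<Longrightarrow> mlin (m + n) (B m n g f)"
proof (induction "m + n" arbitrary: m n g f rule: less_induct)
  case less
  show ?case
  proof (cases rule: nat_pair_cases[where m = m and n = n])
    case 1
    then show ?thesis using less.prems mlin_act[of n f "g []"] by (auto simp: fun_eq_iff intro: mlin_cong)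
  next
    case (2 m')
    then show ?thesis using less.prems mlin_neg[OF mlin_act[of m g "f []"]] 
      by (auto intro: mlin_cong simp del: diag_act.simps)
  next
    case (s m' n')
    have mn: "m + n = Suc (m' + n)" "m' + n = m + n'" using s by auto
    have cl: "B m' n (feed x g) f xs \<in> carrier G" "B m n' g (feed x f) xs \<in> carrier G"
      if "x \<in> carrier V" "xs \<in> tuples (m' + n) V" for x xs
      using that less.prems s by (auto intro!: rec_bracket_closed multilinear_Cons simp flip: mn)
    show ?thesis unfolding mn(1) multilinear_Suc rec_bracket_Cons[OF s]
    proof (intro conjI ballI)
      fix x assume x: "x \<in> carrier V"
      have "mlin (m' + n) (B m' n (feed x g) f)"
        by (rule less.hyps) (use s x less.prems in \<open>auto intro: multilinear_Cons\<close>)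
      moreover have "mlin (m' + n) (B m n' g (feed x f))"
        unfolding mn by (rule less.hyps) (use s x less.prems in \<open>auto intro: multilinear_Cons\<close>)
      ultimately show "mlin (m' + n) (\<lambda>xs. B m' n (feed x g) f xs \<oplus>\<^sub>G
            alt G m (B m n' g (feed x f) xs))"
        by (rule mlin_add_alt)
    next
      fix xs assume xs: "xs \<in> tuples (m' + n) V"
      then have xs': "xs \<in> tuples (m + n') V" by (simp add: mn)
      show "(\<lambda>x. B m' n (feed x g) f xs \<oplus>\<^sub>G alt G m (B m n' g (feed x f) xs)) \<in> module_hom K V G"
      proof (intro module_homI V.module_axioms G.module_axioms)
        fix a b x y assume h: "a \<in> carrier K" "b \<in> carrier K" "x \<in> carrier V" "y \<in> carrier V"
        let ?z = "a \<odot>\<^sub>V x \<oplus>\<^sub>V b \<odot>\<^sub>V y"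
        have "B m' n (feed ?z g) f xs =
            a \<odot>\<^sub>G B m' n (feed x g) f xs \<oplus>\<^sub>G b \<odot>\<^sub>G B m' n (feed y g) f xs"
          by (rule rec_bracket_lin_left) (use less.prems s h xs in \<open>auto intro: multilinear_Cons simp: mlin_lin\<close>)
        moreover have "B m n' g (feed ?z f) xs =
            a \<odot>\<^sub>G B m n' g (feed x f) xs \<oplus>\<^sub>G b \<odot>\<^sub>G B m n' g (feed y f) xs"
          by (rule rec_bracket_lin_right) (use less.prems s h xs' in \<open>auto intro: multilinear_Cons simp: mlin_lin\<close>)
        ultimately show "B m' n (feed ?z g) f xs \<oplus>\<^sub>G alt G m (B m n' g (feed ?z f) xs) =
            a \<odot>\<^sub>G (B m' n (feed x g) f xs \<oplus>\<^sub>G alt G m (B m n' g (feed x f) xs)) \<oplus>\<^sub>G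
            b \<odot>\<^sub>G (B m' n (feed y g) f xs \<oplus>\<^sub>G alt G m (B m n' g (feed y f) xs))"
          using h cl[OF _ xs] by (simp add: lin_comb_simps)
      qed (use cl xs in auto)
    qed
  qed
qed

section \<open>The Jacobi identity of the recursive bracket\<close>

lemma act_act:
  assumes "mlin n f" "c \<in> carrier G" "d \<in> carrier G" "xs \<in> tuples n V"
  shows "act n c (act n d f) xs = act n (br c d) f xs \<oplus>\<^sub>G act n d (act n c f) xs"
  using assms
proof (induction n arbitrary: f xs)
  case 0
  then show ?case by (auto intro: bracket_leibniz)
next
  case (Suc n)
  obtain x xs' where xs: "xs = x # xs'" "x \<in> carrier V" "xs' \<in> tuples n V"
    using Suc.prems by (auto elim: tuples_SucE)
  note m = multilinear_Cons[OF Suc.prems(1)]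
  have c: "f (y # xs') \<in> carrier G" if "y \<in> carrier V" for y
    using Suc.prems(1) that xs by (intro multilinear_closed) auto
  have e: "act n a (act n b (feed x f)) xs' \<in> carrier G" if "a \<in> carrier G" "b \<in> carrier G" for a b
    using that xs m by (auto intro!: act_closed mlin_act)
  have d: "act n a (feed y f) xs' \<in> carrier G" if "a \<in> carrier G" "y \<in> carrier V" for a y
    using that xs m by (auto intro!: act_closed)
  have 1: "act n a (\<lambda>ys. act (Suc n) b f (x # ys)) xs' =
      act n a (act n b (feed x f)) xs' \<ominus>\<^sub>G act n a (\<lambda>ys. f (\<rho> b x # ys)) xs'"
    if "a \<in> carrier G" "b \<in> carrier G" for a b
    by (rule act_diff) (use that xs in \<open>auto intro!: m mlin_act mlin_diff\<close>)
  have 2: "act (Suc n) a (act (Suc n) b f) (x # xs') =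
      act n a (act n b (feed x f)) xs' \<ominus>\<^sub>G act n a (\<lambda>ys. f (\<rho> b x # ys)) xs' \<ominus>\<^sub>G
      (act n b (\<lambda>ys. f (\<rho> a x # ys)) xs' \<ominus>\<^sub>G f (\<rho> b (\<rho> a x) # xs'))"
    if "a \<in> carrier G" "b \<in> carrier G" for a b
    using 1[OF that] by simp
  \<comment> \<open>\<open>\<rho>\<close> turns the bracket into a commutator. Its first term
    cancels against the same term in the action of \<open>d\<close> on
    \<open>act (Suc n) c f\<close>.\<close>
  have 3: "f (\<rho> (br c d) x # xs') = f (\<rho> c (\<rho> d x) # xs') \<ominus>\<^sub>G f (\<rho> d (\<rho> c x) # xs')"
    using Suc.prems xs by (simp add: rhoL_bracket hom_diff[OF multilinear_hd])
  have 4: "act n c (act n d (feed x f)) xs' =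
      act n (br c d) (feed x f) xs' \<oplus>\<^sub>G act n d (act n c (feed x f)) xs'"
    by (rule Suc.IH) (use Suc.prems xs m in auto)
  show ?case unfolding xs(1) 2[OF Suc.prems(2,3)] 2[OF Suc.prems(3,2)] diag_act_Cons[OF refl, of G R n "br c d"] 3 4
    by (rule G.M.act_act_identity) (use c d e Suc.prems xs in auto)
qed

lemma rec_bracket_0_left: "B 0 n g f = act n (g []) f"
  by (simp add: fun_eq_iff)

lemma act_add_alt:
  assumes "mlin n f" "mlin n f'" "mlin n h" "c \<in> carrier G" "xs \<in> tuples n V"
    and "\<And>ys. ys \<in> tuples n V \<Longrightarrow> h ys = f ys \<oplus>\<^sub>G alt G k (f' ys)"
  shows "act n c h xs = act n c f xs \<oplus>\<^sub>G alt G k (act n c f' xs)"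
  using rec_bracket_add_alt_right[of 0 "\<lambda>_. c" n f f' h xs k] assms by (simp add: rec_bracket_0_left)

text \<open>This derivation property is the Jacobi identity with a first entry of degree 0. If one
  of the maps has no arguments, it reduces to \<open>act_act\<close>; otherwise the terms in which
  \<open>c\<close> hits the fed vector match on both sides.\<close>

lemma act_rec_bracket:
  assumes "mlin m g" "mlin n f" "c \<in> carrier G" "xs \<in> tuples (m + n) V"
  shows "act (m + n) c (B m n g f) xs = B m n (act m c g) f xs \<oplus>\<^sub>G B m n g (act n c f) xs"
  using assms
proof (induction "m + n" arbitrary: m n g f xs rule: less_induct)
  case less
  show ?case
  proof (cases rule: nat_pair_cases[where m = m and n = n])
    case 1
    then show ?thesis using less.prems act_act[of n f c "g []" xs] by (simp add: rec_bracket_0_left)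
  next
    case (2 m')
    let ?d = "f []"
    have d: "?d \<in> carrier G" and g: "mlin m (act m ?d g)" using less.prems 2 by (simp_all add: mlin_act)
    have B0: "B m 0 h f = (\<lambda>xs. \<ominus>\<^sub>G act m (f []) h xs)" for h f using 2 by (simp add: fun_eq_iff)
    have "act m c (\<lambda>xs. \<ominus>\<^sub>G act m ?d g xs) xs = \<ominus>\<^sub>G act m c (act m ?d g) xs"
      by (rule act_neg[OF g mlin_neg[OF g]]) (use less.prems 2 in auto)
    also have "act m c (act m ?d g) xs = act m (br c ?d) g xs \<oplus>\<^sub>G act m ?d (act m c g) xs"
      using less.prems 2 d by (intro act_act) auto
    finally show ?thesis using less.prems d \<open>n = 0\<close>
      by (simp add: B0 G.M.minus_add G.M.a_comm act_closed mlin_act del: diag_act.simps(2) rec_bracket.simps)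
  next
    case (s m' n')
    obtain x xs' where xs: "xs = x # xs'" "x \<in> carrier V" "xs' \<in> tuples (m' + n) V"
      using less.prems s by (auto elim: tuples_SucE)
    let ?g = "feed x g" and ?f = "feed x f"
    let ?g' = "\<lambda>ys. g (\<rho> c x # ys)" and ?f' = "\<lambda>ys. f (\<rho> c x # ys)"
    have mn: "m' + n = m + n'" "m + n = Suc (m' + n)" using s by auto
    have t: "xs' \<in> tuples (m + n') V" using xs mn by simp
    have c: "c \<in> carrier G" "\<rho> c x \<in> carrier V" using less.prems xs by auto
    note g = less.prems(1) and f = less.prems(2)
    have g': "mlin m' ?g" "mlin m' ?g'" and f': "mlin n' ?f" "mlin n' ?f'"
      using multilinear_Cons[OF g[unfolded s]] multilinear_Cons[OF f[unfolded s]] xs c by simp_all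
    note ac = mlin_act[OF g c(1)] mlin_act[OF f c(1)] mlin_act[OF g'(1) c(1)] mlin_act[OF f'(1) c(1)]
    have acx: "mlin m' (\<lambda>ys. act m c g (x # ys))" "mlin n' (\<lambda>ys. act n c f (x # ys))"
      using multilinear_Cons[OF ac(1)[unfolded s]] multilinear_Cons[OF ac(2)[unfolded s]] xs
      by (simp_all add: s del: diag_act.simps)
    have P: "mlin (m' + n) (B m' n ?g f)" by (rule mlin_rec_bracket[OF g'(1) f])
    have Q: "mlin (m' + n) (B m n' g ?f)" unfolding mn by (rule mlin_rec_bracket[OF g f'(1)])
    have "act (m' + n) c (\<lambda>ys. B m n g f (x # ys)) xs' =
        act (m' + n) c (B m' n ?g f) xs' \<oplus>\<^sub>G alt G m (act (m' + n) c (B m n' g ?f) xs')"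
      unfolding rec_bracket_Cons[OF s]
      by (rule act_add_alt[OF P Q mlin_add_alt[OF P Q] c(1) xs(3) refl])
    also have "act (m' + n) c (B m' n ?g f) xs' = B m' n (act m' c ?g) f xs' \<oplus>\<^sub>G B m' n ?g (act n c f) xs'"
      by (rule less.hyps[OF _ g'(1) f c(1) xs(3)]) (simp add: s)
    also have "act (m' + n) c (B m n' g ?f) xs' = B m n' (act m c g) ?f xs' \<oplus>\<^sub>G B m n' g (act n' c ?f) xs'"
      unfolding mn(1) by (rule less.hyps[OF _ g f'(1) c(1) t]) (simp add: s)
    finally have L: "act (m + n) c (B m n g f) xs =
      ((B m' n (act m' c ?g) f xs' \<oplus>\<^sub>G B m' n ?g (act n c f) xs') \<oplus>\<^sub>G
        alt G m (B m n' (act m c g) ?f xs' \<oplus>\<^sub>G B m n' g (act n' c ?f) xs')) \<ominus>\<^sub>G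
      (B m' n ?g' f xs' \<oplus>\<^sub>G alt G m (B m n' g ?f' xs'))"
      unfolding xs(1) diag_act_Cons[OF mn(2)] unfolding rec_bracket_Cons[OF s] by simp
    \<comment> \<open>Feeding \<open>x\<close> to the acted map leaves a correction in which
      \<open>x\<close> is replaced by \<open>\<rho> c x\<close>. Writing its minus sign as
      \<open>alt G 1\<close> makes the expansion rule applicable.\<close>
    have "B m' n (\<lambda>ys. act m c g (x # ys)) f xs' = B m' n (act m' c ?g) f xs' \<oplus>\<^sub>G alt G 1 (B m' n ?g' f xs')"
      by (rule rec_bracket_add_alt_left[OF ac(3) g'(2) acx(1) f xs(3)])
        (simp add: diag_act_Cons[OF s(1)] alt_def a_minus_def del: diag_act.simps)
    moreover have "B m n' g (\<lambda>ys. act n c f (x # ys)) xs' = B m n' g (act n' c ?f) xs' \<oplus>\<^sub>G alt G 1 (B m n' g ?f' xs')"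
      by (rule rec_bracket_add_alt_right[OF g ac(4) f'(2) acx(2) t])
        (simp add: diag_act_Cons[OF s(2)] alt_def a_minus_def del: diag_act.simps)
    ultimately have R: "B m n (act m c g) f xs \<oplus>\<^sub>G B m n g (act n c f) xs =
        ((B m' n (act m' c ?g) f xs' \<ominus>\<^sub>G B m' n ?g' f xs') \<oplus>\<^sub>G alt G m (B m n' (act m c g) ?f xs')) \<oplus>\<^sub>G
        (B m' n ?g (act n c f) xs' \<oplus>\<^sub>G alt G m (B m n' g (act n' c ?f) xs' \<ominus>\<^sub>G B m n' g ?f' xs'))"
      unfolding xs(1) rec_bracket_Cons[OF s] by (simp add: a_minus_def alt_def[of G "Suc 0"])
    show ?thesis unfolding L R
      by (rule G.M.derivation_identity)
        (rule rec_bracket_closed[OF ac(3) f xs(3)] rec_bracket_closed[OF g'(1) ac(2) xs(3)]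
          rec_bracket_closed[OF ac(1) f'(1) t] rec_bracket_closed[OF g ac(4) t]
          rec_bracket_closed[OF g'(2) f xs(3)] rec_bracket_closed[OF g f'(2) t])+
  qed
qed

text \<open>For m = 0 this is the derivation property, and for n = 0 or k = 0 a rearrangement of it.
  If all three maps have arguments, feeding \<open>x\<close> to each of them in turn gives three
  instances of the induction hypothesis, and the sign identity assembles them.\<close>

lemma rec_bracket_jacobi:
  assumes "mlin m g" "mlin n h" "mlin k f" "xs \<in> tuples (m + n + k) V"
  shows "B m (n + k) g (B n k h f) xs =
    B (m + n) k (B m n g h) f xs \<oplus>\<^sub>G alt G (m * n) (B n (m + k) h (B m k g f) xs)"
  using assms
proof (induction "m + n + k" arbitrary: m n k g h f xs rule: less_induct)
  case less
  note g = less.prems(1) and h = less.prems(2) and f = less.prems(3)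
  consider "m = 0" | "m > 0" "n = 0" | "m > 0" "n > 0" "k = 0"
    | (s) m' n' k' where "m = Suc m'" "n = Suc n'" "k = Suc k'"
    by (metis not0_implies_Suc not_gr0)
  then show ?case
  proof cases
    case 1
    then show ?thesis using act_rec_bracket[OF h f, of "g []" xs] less.prems by (simp add: rec_bracket_0_left)
  next
    case 2
    let ?d = "h []"
    have d: "?d \<in> carrier G" using h 2 by simp
    have t: "xs \<in> tuples (m + k) V" using less.prems 2 by simp
    have a: "mlin m (act m ?d g)" by (rule mlin_act[OF g d])
    have B0: "B m 0 g h = (\<lambda>xs. \<ominus>\<^sub>G act m ?d g xs)" using 2 by (simp add: fun_eq_iff rec_bracket_0_right)
    have 1: "B m k (\<lambda>xs. \<ominus>\<^sub>G act m ?d g xs) f xs = alt G 1 (B m k (act m ?d g) f xs)"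
      by (rule rec_bracket_alt_left[OF a mlin_neg[OF a] f t]) (simp add: alt_def)
    have 2: "act (m + k) ?d (B m k g f) xs = B m k (act m ?d g) f xs \<oplus>\<^sub>G B m k g (act k ?d f) xs"
      by (rule act_rec_bracket[OF g f d t])
    have c: "B m k (act m ?d g) f xs \<in> carrier G" "B m k g (act k ?d f) xs \<in> carrier G"
      by (rule rec_bracket_closed[OF a f t] rec_bracket_closed[OF g mlin_act[OF f d] t])+
    have "B m k g (act k ?d f) xs = \<ominus>\<^sub>G B m k (act m ?d g) f xs \<oplus>\<^sub>G 
        (B m k (act m ?d g) f xs \<oplus>\<^sub>G B m k g (act k ?d f) xs)"
      using c by (simp add: G.M.r_neg1)
    then show ?thesis using \<open>n = 0\<close> by (simp add: B0 1 2 rec_bracket_0_left alt_def)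
  next
    case 3
    let ?d = "f []"
    have d: "?d \<in> carrier G" using f 3 by simp
    have t: "xs \<in> tuples (m + n) V" "xs \<in> tuples (n + m) V" using less.prems 3 by (simp_all add: add.commute)
    have a: "mlin n (act n ?d h)" "mlin m (act m ?d g)" by (rule mlin_act[OF h d] mlin_act[OF g d])+
    have B0: "B p 0 u f = (\<lambda>xs. \<ominus>\<^sub>G act p ?d u xs)" if "p > 0" for p u
      using that by (simp add: fun_eq_iff rec_bracket_0_right)
    have 1: "B m n g (\<lambda>xs. \<ominus>\<^sub>G act n ?d h xs) xs = alt G 1 (B m n g (act n ?d h) xs)"
      by (rule rec_bracket_alt_right[OF g a(1) mlin_neg[OF a(1)] t(1)]) (simp add: alt_def)
    have 2: "B n m h (\<lambda>xs. \<ominus>\<^sub>G act m ?d g xs) xs = alt G 1 (B n m h (act m ?d g) xs)"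
      by (rule rec_bracket_alt_right[OF h a(2) mlin_neg[OF a(2)] t(2)]) (simp add: alt_def)
    have 4: "act (m + n) ?d (B m n g h) xs = B m n (act m ?d g) h xs \<oplus>\<^sub>G B m n g (act n ?d h) xs"
      by (rule act_rec_bracket[OF g h d t(1)])
    \<comment> \<open>The derivation property has \<open>h\<close> as second entry, the last term of
      the goal has it as first entry; antisymmetry interchanges the two.\<close>
    have 5: "B m n (act m ?d g) h xs = \<ominus>\<^sub>G alt G (m * n) (B n m h (act m ?d g) xs)"
      by (rule rec_bracket_antisym[OF a(2) h t(1)]) (use 3 in simp)
    have c: "B m n g (act n ?d h) xs \<in> carrier G" "B n m h (act m ?d g) xs \<in> carrier G"
      by (rule rec_bracket_closed[OF g a(1) t(1)] rec_bracket_closed[OF h a(2) t(2)])+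
    show ?thesis using 3 c by (simp add: B0 1 2 4 5 alt_def G.M.minus_add G.M.a_ac G.M.r_neg G.M.r_neg1 G.M.r_neg2)
  next
    case s
    obtain x xs' where xs: "xs = x # xs'" "x \<in> carrier V" "xs' \<in> tuples (m' + n + k) V"
      using less.prems(4) s by (auto elim: tuples_SucE)
    let ?g = "feed x g" and ?h = "feed x h" and ?f = "feed x f"
    have g': "mlin m' ?g" and h': "mlin n' ?h" and f': "mlin k' ?f"
      using multilinear_Cons[OF g[unfolded s]] multilinear_Cons[OF h[unfolded s]] 
        multilinear_Cons[OF f[unfolded s]] xs by simp_all
    have e: "n + k = Suc (n' + k)" "m + n = Suc (m' + n)" "m + k = Suc (m' + k)"
      "n + k' = n' + k" "m + n' = m' + n" "m + k' = m' + k"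
      using s by auto
    have t: "xs' \<in> tuples (m' + (n + k)) V" "xs' \<in> tuples (m + (n' + k)) V" "xs' \<in> tuples (m + (n + k')) V"
      "xs' \<in> tuples (m + n' + k) V" "xs' \<in> tuples (m + n + k') V" "xs' \<in> tuples (m' + n + k) V"
      "xs' \<in> tuples (n + (m' + k)) V" "xs' \<in> tuples (n' + (m + k)) V"  "xs' \<in> tuples (n + (m + k')) V"
      using xs(3) s by (simp_all add: add_ac)
    define H where "H = B n k h f"
    define A where "A = B m n g h"
    define C where "C = B m k g f"
    have Hx: "H (x # ys) = B n' k ?h f ys \<oplus>\<^sub>G alt G n (B n k' h ?f ys)" for ys
      unfolding H_def by (rule rec_bracket_Cons[OF s(2,3)])
    have Ax: "A (x # ys) = B m' n ?g h ys \<oplus>\<^sub>G alt G m (B m n' g ?h ys)" for ys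
      unfolding A_def by (rule rec_bracket_Cons[OF s(1,2)])
    have Cx: "C (x # ys) = B m' k ?g f ys \<oplus>\<^sub>G alt G m (B m k' g ?f ys)" for ys
      unfolding C_def by (rule rec_bracket_Cons[OF s(1,3)])
    have H: "mlin (n + k) H" unfolding H_def by (rule mlin_rec_bracket[OF h f])
    have A: "mlin (m + n) A" unfolding A_def by (rule mlin_rec_bracket[OF g h])
    have C: "mlin (m + k) C" unfolding C_def by (rule mlin_rec_bracket[OF g f])
    have H': "mlin (n' + k) (feed x H)" using multilinear_Cons[OF H[unfolded e(1)]] xs by simp
    have A': "mlin (m' + n) (feed x A)" using multilinear_Cons[OF A[unfolded e(2)]] xs by simp
    have C': "mlin (m' + k) (feed x C)" using multilinear_Cons[OF C[unfolded e(3)]] xs by simp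
    note H1 = mlin_rec_bracket[OF h' f] and H2 = mlin_rec_bracket[OF h f', unfolded e(4)]
    note A1 = mlin_rec_bracket[OF g' h] and A2 = mlin_rec_bracket[OF g h', unfolded e(5)]
    note C1 = mlin_rec_bracket[OF g' f] and C2 = mlin_rec_bracket[OF g f', unfolded e(6)]
    have J1: "B m' (n + k) ?g H xs' = B (m' + n) k (B m' n ?g h) f xs' \<oplus>\<^sub>G 
        alt G (m' * n) (B n (m' + k) h (B m' k ?g f) xs')"
      unfolding H_def by (rule less.hyps[OF _ g' h f t(6)]) (simp add: s)
    have J2: "B m (n' + k) g (B n' k ?h f) xs' = B (m' + n) k (B m n' g ?h) f xs' \<oplus>\<^sub>G 
        alt G (m * n') (B n' (m + k) ?h C xs')"
      unfolding C_def e(5)[symmetric] by (rule less.hyps[OF _ g h' f t(4)]) (simp add: s)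
    have J3: "B m (n' + k) g (B n k' h ?f) xs' = B (m + n) k' A ?f xs' \<oplus>\<^sub>G 
        alt G (m * n) (B n (m' + k) h (B m k' g ?f) xs')"
      unfolding A_def e(4)[symmetric] e(6)[symmetric] by (rule less.hyps[OF _ g h f' t(5)]) (simp add: s)
    have L1: "B m (n' + k) g (feed x H) xs' = B m (n' + k) g (B n' k ?h f) xs' \<oplus>\<^sub>G
        alt G n (B m (n' + k) g (B n k' h ?f) xs')"
      by (rule rec_bracket_add_alt_right[OF g H1 H2 H' t(2) Hx])
    have R1: "B (m' + n) k (feed x A) f xs' = B (m' + n) k (B m' n ?g h) f xs' \<oplus>\<^sub>G
        alt G m (B (m' + n) k (B m n' g ?h) f xs')"
      by (rule rec_bracket_add_alt_left[OF A1 A2 A' f t(6) Ax])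
    have R2: "B n (m' + k) h (feed x C) xs' = B n (m' + k) h (B m' k ?g f) xs' \<oplus>\<^sub>G
        alt G m (B n (m' + k) h (B m k' g ?f) xs')"
      by (rule rec_bracket_add_alt_right[OF h C1 C2 C' t(7) Cx])
    show ?thesis
      unfolding H_def[symmetric] A_def[symmetric] C_def[symmetric] xs(1) 
        rec_bracket_Cons[OF s(1) e(1)] rec_bracket_Cons[OF e(2) s(3)] rec_bracket_Cons[OF s(2) e(3)]
        L1 R1 R2 J1 J2 J3
      by (rule G.M.jacobi_identity[OF _ _ _ _ _ _ s(1,2)])
        (rule rec_bracket_closed[OF A1 f t(6)] rec_bracket_closed[OF A2 f t(6)]
          rec_bracket_closed[OF h C1 t(7)] rec_bracket_closed[OF h C2 t(7)]
          rec_bracket_closed[OF h' C t(8)] rec_bracket_closed[OF A f' t(5)])+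
  qed
qed

subsection \<open>Comparison with the derived bracket\<close>

abbreviation "E \<equiv> direct_sum G V"

sublocale E: abelian_module_group E
  using direct_sum_is_module[OF G.module_axioms V.module_axioms]
  by (simp add: abelian_module_group_def module_def)

lemma carrier_E: "carrier E = carrier G \<times> carrier V"
  and zero_E: "\<zero>\<^bsub>E\<^esub> = (\<zero>\<^sub>G, \<zero>\<^sub>V)"
  and add_E: "z \<oplus>\<^bsub>E\<^esub> w = (fst z \<oplus>\<^sub>G fst w, snd z \<oplus>\<^sub>V snd w)"
  by (simp_all add: direct_sum_def)

lemma minus_E: "z \<in> carrier E \<Longrightarrow> \<ominus>\<^bsub>E\<^esub> z = (\<ominus>\<^sub>G fst z, \<ominus>\<^sub>V snd z)"
  by (rule E.minus_equality) (auto simp: carrier_E zero_E add_E G.M.l_neg V.M.l_neg)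

lemma diff_E: "z \<in> carrier E \<Longrightarrow> w \<in> carrier E \<Longrightarrow>
    z \<ominus>\<^bsub>E\<^esub> w = (fst z \<ominus>\<^sub>G fst w, snd z \<ominus>\<^sub>V snd w)"
  by (simp add: a_minus_def minus_E add_E)

lemma alt_E: "z \<in> carrier E \<Longrightarrow> alt E k z = (alt G k (fst z), alt V k (snd z))"
  by (simp add: alt_def minus_E)

text \<open>In contrast to \<open>extend_by_zero\<close> there is no restriction to tuples, so
  feeding a pair to \<open>ext g\<close> again gives an \<open>ext\<close>. In the same way
  \<open>mu\<close> is the unrestricted semidirect multiplication, with the vanishing right action
  left out.\<close>

definition ext :: "('v list \<Rightarrow> 'g) \<Rightarrow> ('g \<times> 'v) list \<Rightarrow> 'g \<times> 'v" where
  "ext g zs = (g (map snd zs), \<zero>\<^sub>V)"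

definition mu :: "('g \<times> 'v) list \<Rightarrow> 'g \<times> 'v" where
  "mu zs = (br (fst (zs ! 0)) (fst (zs ! 1)), \<rho> (fst (zs ! 0)) (snd (zs ! 1)))"

abbreviation inV :: "'v list \<Rightarrow> ('g \<times> 'v) list" where
  "inV vs \<equiv> map (\<lambda>v. (\<zero>\<^sub>G, v)) vs"

lemma inV_in_tuples [simp]: "inV vs \<in> tuples n E \<longleftrightarrow> vs \<in> tuples n V"
  by (auto simp: tuples_def carrier_E)

lemma map_snd_Pair [simp]: "map (snd \<circ> Pair c) vs = vs"
  by (induction vs) auto

lemma map_snd_in_tuples: "zs \<in> tuples n E \<Longrightarrow> map snd zs \<in> tuples n V"
  by (auto simp: tuples_def carrier_E)

lemma ext_closed: "mlin n g \<Longrightarrow> zs \<in> tuples n E \<Longrightarrow> ext g zs \<in> carrier E"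
  by (simp add: ext_def carrier_E multilinear_closed map_snd_in_tuples)

lemma ext_Cons [simp]: "ext g (z # zs) = ext (\<lambda>ys. g (snd z # ys)) zs"
  by (simp add: ext_def)

lemma tuples_2E:
  assumes "zs \<in> tuples (Suc (Suc 0)) E"
  obtains x u y v where "zs = [(x, u), (y, v)]" "x \<in> carrier G" "y \<in> carrier G" "u \<in> carrier V" "v \<in> carrier V"
  using assms by (elim tuples_SucE) (auto simp: carrier_E)

lemma tuples_1E:
  assumes "zs \<in> tuples (Suc 0) E"
  obtains y v where "zs = [(y, v)]" "y \<in> carrier G" "v \<in> carrier V"
  using assms by (elim tuples_SucE) (auto simp: carrier_E)

lemma mu_closed: "zs \<in> tuples (Suc (Suc 0)) E \<Longrightarrow> mu zs \<in> carrier E"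
  by (elim tuples_2E) (auto simp: mu_def carrier_E)

lemma br_zero [simp]: "x \<in> carrier G \<Longrightarrow> br \<zero>\<^sub>G x = \<zero>\<^sub>G" "x \<in> carrier G \<Longrightarrow> br x \<zero>\<^sub>G = \<zero>\<^sub>G"
  using br_lin[of x x x "\<zero>\<^bsub>K\<^esub>" "\<zero>\<^bsub>K\<^esub>"] by simp_all

lemma rho_zero [simp]: "v \<in> carrier V \<Longrightarrow> \<rho> \<zero>\<^sub>G v = \<zero>\<^sub>V" "x \<in> carrier G \<Longrightarrow> \<rho> x \<zero>\<^sub>V = \<zero>\<^sub>V"
  using rho_lin(1)[of "\<zero>\<^sub>G" "\<zero>\<^sub>G" v v "\<zero>\<^bsub>K\<^esub>" "\<zero>\<^bsub>K\<^esub>"]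
    rho_lin(2)[of x x "\<zero>\<^sub>V" "\<zero>\<^sub>V" "\<zero>\<^bsub>K\<^esub>" "\<zero>\<^bsub>K\<^esub>"] by simp_all

lemma mu_zero: "zs \<in> tuples (Suc (Suc 0)) E \<Longrightarrow> \<zero>\<^bsub>E\<^esub> \<in> set zs \<Longrightarrow> mu zs = \<zero>\<^bsub>E\<^esub>"
  by (elim tuples_2E) (auto simp: mu_def zero_E)

lemma mlin_zero: "mlin n g \<Longrightarrow> xs \<in> tuples n V \<Longrightarrow> \<zero>\<^sub>V \<in> set xs \<Longrightarrow> g xs = \<zero>\<^sub>G"
proof (induction n arbitrary: g xs)
  case (Suc n)
  obtain y ys where xs: "xs = y # ys" "y \<in> carrier V" "ys \<in> tuples n V"
    using Suc.prems(2) by (rule tuples_SucE)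
  show ?case
  proof (cases "y = \<zero>\<^sub>V")
    case True
    then show ?thesis using hom_zero[OF multilinear_hd[OF Suc.prems(1) xs(3)]] xs by simp
  next
    case False
    then show ?thesis using Suc.IH[OF multilinear_Cons[OF Suc.prems(1) xs(2)] xs(3)] Suc.prems(3) xs by auto
  qed
qed simp

lemma ext_zero: "mlin n g \<Longrightarrow> zs \<in> tuples n E \<Longrightarrow> \<zero>\<^bsub>E\<^esub> \<in> set zs \<Longrightarrow> ext g zs = \<zero>\<^bsub>E\<^esub>"
  by (force simp: ext_def zero_E intro!: mlin_zero map_snd_in_tuples)

text \<open>\<open>D m g\<close> is \<open>[\<mu>, g]\<close>, and \<open>DD m n g1 g2\<close> below is \<open>[[\<mu>, g1], g2]\<close>; the exponents of their signs
  differ from those of the Balavoine bracket by even numbers, in order to avoid truncated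
  subtraction.\<close>

definition D :: "nat \<Rightarrow> ('v list \<Rightarrow> 'g) \<Rightarrow> ('g \<times> 'v) list \<Rightarrow> 'g \<times> 'v" where
  "D m g zs = pre_lie E 2 m mu (ext g) zs \<ominus>\<^bsub>E\<^esub> alt E (Suc m) (pre_lie E m 2 (ext g) mu zs)"

lemma D_terms_closed:
  assumes "mlin m g" "zs \<in> tuples (Suc m) E"
  shows "pre_lie E 2 m mu (ext g) zs \<in> carrier E" "pre_lie E m 2 (ext g) mu zs \<in> carrier E"
  using assms by (auto intro!: E.pre_lie_closed mu_closed ext_closed[of m] simp: numeral_2_eq_2)

lemma D_closed: "mlin m g \<Longrightarrow> zs \<in> tuples (Suc m) E \<Longrightarrow> D m g zs \<in> carrier E"
  unfolding D_def by (intro E.minus_closed E.alt_closed D_terms_closed)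

lemma D_0: "g [] \<in> carrier G \<Longrightarrow> zs \<in> tuples 1 E \<Longrightarrow> D 0 g zs = mu ((g [], \<zero>\<^sub>V) # zs)"
proof -
  assume "g [] \<in> carrier G" "zs \<in> tuples 1 E"
  then have "mu ((g [], \<zero>\<^sub>V) # zs) \<in> carrier E" by (intro mu_closed) (simp add: carrier_E)
  then show ?thesis by (simp add: D_def numeral_2_eq_2 ext_def a_minus_def)
qed

text \<open>A product whose left factor lies in \<open>V\<close> vanishes, as \<open>\<rho>\<close>
  is fed with 0 and there is no right action. So of the four terms only the two in which
  \<open>v\<close> enters \<open>g\<close> survive, and they form \<open>D\<close> of the fed
  map.\<close>

lemma D_Cons_V:
  assumes g: "mlin (Suc b) g" and v: "v \<in> carrier V" and zs: "zs \<in> tuples (Suc b) E"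
  shows "D (Suc b) g ((\<zero>\<^sub>G, v) # zs) = D b (feed v g) zs"
proof -
  let ?z = "(\<zero>\<^sub>G, v)" and ?g = "feed v g"
  have g': "mlin b ?g" by (rule multilinear_Cons[OF g v])
  have mz: "mu (?z # ys) = \<zero>\<^bsub>E\<^esub>" if "ys \<in> tuples (Suc 0) E" for ys
    using that by (elim tuples_1E) (auto simp: mu_def zero_E)
  have 1: "pre_lie E (Suc 0) (Suc b) (feed ?z mu) (ext g) zs = \<zero>\<^bsub>E\<^esub>"
    by (rule E.pre_lie_zero_left) (use zs ext_closed[OF g] mz in auto)
  have 2: "pre_lie E (Suc b) (Suc 0) (ext g) (feed ?z mu) zs = \<zero>\<^bsub>E\<^esub>"
    by (rule E.pre_lie_zero_right) (use zs ext_zero[OF g] mz in auto)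
  note c = D_terms_closed[OF g' zs, unfolded numeral_2_eq_2]
  show ?thesis using c unfolding D_def numeral_2_eq_2
    by (simp add: 1 2) (simp add: alt_def a_minus_def)
qed

text \<open>Multiplication by \<open>c\<close> has one remaining argument, so its insertions into
  \<open>g\<close> carry no signs and replace each v_i in turn by rho(c) v_i. The sum of these terms
  is the part subtracted in the diagonal action.\<close>

lemma pre_lie_ext_mu:
  "mlin a g \<Longrightarrow> c \<in> carrier G \<Longrightarrow> vs \<in> tuples a V \<Longrightarrow>
    pre_lie E a (Suc 0) (ext g) (\<lambda>ys. mu ((c, \<zero>\<^sub>V) # ys)) (inV vs) =
      (br c (g vs) \<ominus>\<^sub>G act a c g vs, \<zero>\<^sub>V)"
proof (induction a arbitrary: g vs)
  case 0
  then show ?case by (simp add: zero_E a_minus_def G.M.r_neg)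
next
  case (Suc a)
  obtain v vs' where vs: "vs = v # vs'" "v \<in> carrier V" "vs' \<in> tuples a V"
    using Suc.prems(3) by (rule tuples_SucE)
  note g' = multilinear_Cons[OF Suc.prems(1)]
  have IH: "pre_lie E a (Suc 0) (ext (feed v g)) (\<lambda>ys. mu ((c, \<zero>\<^sub>V) # ys)) (inV vs') =
      (br c (g (v # vs')) \<ominus>\<^sub>G act a c (feed v g) vs', \<zero>\<^sub>V)"
    by (rule Suc.IH[OF g'[OF vs(2)] Suc.prems(2) vs(3)])
  have c: "act a c (feed v g) vs' \<in> carrier G" by (rule act_closed[OF g'[OF vs(2)] Suc.prems(2) vs(3)])
  have d: "g (v # vs') \<in> carrier G" "g (\<rho> c v # vs') \<in> carrier G"
    using Suc.prems vs by (simp_all add: multilinear_closed)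
  have m: "mu [(c, \<zero>\<^sub>V), (\<zero>\<^sub>G, v)] = (\<zero>\<^sub>G, \<rho> c v)"
    using Suc.prems(2) by (simp add: mu_def)
  have "g (\<rho> c v # vs') \<oplus>\<^sub>G (br c (g (v # vs')) \<ominus>\<^sub>G act a c (feed v g) vs') =
      br c (g (v # vs')) \<ominus>\<^sub>G (act a c (feed v g) vs' \<ominus>\<^sub>G g (\<rho> c v # vs'))"
    using c d Suc.prems(2) by (simp add: a_minus_def G.M.minus_add G.M.a_ac)
  then show ?case by (simp add: vs m IH add_E) (simp add: ext_def)
qed

text \<open>Fed to \<open>ext g\<close>, an element of \<open>G\<close> counts as the zero vector,
  so it has to enter \<open>mu\<close>. Then \<open>mu\<close> after \<open>g\<close> gives
  [c, g(vs)], \<open>g\<close> after \<open>mu\<close> gives the sum of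
  \<open>pre_lie_ext_mu\<close>, and their difference is the diagonal action.\<close>

lemma D_Cons_G:
  assumes g: "mlin (Suc b) g" and c: "c \<in> carrier G" and vs: "vs \<in> tuples (Suc b) V"
  shows "D (Suc b) g ((c, \<zero>\<^sub>V) # inV vs) = (alt G b (act (Suc b) c g vs), \<zero>\<^sub>V)"
proof -
  let ?m = "\<lambda>ys. mu ((c, \<zero>\<^sub>V) # ys)"
  have z: "ext (feed \<zero>\<^sub>V g) ys = \<zero>\<^bsub>E\<^esub>" if "ys \<in> tuples b E" for ys
    using mlin_zero[OF g, of "\<zero>\<^sub>V # map snd ys"] map_snd_in_tuples[OF that] by (simp add: ext_def zero_E)
  have mc: "?m ys \<in> carrier E" if "ys \<in> tuples 1 E" for ys
    using that c by (intro mu_closed) (auto simp: carrier_E)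
  have 1: "pre_lie E (Suc (Suc 0)) b mu (ext (feed \<zero>\<^sub>V g)) (inV vs) = \<zero>\<^bsub>E\<^esub>"
    by (rule E.pre_lie_zero_right) (use vs z mu_zero in auto)
  have "pre_lie E (Suc 0) (Suc b) ?m (ext g) (inV vs) = ?m [ext g (inV vs)]"
    by (rule E.pre_lie_1_left) (use vs mc ext_closed[OF g] in auto)
  also have "\<dots> = (br c (g vs), \<zero>\<^sub>V)"
    using c by (simp add: ext_def mu_def)
  finally have 2: "pre_lie E (Suc 0) (Suc b) ?m (ext g) (inV vs) = (br c (g vs), \<zero>\<^sub>V)" .
  have 3: "pre_lie E b (Suc (Suc 0)) (ext (feed \<zero>\<^sub>V g)) mu (inV vs) = \<zero>\<^bsub>E\<^esub>"
    by (rule E.pre_lie_zero_left) (use vs z mu_closed in auto)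
  note 4 = pre_lie_ext_mu[OF g c vs]
  define u where "u = bracket G c (g vs)"
  define w where "w = diag_act G R (Suc b) c g vs"
  have XY: "u \<in> carrier G" "w \<in> carrier G"
    using c multilinear_closed[OF g vs] act_closed[OF g c vs] by (simp_all add: u_def w_def del: diag_act.simps)
  have u': "(u, \<zero>\<^sub>V) \<in> carrier E" "(u \<ominus>\<^sub>G w, \<zero>\<^sub>V) \<in> carrier E"
    using XY by (auto simp: carrier_E)
  have "pre_lie E 2 (Suc b) mu (ext g) ((c, \<zero>\<^sub>V) # inV vs) = alt E b (u, \<zero>\<^sub>V)"
    using u'(1) unfolding numeral_2_eq_2 u_def by (simp add: 1 2)
  moreover have "pre_lie E (Suc b) 2 (ext g) mu ((c, \<zero>\<^sub>V) # inV vs) = (u \<ominus>\<^sub>G w, \<zero>\<^sub>V)"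
    using u'(2) unfolding numeral_2_eq_2 u_def w_def
    by (simp add: 3 4 del: diag_act.simps)
  ultimately have "D (Suc b) g ((c, \<zero>\<^sub>V) # inV vs) =
      alt E b (u, \<zero>\<^sub>V) \<ominus>\<^bsub>E\<^esub> alt E (Suc (Suc b)) (u \<ominus>\<^sub>G w, \<zero>\<^sub>V)"
    by (simp only: D_def)
  also have "\<dots> = (alt G b u \<ominus>\<^sub>G alt G b (u \<ominus>\<^sub>G w), \<zero>\<^sub>V)"
    using XY by (simp add: diff_E alt_E carrier_E) (simp add: alt_def a_minus_def)
  also have "alt G b u \<ominus>\<^sub>G alt G b (u \<ominus>\<^sub>G w) = alt G b w"
    using XY by (simp add: alt_def a_minus_def G.M.minus_add G.M.r_neg1 G.M.r_neg2)
  finally show ?thesis by (simp only: w_def)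
qed

definition DD :: "nat \<Rightarrow> nat \<Rightarrow> ('v list \<Rightarrow> 'g) \<Rightarrow> ('v list \<Rightarrow> 'g) \<Rightarrow> ('g \<times> 'v) list \<Rightarrow> 'g \<times> 'v" where
  "DD m n g1 g2 zs = pre_lie E (Suc m) n (D m g1) (ext g2) zs \<ominus>\<^bsub>E\<^esub>
     alt E (m * Suc n) (pre_lie E n (Suc m) (ext g2) (D m g1) zs)"

lemma DD_terms_closed:
  assumes "mlin m g1" "mlin n g2" "zs \<in> tuples (m + n) E"
  shows "pre_lie E (Suc m) n (D m g1) (ext g2) zs \<in> carrier E" "pre_lie E n (Suc m) (ext g2) (D m g1) zs \<in> carrier E"
  using assms by (auto intro!: E.pre_lie_closed D_closed ext_closed[of n] simp: add.commute)

text \<open>Both sides satisfy the same recursion, so the base cases decide: a map without arguments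
  acts diagonally on the other one, by \<open>pre_lie_ext_mu\<close> or \<open>D_Cons_G\<close>. For
  m = n = 0 the left side is [g1, g2] and the right side -[g2, g1], which explains the last
  hypothesis.\<close>

lemma fst_DD:
  assumes "mlin m g1" "mlin n g2" "vs \<in> tuples (m + n) V" "m + n > 0"
  shows "fst (DD m n g1 g2 (inV vs)) = alt G (Suc m) (B n m g2 g1 vs)"
  using assms
proof (induction "m + n" arbitrary: m n g1 g2 vs rule: less_induct)
  case less
  note g1 = less.prems(1) and g2 = less.prems(2)
  show ?case
  proof (cases rule: nat_pair_cases[where m = m and n = n])
    case 1
    let ?c = "g1 []" and ?zs = "inV vs"
    have c: "?c \<in> carrier G" using g1 1 by simp
    have vs: "vs \<in> tuples n V" using less.prems 1 by simp
    let ?m = "\<lambda>ys. mu ((?c, \<zero>\<^sub>V) # ys)"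
    have D: "D 0 g1 ys = ?m ys" if "ys \<in> tuples (Suc 0) E" for ys
      using D_0[of g1 ys] c that by simp
    have mc: "?m ys \<in> carrier E" if "ys \<in> tuples (Suc 0) E" for ys
      using that c by (intro mu_closed) (auto simp: carrier_E)
    have "pre_lie E (Suc 0) n (D 0 g1) (ext g2) ?zs = D 0 g1 [ext g2 ?zs]"
      by (rule E.pre_lie_1_left) (use vs mc D ext_closed[OF g2] in auto)
    also have "\<dots> = (br ?c (g2 vs), \<zero>\<^sub>V)"
      using ext_closed[OF g2, of ?zs] vs c by (simp add: D) (simp add: mu_def ext_def)
    finally have p: "pre_lie E (Suc 0) n (D 0 g1) (ext g2) ?zs = (br ?c (g2 vs), \<zero>\<^sub>V)" .
    have "pre_lie E n (Suc 0) (ext g2) (D 0 g1) ?zs = pre_lie E n (Suc 0) (ext g2) ?m ?zs"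
      by (rule pre_lie_cong) (use vs D mc in auto)
    also have "\<dots> = (br ?c (g2 vs) \<ominus>\<^sub>G act n ?c g2 vs, \<zero>\<^sub>V)"
      by (rule pre_lie_ext_mu[OF g2 c vs])
    finally have q: "pre_lie E n (Suc 0) (ext g2) (D 0 g1) ?zs = (br ?c (g2 vs) \<ominus>\<^sub>G act n ?c g2 vs, \<zero>\<^sub>V)" .
    have cl: "br ?c (g2 vs) \<in> carrier G" "act n ?c g2 vs \<in> carrier G"
      using c multilinear_closed[OF g2 vs] act_closed[OF g2 c vs] by auto
    have "fst (DD m n g1 g2 ?zs) = act n ?c g2 vs"
      unfolding DD_def 1 p q using cl
      by (simp add: diff_E carrier_E) (simp add: a_minus_def G.M.minus_add G.M.r_neg1 G.M.r_neg2)
    then show ?thesis using 1 less.prems(4) cl by (simp add: rec_bracket_0_right alt_def)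
  next
    case (2 m')
    have c: "g2 [] \<in> carrier G" using g2 2 by simp
    have vs: "vs \<in> tuples m V" using less.prems 2 by simp
    have "D m g1 ((g2 [], \<zero>\<^sub>V) # inV vs) \<in> carrier E"
      by (rule D_closed[OF g1]) (use c vs in \<open>simp add: carrier_E\<close>)
    then have "DD m n g1 g2 (inV vs) = D m g1 ((g2 [], \<zero>\<^sub>V) # inV vs)"
      by (simp add: DD_def 2 ext_def a_minus_def)
    then have "fst (DD m n g1 g2 (inV vs)) = alt G m' (act m (g2 []) g1 vs)"
      using D_Cons_G[OF g1[unfolded 2] c, of vs] vs 2 by (simp del: diag_act.simps)
    then show ?thesis using 2 by (simp add: alt_def del: diag_act.simps)
  next
    case (s m' n')
    obtain v vs' where vs: "vs = v # vs'" "v \<in> carrier V" "vs' \<in> tuples (m' + n) V"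
      using less.prems(3) s by (auto elim: tuples_SucE)
    let ?z = "(\<zero>\<^sub>G, v)" and ?zs = "inV vs'"
    let ?g1 = "feed v g1" and ?g2 = "feed v g2"
    have g1': "mlin m' ?g1" and g2': "mlin n' ?g2"
      using multilinear_Cons[OF g1[unfolded s] vs(2)] multilinear_Cons[OF g2[unfolded s] vs(2)] by simp_all
    have t: "vs' \<in> tuples (m + n') V" "?zs \<in> tuples (m' + n) E" "?zs \<in> tuples (m + n') E"
      using vs s by simp_all
    have DV: "D m g1 (?z # zs) = D m' ?g1 zs" if "zs \<in> tuples m E" for zs
      unfolding s by (rule D_Cons_V[OF g1[unfolded s] vs(2) that[unfolded s]])
    have Dc: "D m' ?g1 zs \<in> carrier E" if "zs \<in> tuples m E" for zs
      by (rule D_closed[OF g1' that[unfolded s]])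
    have c1: "pre_lie E m n (\<lambda>ys. D m g1 (?z # ys)) (ext g2) ?zs = pre_lie E (Suc m') n (D m' ?g1) (ext g2) ?zs"
      unfolding s(1)[symmetric] by (rule pre_lie_cong) (use t(2) s DV ext_closed[OF g2] in auto)
    have c2: "pre_lie E n m (ext g2) (\<lambda>ys. D m g1 (?z # ys)) ?zs = pre_lie E n (Suc m') (ext g2) (D m' ?g1) ?zs"
      unfolding s(1)[symmetric] by (rule pre_lie_cong) (use t(2) s DV Dc in \<open>auto simp: add.commute\<close>)
    have "pre_lie E (Suc m) n (D m g1) (ext g2) (inV vs) = pre_lie E (Suc m) n' (D m g1) (ext ?g2) ?zs \<oplus>\<^bsub>E\<^esub>
        alt E n' (pre_lie E (Suc m') n (D m' ?g1) (ext g2) ?zs)"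
      unfolding c1[symmetric] unfolding s(2) vs(1) by simp
    moreover have "pre_lie E n (Suc m) (ext g2) (D m g1) (inV vs) = pre_lie E n (Suc m') (ext g2) (D m' ?g1) ?zs \<oplus>\<^bsub>E\<^esub>
        alt E m (pre_lie E n' (Suc m) (ext ?g2) (D m g1) ?zs)"
      unfolding c2[symmetric] unfolding s(2) vs(1) by simp
    \<comment> \<open>The derivation property of feeding, now for the iterated bracket.\<close>
    ultimately have "DD m n g1 g2 (inV vs) = DD m n' g1 ?g2 ?zs \<oplus>\<^bsub>E\<^esub> alt E n' (DD m' n ?g1 g2 ?zs)"
      unfolding DD_def using DD_terms_closed[OF g1 g2' t(3)] DD_terms_closed[OF g1' g2 t(2)] s
      by (simp only: E.bracket_sign_identity)
    moreover have "DD m' n ?g1 g2 ?zs \<in> carrier E"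
      unfolding DD_def by (intro E.minus_closed E.alt_closed DD_terms_closed[OF g1' g2 t(2)])
    ultimately have "fst (DD m n g1 g2 (inV vs)) =
        fst (DD m n' g1 ?g2 ?zs) \<oplus>\<^sub>G alt G n' (fst (DD m' n ?g1 g2 ?zs))"
      by (simp add: add_E alt_E)
    also have "fst (DD m n' g1 ?g2 ?zs) = alt G (Suc m) (B n' m ?g2 g1 vs')"
      by (rule less.hyps[OF _ g1 g2' t(1)]) (use s in simp_all)
    also have "fst (DD m' n ?g1 g2 ?zs) = alt G (Suc m') (B n m' g2 ?g1 vs')"
      by (rule less.hyps[OF _ g1' g2 vs(3)]) (use s in simp_all)
    also have "alt G (Suc m) (B n' m ?g2 g1 vs') \<oplus>\<^sub>G alt G n' (alt G (Suc m') (B n m' g2 ?g1 vs')) =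
        alt G (Suc m) (B n' m ?g2 g1 vs' \<oplus>\<^sub>G alt G n (B n m' g2 ?g1 vs'))"
    proof -
      have "B n' m ?g2 g1 vs' \<in> carrier G" "B n m' g2 ?g1 vs' \<in> carrier G"
        using rec_bracket_closed[OF g2' g1, of vs'] rec_bracket_closed[OF g2 g1', of vs'] t(1) vs(3)
        by (simp_all add: add.commute)
      then show ?thesis by (simp add: G.M.alt_add G.M.alt_alt s) (simp add: alt_def)
    qed
    finally show ?thesis unfolding vs(1) rec_bracket_Cons[OF s(2,1)] .
  qed
qed

lemma semidirect_mult_eq_mu: "zs \<in> tuples (Suc (Suc 0)) E \<Longrightarrow> semidirect_mult G R zs = mu zs"
  by (frule tuples_2E) (auto simp: semidirect_mult_def mu_def numeral_2_eq_2 rhoR_zero elim: tuples_2E)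

lemma extend_by_zero_eq_ext: "zs \<in> tuples n E \<Longrightarrow> extend_by_zero G R n g zs = ext g zs"
  by (simp add: extend_by_zero_def ext_def)

lemma balavoine_semidirect_mult:
  assumes g: "mlin m g" and m: "m \<ge> 1" and zs: "zs \<in> tuples (Suc m) E"
  shows "balavoine E 1 (m - 1) (semidirect_mult G R) (extend_by_zero G R m g) zs = D m g zs"
proof -
  obtain m' where m': "m = Suc m'" using m by (cases m) auto
  have "balavoine E 1 m' (semidirect_mult G R) (extend_by_zero G R m g) zs =
    pre_lie E (Suc 1) (Suc m') (semidirect_mult G R) (extend_by_zero G R m g) zs \<ominus>\<^bsub>E\<^esub>
    alt E (1 * m') (pre_lie E (Suc m') (Suc 1) (extend_by_zero G R m g) (semidirect_mult G R) zs)"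
    using g zs m' by (intro E.balavoine_eq_pre_lie)
      (auto simp: semidirect_mult_eq_mu extend_by_zero_eq_ext mu_closed ext_closed)
  also have "pre_lie E (Suc 1) (Suc m') (semidirect_mult G R) (extend_by_zero G R m g) zs = pre_lie E 2 m mu (ext g) zs"
    unfolding m'[symmetric] numeral_2_eq_2 One_nat_def
    by (rule pre_lie_cong) (use zs g in \<open>auto simp: semidirect_mult_eq_mu extend_by_zero_eq_ext ext_closed\<close>)
  also have "pre_lie E (Suc m') (Suc 1) (extend_by_zero G R m g) (semidirect_mult G R) zs = pre_lie E m 2 (ext g) mu zs"
    unfolding m'[symmetric] numeral_2_eq_2 One_nat_def
    by (rule pre_lie_cong) (use zs g in \<open>auto simp: semidirect_mult_eq_mu extend_by_zero_eq_ext mu_closed\<close>)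
  finally show ?thesis by (simp add: D_def m' alt_def)
qed

text \<open>The prefactor (-1)^(m-1) cancels the sign (-1)^(m+1) of \<open>fst_DD\<close>. The order
  is reversed because, for an element in place of g2, the bracket [[mu, g1], g2] is up to sign the
  action of g2 on g1.\<close>

theorem derived_bracket_eq_rec_bracket:
  assumes g1: "mlin m g1" and g2: "mlin n g2" and mn: "m \<ge> 1" "n \<ge> 1" and vs: "vs \<in> tuples (m + n) V"
  shows "derived_bracket G R m n g1 g2 vs = B n m g2 g1 vs"
proof -
  obtain m' n' where s: "m = Suc m'" "n = Suc n'" using mn by (metis not0_implies_Suc not_one_le_zero)
  let ?P = "balavoine E 1 (m - 1) (semidirect_mult G R) (extend_by_zero G R m g1)" and ?Q = "extend_by_zero G R n g2"
  have zs: "inV vs \<in> tuples (m + n) E" using vs by simp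
  have P: "?P ys = D m g1 ys" if "ys \<in> tuples (Suc m) E" for ys
    by (rule balavoine_semidirect_mult[OF g1 mn(1) that])
  have Q: "?Q ys = ext g2 ys" if "ys \<in> tuples n E" for ys using that by (rule extend_by_zero_eq_ext)
  have "balavoine E m n' ?P ?Q (inV vs) = pre_lie E (Suc m) (Suc n') ?P ?Q (inV vs) \<ominus>\<^bsub>E\<^esub>
      alt E (m * n') (pre_lie E (Suc n') (Suc m) ?Q ?P (inV vs))"
    by (rule E.balavoine_eq_pre_lie) (use zs s P Q D_closed[OF g1] ext_closed[OF g2] in auto)
  also have "pre_lie E (Suc m) (Suc n') ?P ?Q (inV vs) = pre_lie E (Suc m) n (D m g1) (ext g2) (inV vs)"
    unfolding s(2)[symmetric] by (rule pre_lie_cong) (use zs P Q ext_closed[OF g2] in auto)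
  also have "pre_lie E (Suc n') (Suc m) ?Q ?P (inV vs) = pre_lie E n (Suc m) (ext g2) (D m g1) (inV vs)"
    unfolding s(2)[symmetric] by (rule pre_lie_cong) (use zs P Q D_closed[OF g1] in \<open>auto simp: add.commute\<close>)
  also have "pre_lie E (Suc m) n (D m g1) (ext g2) (inV vs) \<ominus>\<^bsub>E\<^esub>
      alt E (m * n') (pre_lie E n (Suc m) (ext g2) (D m g1) (inV vs)) = DD m n g1 g2 (inV vs)"
    by (simp add: DD_def s(2) alt_def)
  finally have b: "balavoine E m (n - 1) ?P ?Q (inV vs) = DD m n g1 g2 (inV vs)" using s by simp
  have c: "DD m n g1 g2 (inV vs) \<in> carrier E"
    unfolding DD_def by (intro E.minus_closed E.alt_closed DD_terms_closed[OF g1 g2 zs])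
  have "derived_bracket G R m n g1 g2 vs = fst (alt E (m - 1) (DD m n g1 g2 (inV vs)))"
    using vs b c by (simp add: derived_bracket_def Let_def E.add_pow_alt)
  also have "\<dots> = alt G (m - 1) (alt G (Suc m) (B n m g2 g1 vs))"
    using c fst_DD[OF g1 g2 vs] mn by (simp add: alt_E)
  also have "\<dots> = B n m g2 g1 vs"
    using rec_bracket_closed[OF g2 g1, of vs] vs s by (simp add: add.commute G.M.alt_alt) (simp add: alt_def)
  finally show ?thesis .
qed

subsection \<open>The graded Lie algebra of an antisymmetric representation\<close>

abbreviation "H n \<equiv> hom_space K n V G"

lemma carrier_hom_space: "f \<in> carrier (H n) \<longleftrightarrow> mlin n f \<and> f \<in> extensional (tuples n V)"
  by (simp add: hom_space_def multilinear_maps_iff)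

lemma restrict_in_hom_space: "mlin n f \<Longrightarrow> restrict f (tuples n V) \<in> carrier (H n)"
  unfolding carrier_hom_space by (auto intro: mlin_cong)

lemma hom_space_eqI:
  "f \<in> carrier (H n) \<Longrightarrow> g \<in> carrier (H n) \<Longrightarrow> (\<And>xs. xs \<in> tuples n V \<Longrightarrow> f xs = g xs) \<Longrightarrow> f = g"
  unfolding carrier_hom_space by (auto intro: extensionalityI)

lemma mlin_smult: "mlin n f \<Longrightarrow> a \<in> carrier K \<Longrightarrow> mlin n (\<lambda>xs. a \<odot>\<^sub>G f xs)"
  by (rule mlin_cong[OF mlin_lincomb[of n f f a "\<zero>\<^bsub>K\<^esub>"]]) (auto simp: multilinear_closed)

lemma mlin_add: "mlin n f \<Longrightarrow> mlin n g \<Longrightarrow> mlin n (\<lambda>xs. f xs \<oplus>\<^sub>G g xs)"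
  using mlin_add_alt[of n f g 0] by simp

lemma mlin_const_zero: "mlin n (\<lambda>xs. \<zero>\<^sub>G)"
  by (auto simp: multilinear_def module_hom_def)

lemma hom_space_sel:
  "\<zero>\<^bsub>H n\<^esub> = (\<lambda>xs \<in> tuples n V. \<zero>\<^sub>G)"
  "f \<oplus>\<^bsub>H n\<^esub> g = (\<lambda>xs \<in> tuples n V. f xs \<oplus>\<^sub>G g xs)"
  "c \<odot>\<^bsub>H n\<^esub> f = (\<lambda>xs \<in> tuples n V. c \<odot>\<^sub>G f xs)"
  by (simp_all add: hom_space_def)

lemma hom_space_closed:
  "\<zero>\<^bsub>H n\<^esub> \<in> carrier (H n)"
  "f \<in> carrier (H n) \<Longrightarrow> g \<in> carrier (H n) \<Longrightarrow> f \<oplus>\<^bsub>H n\<^esub> g \<in> carrier (H n)"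
  "c \<in> carrier K \<Longrightarrow> f \<in> carrier (H n) \<Longrightarrow> c \<odot>\<^bsub>H n\<^esub> f \<in> carrier (H n)"
  unfolding hom_space_sel
  by (rule restrict_in_hom_space, simp add: carrier_hom_space mlin_const_zero mlin_add mlin_smult)+

lemma hom_space_value: "f \<in> carrier (H n) \<Longrightarrow> xs \<in> tuples n V \<Longrightarrow> f xs \<in> carrier G"
  using multilinear_closed[of K n V G f xs] by (simp add: carrier_hom_space)

lemma module_hom_space: "module K (H n)"
proof (rule moduleI)
  show "cring K" by (rule G.R.is_cring)
  show "abelian_group (H n)"
  proof (rule abelian_groupI)
    fix f assume f: "f \<in> carrier (H n)"
    have "(\<lambda>xs \<in> tuples n V. \<ominus>\<^sub>G f xs) \<in> carrier (H n)"
      using f by (intro restrict_in_hom_space mlin_neg) (simp add: carrier_hom_space)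
    moreover from this have "(\<lambda>xs \<in> tuples n V. \<ominus>\<^sub>G f xs) \<oplus>\<^bsub>H n\<^esub> f = \<zero>\<^bsub>H n\<^esub>"
      by (intro hom_space_eqI[where n = n] hom_space_closed f) (simp_all add: hom_space_sel hom_space_value[OF f] G.M.l_neg)
    ultimately show "\<exists>g \<in> carrier (H n). g \<oplus>\<^bsub>H n\<^esub> f = \<zero>\<^bsub>H n\<^esub>" by blast
  next
    fix f g h assume "f \<in> carrier (H n)" "g \<in> carrier (H n)" "h \<in> carrier (H n)"
    then show "f \<oplus>\<^bsub>H n\<^esub> g \<oplus>\<^bsub>H n\<^esub> h = f \<oplus>\<^bsub>H n\<^esub> (g \<oplus>\<^bsub>H n\<^esub> h)"
      by (intro hom_space_eqI[where n = n] hom_space_closed) (simp_all add: hom_space_sel hom_space_value G.M.a_assoc)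
  next
    fix f g assume "f \<in> carrier (H n)" "g \<in> carrier (H n)"
    then show "f \<oplus>\<^bsub>H n\<^esub> g = g \<oplus>\<^bsub>H n\<^esub> f"
      by (intro hom_space_eqI[where n = n] hom_space_closed) (simp_all add: hom_space_sel hom_space_value G.M.a_comm)
  next
    fix f assume "f \<in> carrier (H n)"
    then show "\<zero>\<^bsub>H n\<^esub> \<oplus>\<^bsub>H n\<^esub> f = f"
      by (intro hom_space_eqI[where n = n] hom_space_closed) (simp_all add: hom_space_sel hom_space_value)
  qed (intro hom_space_closed; assumption)+
next
  fix f g a b assume "f \<in> carrier (H n)" "g \<in> carrier (H n)" "a \<in> carrier K" "b \<in> carrier K"
  then show "a \<odot>\<^bsub>H n\<^esub> (f \<oplus>\<^bsub>H n\<^esub> g) = a \<odot>\<^bsub>H n\<^esub> f \<oplus>\<^bsub>H n\<^esub> a \<odot>\<^bsub>H n\<^esub> g"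
    by (intro hom_space_eqI[where n = n] hom_space_closed) (simp_all add: hom_space_sel hom_space_value G.smult_r_distr)
next
  fix f a b assume "f \<in> carrier (H n)" "a \<in> carrier K" "b \<in> carrier K"
  then show "(a \<oplus>\<^bsub>K\<^esub> b) \<odot>\<^bsub>H n\<^esub> f = a \<odot>\<^bsub>H n\<^esub> f \<oplus>\<^bsub>H n\<^esub> b \<odot>\<^bsub>H n\<^esub> f"
    "(a \<otimes>\<^bsub>K\<^esub> b) \<odot>\<^bsub>H n\<^esub> f = a \<odot>\<^bsub>H n\<^esub> (b \<odot>\<^bsub>H n\<^esub> f)"
    by (intro hom_space_eqI[where n = n] hom_space_closed G.R.a_closed G.R.m_closed; 
        simp add: hom_space_sel hom_space_value G.smult_l_distr G.smult_assoc1)+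
next
  fix f assume "f \<in> carrier (H n)"
  then show "\<one>\<^bsub>K\<^esub> \<odot>\<^bsub>H n\<^esub> f = f"
    by (intro hom_space_eqI[where n = n] hom_space_closed) (simp_all add: hom_space_sel hom_space_value)
qed (intro hom_space_closed; assumption)

lemma minus_hom_space:
  assumes f: "f \<in> carrier (H n)" shows "\<ominus>\<^bsub>H n\<^esub> f = (\<lambda>xs \<in> tuples n V. \<ominus>\<^sub>G f xs)"
proof -
  interpret H: module K "H n" by (rule module_hom_space)
  have "(\<lambda>xs \<in> tuples n V. \<ominus>\<^sub>G f xs) \<in> carrier (H n)"
    using f by (intro restrict_in_hom_space mlin_neg) (simp add: carrier_hom_space)
  moreover from this have "(\<lambda>xs \<in> tuples n V. \<ominus>\<^sub>G f xs) \<oplus>\<^bsub>H n\<^esub> f = \<zero>\<^bsub>H n\<^esub>"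
    by (intro hom_space_eqI[where n = n] hom_space_closed f) (simp_all add: hom_space_sel hom_space_value[OF f] G.M.l_neg)
  ultimately show ?thesis using f by (intro H.M.minus_equality)
qed

lemma add_pow_hom_space:
  assumes f: "f \<in> carrier (H n)"
  shows "[((- 1) ^ k :: int)] \<cdot>\<^bsub>H n\<^esub> f = (\<lambda>xs \<in> tuples n V. alt G k (f xs))"
proof -
  interpret H: module K "H n" by (rule module_hom_space)
  have "f = (\<lambda>xs \<in> tuples n V. f xs)" using f by (auto simp: carrier_hom_space extensional_def)
  then show ?thesis using f minus_hom_space[OF f] by (simp add: H.M.add_pow_alt) (simp add: alt_def)
qed

lemma derived_bracket_eq:
  assumes "f \<in> carrier (H m)" "g \<in> carrier (H n)" "m \<ge> 1" "n \<ge> 1"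
  shows "derived_bracket G R m n f g = (\<lambda>xs \<in> tuples (m + n) V. B n m g f xs)"
proof
  fix xs
  show "derived_bracket G R m n f g xs = (\<lambda>xs \<in> tuples (m + n) V. B n m g f xs) xs"
  proof (cases "xs \<in> tuples (m + n) V")
    case True
    then show ?thesis using assms by (simp add: derived_bracket_eq_rec_bracket carrier_hom_space)
  qed (simp add: derived_bracket_def Let_def)
qed

lemma derived_bracket_closed:
  assumes "f \<in> carrier (H m)" "g \<in> carrier (H n)" "m \<ge> 1" "n \<ge> 1"
  shows "derived_bracket G R m n f g \<in> carrier (H (m + n))"
  unfolding derived_bracket_eq[OF assms]
  using assms mlin_rec_bracket[of n g m f] by (intro restrict_in_hom_space) (simp add: carrier_hom_space add.commute)

text \<open>Linearity with trivial sign. It is required since restricted maps, such as the values of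
  \<open>derived_bracket\<close>, agree with the recursive expressions on tuples only.\<close>

lemma rec_bracket_cong_left:
  "mlin m g \<Longrightarrow> mlin n f \<Longrightarrow> xs \<in> tuples (m + n) V \<Longrightarrow> (\<And>ys. ys \<in> tuples m V \<Longrightarrow> h ys = g ys) \<Longrightarrow>
    B m n h f xs = B m n g f xs"
  using rec_bracket_alt_left[of m g h n f xs 0] mlin_cong[of m g h] by simp

lemma rec_bracket_cong_right:
  "mlin m g \<Longrightarrow> mlin n f \<Longrightarrow> xs \<in> tuples (m + n) V \<Longrightarrow> (\<And>ys. ys \<in> tuples n V \<Longrightarrow> h ys = f ys) \<Longrightarrow>
    B m n g h xs = B m n g f xs"
  using rec_bracket_alt_right[of m g n f h xs 0] mlin_cong[of n f h] by simp

lemma derived_bracket_hom_right: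
  assumes f: "f \<in> carrier (H m)" and mn: "m \<ge> 1" "n \<ge> 1"
  shows "(\<lambda>g. derived_bracket G R m n f g) \<in> module_hom K (H n) (H (m + n))"
proof (rule module_homI[OF module_hom_space module_hom_space derived_bracket_closed[OF f _ mn]])
  fix a b g h assume a: "a \<in> carrier K" "b \<in> carrier K" and g: "g \<in> carrier (H n)" "h \<in> carrier (H n)"
  let ?l = "a \<odot>\<^bsub>H n\<^esub> g \<oplus>\<^bsub>H n\<^esub> b \<odot>\<^bsub>H n\<^esub> h"
  have l: "?l \<in> carrier (H n)" using a g by (intro hom_space_closed)
  note c = derived_bracket_closed[OF f l mn] derived_bracket_closed[OF f g(1) mn] derived_bracket_closed[OF f g(2) mn]
  show "derived_bracket G R m n f ?l = a \<odot>\<^bsub>H (m + n)\<^esub> derived_bracket G R m n f g \<oplus>\<^bsub>H (m + n)\<^esub>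
      b \<odot>\<^bsub>H (m + n)\<^esub> derived_bracket G R m n f h"
  proof (rule hom_space_eqI[OF c(1)])
    fix xs assume xs: "xs \<in> tuples (m + n) V"
    have "B n m ?l f xs = a \<odot>\<^sub>G B n m g f xs \<oplus>\<^sub>G b \<odot>\<^sub>G B n m h f xs"
      by (rule rec_bracket_lin_left)
        (use a f g l xs in \<open>auto simp: carrier_hom_space add.commute, auto simp: hom_space_sel\<close>)
    then show "derived_bracket G R m n f ?l xs = (a \<odot>\<^bsub>H (m + n)\<^esub> derived_bracket G R m n f g \<oplus>\<^bsub>H (m + n)\<^esub>
      b \<odot>\<^bsub>H (m + n)\<^esub> derived_bracket G R m n f h) xs"
      using xs by (simp add: hom_space_sel(2,3)[of "m + n"] derived_bracket_eq[OF f l mn]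
          derived_bracket_eq[OF f g(1) mn] derived_bracket_eq[OF f g(2) mn])
  qed (use a c in \<open>intro hom_space_closed\<close>)
qed

lemma derived_bracket_hom_left:
  assumes f: "f \<in> carrier (H n)" and mn: "m \<ge> 1" "n \<ge> 1"
  shows "(\<lambda>g. derived_bracket G R m n g f) \<in> module_hom K (H m) (H (m + n))"
proof (rule module_homI[OF module_hom_space module_hom_space derived_bracket_closed[OF _ f mn]])
  fix a b g h assume a: "a \<in> carrier K" "b \<in> carrier K" and g: "g \<in> carrier (H m)" "h \<in> carrier (H m)"
  let ?l = "a \<odot>\<^bsub>H m\<^esub> g \<oplus>\<^bsub>H m\<^esub> b \<odot>\<^bsub>H m\<^esub> h"
  have l: "?l \<in> carrier (H m)" using a g by (intro hom_space_closed)
  note c = derived_bracket_closed[OF l f mn] derived_bracket_closed[OF g(1) f mn] derived_bracket_closed[OF g(2) f mn]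
  show "derived_bracket G R m n ?l f = a \<odot>\<^bsub>H (m + n)\<^esub> derived_bracket G R m n g f \<oplus>\<^bsub>H (m + n)\<^esub>
      b \<odot>\<^bsub>H (m + n)\<^esub> derived_bracket G R m n h f"
  proof (rule hom_space_eqI[OF c(1)])
    fix xs assume xs: "xs \<in> tuples (m + n) V"
    have "B n m f ?l xs = a \<odot>\<^sub>G B n m f g xs \<oplus>\<^sub>G b \<odot>\<^sub>G B n m f h xs"
      by (rule rec_bracket_lin_right)
        (use a f g l xs in \<open>auto simp: carrier_hom_space add.commute, auto simp: hom_space_sel\<close>)
    then show "derived_bracket G R m n ?l f xs = (a \<odot>\<^bsub>H (m + n)\<^esub> derived_bracket G R m n g f \<oplus>\<^bsub>H (m + n)\<^esub>
      b \<odot>\<^bsub>H (m + n)\<^esub> derived_bracket G R m n h f) xs"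
      using xs by (simp add: hom_space_sel(2,3)[of "m + n"] derived_bracket_eq[OF l f mn]
          derived_bracket_eq[OF g(1) f mn] derived_bracket_eq[OF g(2) f mn])
  qed (use a c in \<open>intro hom_space_closed\<close>)
qed

lemma derived_bracket_antisym:
  assumes f: "f \<in> carrier (H m)" and g: "g \<in> carrier (H n)" and mn: "m \<ge> 1" "n \<ge> 1"
  shows "derived_bracket G R m n f g = \<ominus>\<^bsub>H (m + n)\<^esub>
    ([((- 1) ^ (m * n) :: int)] \<cdot>\<^bsub>H (m + n)\<^esub> derived_bracket G R n m g f)"
proof -
  interpret H: module K "H (m + n)" by (rule module_hom_space)
  have c: "derived_bracket G R n m g f \<in> carrier (H (m + n))"
    using derived_bracket_closed[OF g f mn(2,1)] by (simp add: add.commute)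
  have p: "[((- 1) ^ (m * n) :: int)] \<cdot>\<^bsub>H (m + n)\<^esub> derived_bracket G R n m g f \<in> carrier (H (m + n))"
    by (rule H.M.add.int_pow_closed[OF c])
  show ?thesis
  proof (rule hom_space_eqI[OF derived_bracket_closed[OF f g mn] H.M.a_inv_closed[OF p]])
    fix xs assume xs: "xs \<in> tuples (m + n) V"
    then have xs': "xs \<in> tuples (n + m) V" by (simp add: add.commute)
    have "B n m g f xs = \<ominus>\<^sub>G alt G (n * m) (B m n f g xs)"
      using f g mn xs' by (intro rec_bracket_antisym) (simp_all add: carrier_hom_space)
    then show "derived_bracket G R m n f g xs = (\<ominus>\<^bsub>H (m + n)\<^esub>
        ([((- 1) ^ (m * n) :: int)] \<cdot>\<^bsub>H (m + n)\<^esub> derived_bracket G R n m g f)) xs"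
      unfolding minus_hom_space[OF p] unfolding add_pow_hom_space[OF c] using xs xs'
      by (simp add: derived_bracket_eq[OF f g mn] derived_bracket_eq[OF g f mn(2,1)] mult.commute)
  qed
qed

text \<open>Reversing the entries turns this into \<open>rec_bracket_jacobi\<close> for z, y, x. Its
  last term has the inner bracket in the wrong slot, which one use of antisymmetry corrects.\<close>

lemma derived_bracket_jacobi:
  assumes x: "x \<in> carrier (H m)" and y: "y \<in> carrier (H n)" and z: "z \<in> carrier (H k)"
    and m: "m \<ge> 1" and n: "n \<ge> 1" and k: "k \<ge> 1"
  shows "derived_bracket G R m (n + k) x (derived_bracket G R n k y z) =
      derived_bracket G R (m + n) k (derived_bracket G R m n x y) z \<oplus>\<^bsub>H (m + n + k)\<^esub>
      [((- 1) ^ (m * n) :: int)] \<cdot>\<^bsub>H (m + n + k)\<^esub>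
        derived_bracket G R n (m + k) y (derived_bracket G R m k x z)" (is "?l = ?p \<oplus>\<^bsub>_\<^esub> ?q")
proof -
  interpret H: module K "H (m + n + k)" by (rule module_hom_space)
  note yz = derived_bracket_closed[OF y z n k] and xy = derived_bracket_closed[OF x y m n]
    and xz = derived_bracket_closed[OF x z m k]
  have s: "n + k \<ge> 1" "m + n \<ge> 1" "m + k \<ge> 1" using m n by auto
  have l: "?l \<in> carrier (H (m + n + k))"
    using derived_bracket_closed[OF x yz m s(1)] by (simp add: add_ac)
  have p: "?p \<in> carrier (H (m + n + k))" by (rule derived_bracket_closed[OF xy z s(2) k])
  have q0: "derived_bracket G R n (m + k) y (derived_bracket G R m k x z) \<in> carrier (H (m + n + k))"
    using derived_bracket_closed[OF y xz n s(3)] by (simp add: add_ac)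
  have q: "?q \<in> carrier (H (m + n + k))" by (rule H.M.add.int_pow_closed[OF q0])
  have mx: "mlin m x" and my: "mlin n y" and mz: "mlin k z" using x y z by (simp_all add: carrier_hom_space)
  show ?thesis
  proof (rule hom_space_eqI[OF l H.M.a_closed[OF p q]])
    fix xs assume xs: "xs \<in> tuples (m + n + k) V"
    have t: "xs \<in> tuples (m + (n + k)) V" "xs \<in> tuples ((k + n) + m) V" "xs \<in> tuples (k + (n + m)) V" 
      "xs \<in> tuples (n + (k + m)) V" "xs \<in> tuples (n + (m + k)) V"
      using xs by (simp_all add: add_ac)
    have "?l xs = B (n + k) m (derived_bracket G R n k y z) x xs"
      using t by (simp add: derived_bracket_eq[OF x yz m s(1)])
    also have "\<dots> = B (k + n) m (B k n z y) x xs"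
      unfolding add.commute[of n k]
      by (rule rec_bracket_cong_left[OF mlin_rec_bracket[OF mz my] mx t(2)])
        (simp add: derived_bracket_eq[OF y z n k] add.commute)
    finally have L: "?l xs = B (k + n) m (B k n z y) x xs" .
    have "?p xs = B k (m + n) z (derived_bracket G R m n x y) xs"
      using xs by (simp add: derived_bracket_eq[OF xy z s(2) k])
    also have "\<dots> = B k (n + m) z (B n m y x) xs"
      unfolding add.commute[of m n]
      by (rule rec_bracket_cong_right[OF mz mlin_rec_bracket[OF my mx] t(3)])
        (simp add: derived_bracket_eq[OF x y m n] add.commute)
    finally have P: "?p xs = B k (n + m) z (B n m y x) xs" .
    have "derived_bracket G R n (m + k) y (derived_bracket G R m k x z) xs =
        B (m + k) n (derived_bracket G R m k x z) y xs"
      using t by (simp add: derived_bracket_eq[OF y xz n s(3)])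
    also have "\<dots> = B (k + m) n (B k m z x) y xs"
      unfolding add.commute[of m k] using t(4)
      by (intro rec_bracket_cong_left[OF mlin_rec_bracket[OF mz mx] my])
        (simp_all add: derived_bracket_eq[OF x z m k] add_ac)
    finally have Q: "derived_bracket G R n (m + k) y (derived_bracket G R m k x z) xs = B (k + m) n (B k m z x) y xs" .
    note zx = mlin_rec_bracket[OF mz mx]
    have J: "B k (n + m) z (B n m y x) xs = B (k + n) m (B k n z y) x xs \<oplus>\<^sub>G
        alt G (k * n) (B n (k + m) y (B k m z x) xs)"
      by (rule rec_bracket_jacobi[OF mz my mx t(2)])
    have A: "B n (k + m) y (B k m z x) xs = \<ominus>\<^sub>G alt G (n * (k + m)) (B (k + m) n (B k m z x) y xs)"
      by (rule rec_bracket_antisym[OF my zx t(4)]) (use n in simp)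
    have c: "B (k + n) m (B k n z y) x xs \<in> carrier G" "B (k + m) n (B k m z x) y xs \<in> carrier G"
      using rec_bracket_closed[OF mlin_rec_bracket[OF mz my] mx t(2)] rec_bracket_closed[OF zx my] t(4)
      by (simp_all add: add_ac)
    \<comment> \<open>kn + n(k + m) and mn have the same parity, so the two copies of
      \<open>v\<close> cancel.\<close>
    have "u = (u \<oplus>\<^sub>G alt G (k * n) (\<ominus>\<^sub>G alt G (n * (k + m)) v)) \<oplus>\<^sub>G alt G (m * n) v"
      if "u \<in> carrier G" "v \<in> carrier G" for u v
      using that by (cases "even m"; cases "even n"; cases "even k")
        (simp_all add: alt_def G.M.a_assoc G.M.l_neg G.M.r_neg)
    from this[OF c] show "?l xs = (?p \<oplus>\<^bsub>H (m + n + k)\<^esub> ?q) xs"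
      unfolding L hom_space_sel(2)[of "m + n + k"] add_pow_hom_space[OF q0] restrict_apply'[OF xs] P Q J A .
  qed
qed

theorem graded_lie_algebra_controlling:
  assumes "field K"
  shows "graded_lie_algebra K (controlling_gla K G R)"
  unfolding graded_lie_algebra_def controlling_gla_def graded_algebra.simps
proof (intro conjI allI impI ballI)
  show "vectorspace K (H n)" for n
    using assms module_hom_space by (simp add: vectorspace_def)
  show "bilinear_on K (H m) (H n) (H (m + n)) (derived_bracket G R m n)" if "1 \<le> m" "1 \<le> n" for m n
    unfolding bilinear_on_def using that derived_bracket_hom_left derived_bracket_hom_right by blast
qed (rule derived_bracket_antisym derived_bracket_jacobi; assumption)+

end

section \<open>Pulling multilinear maps back along homomorphisms\<close>

locale antisym_rep_hom = A: antisym_rep K G R + A': antisym_rep K G' R'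
  for K :: "('k, 'c) ring_scheme" and G :: "('k, 'g) leibniz" and R :: "('k, 'g, 'v) representation"
    and G' :: "('k, 'h) leibniz" and R' :: "('k, 'h, 'w) representation" +
  fixes h :: "'g \<Rightarrow> 'h" and \<phi> :: "'w \<Rightarrow> 'v"
  assumes h_hom: "h \<in> module_hom K G G'"
    and h_bracket: "\<And>x y. x \<in> carrier G \<Longrightarrow> y \<in> carrier G \<Longrightarrow> h (bracket G x y) = bracket G' (h x) (h y)"
    and \<phi>_hom: "\<phi> \<in> module_hom K (space R') (space R)"
    and \<phi>_rhoL: "\<And>x w. x \<in> carrier G \<Longrightarrow> w \<in> carrier (space R') \<Longrightarrow> \<phi> (rhoL R' (h x) w) = rhoL R x (\<phi> w)"
begin

lemma h_closed [simp]: "x \<in> carrier G \<Longrightarrow> h x \<in> carrier G'"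
  using h_hom by (auto simp: module_hom_def)

lemma h_neg [simp]: "x \<in> carrier G \<Longrightarrow> h (\<ominus>\<^bsub>G\<^esub> x) = \<ominus>\<^bsub>G'\<^esub> h x"
proof -
  interpret mod_hom K G G' h by unfold_locales (rule h_hom)
  show "x \<in> carrier G \<Longrightarrow> ?thesis" by simp
qed

lemma h_add [simp]: "x \<in> carrier G \<Longrightarrow> y \<in> carrier G \<Longrightarrow> h (x \<oplus>\<^bsub>G\<^esub> y) = h x \<oplus>\<^bsub>G'\<^esub> h y"
  by (rule module_hom_add[OF h_hom])

lemma h_smult [simp]: "c \<in> carrier K \<Longrightarrow> x \<in> carrier G \<Longrightarrow> h (c \<odot>\<^bsub>G\<^esub> x) = c \<odot>\<^bsub>G'\<^esub> h x"
  by (rule module_hom_smult[OF h_hom])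

lemma h_diff: "x \<in> carrier G \<Longrightarrow> y \<in> carrier G \<Longrightarrow> h (x \<ominus>\<^bsub>G\<^esub> y) = h x \<ominus>\<^bsub>G'\<^esub> h y"
  by (simp add: a_minus_def)

lemma h_alt: "x \<in> carrier G \<Longrightarrow> h (alt G k x) = alt G' k (h x)"
  by (simp add: alt_def)

lemma \<phi>_closed [simp]: "w \<in> carrier (space R') \<Longrightarrow> \<phi> w \<in> carrier (space R)"
  using \<phi>_hom by (auto simp: module_hom_def)

lemma map_\<phi>_in_tuples [simp]: "ws \<in> tuples n (space R') \<Longrightarrow> map \<phi> ws \<in> tuples n (space R)"
  by (auto simp: tuples_def)

text \<open>Maps from V^n to G are contravariant in V and covariant in G, hence the opposite
  directions of \<open>\<phi>\<close> and \<open>h\<close>. With \<open>h\<close> the identity this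
  is the action of the functor on arrows; with \<open>\<phi>\<close> the identity it is \<alpha> or
  \<beta>.\<close>

definition pull :: "('v list \<Rightarrow> 'g) \<Rightarrow> 'w list \<Rightarrow> 'h" where
  "pull f ws = h (f (map \<phi> ws))"

lemma pull_Cons: "pull f (w # ws) = pull (\<lambda>ys. f (\<phi> w # ys)) ws"
  by (simp add: pull_def)

lemma mlin_pull: "A.mlin n f \<Longrightarrow> A'.mlin n (pull f)"
proof (induction n arbitrary: f)
  case 0
  then show ?case by (simp add: pull_def)
next
  case (Suc n)
  show ?case unfolding multilinear_Suc
  proof (intro conjI ballI)
    fix w assume "w \<in> carrier (space R')"
    then show "A'.mlin n (\<lambda>ws. pull f (w # ws))"
      unfolding pull_Cons using Suc.IH[OF multilinear_Cons[OF Suc.prems]] by simp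
  next
    fix ws assume ws: "ws \<in> tuples n (space R')"
    have f: "f (v # map \<phi> ws) \<in> carrier G" if "v \<in> carrier (space R)" for v
      using multilinear_closed[OF Suc.prems] that ws by simp
    note hd = multilinear_hd[OF Suc.prems map_\<phi>_in_tuples[OF ws]]
    show "(\<lambda>w. pull f (w # ws)) \<in> module_hom K (space R') G'"
      unfolding pull_def
      by (auto simp: module_hom_def f module_hom_add[OF \<phi>_hom] module_hom_smult[OF \<phi>_hom]
          module_hom_add[OF hd] module_hom_smult[OF hd])
  qed
qed

text \<open>Without arguments this says that \<open>h\<close> preserves brackets; in the step,
  \<open>\<phi>_rhoL\<close> lets the action of \<open>h c\<close> on the first vector pass through
  \<open>\<phi>\<close>.\<close>

lemma act_pull:
  "A.mlin n f \<Longrightarrow> c \<in> carrier G \<Longrightarrow> ws \<in> tuples n (space R') \<Longrightarrow>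
    A'.act n (h c) (pull f) ws = h (A.act n c f (map \<phi> ws))"
proof (induction n arbitrary: f ws)
  case 0
  then show ?case by (simp add: pull_def h_bracket)
next
  case (Suc n)
  obtain w ws' where ws: "ws = w # ws'" "w \<in> carrier (space R')" "ws' \<in> tuples n (space R')"
    using Suc.prems(3) by (rule tuples_SucE)
  have f': "A.mlin n (\<lambda>ys. f (\<phi> w # ys))" using multilinear_Cons[OF Suc.prems(1)] ws by simp
  have "f (rhoL R c (\<phi> w) # map \<phi> ws') \<in> carrier G"
    using multilinear_closed[OF Suc.prems(1)] Suc.prems(2) ws by simp
  moreover have "A'.act n (h c) (\<lambda>ys. pull f (w # ys)) ws' = h (A.act n c (\<lambda>ys. f (\<phi> w # ys)) (map \<phi> ws'))"
    unfolding pull_Cons using Suc.IH[OF f' Suc.prems(2) ws(3)] by simp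
  moreover have "A.act n c (\<lambda>ys. f (\<phi> w # ys)) (map \<phi> ws') \<in> carrier G"
    by (rule A.act_closed[OF f' Suc.prems(2) map_\<phi>_in_tuples[OF ws(3)]])
  ultimately show ?case using Suc.prems(2) ws by (simp add: h_diff) (simp add: pull_def \<phi>_rhoL)
qed

lemma rec_bracket_pull:
  "A.mlin m g \<Longrightarrow> A.mlin n f \<Longrightarrow> ws \<in> tuples (m + n) (space R') \<Longrightarrow>
    A'.B m n (pull g) (pull f) ws = h (A.B m n g f (map \<phi> ws))"
proof (induction "m + n" arbitrary: m n g f ws rule: less_induct)
  case less
  note g = less.prems(1) and f = less.prems(2) and ws = less.prems(3)
  show ?case
  proof (cases rule: nat_pair_cases[where m = m and n = n])
    case 1
    then show ?thesis using act_pull[OF f, of "g []" ws] g ws by (simp add: pull_def[of g])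
  next
    case (2 m')
    then show ?thesis using act_pull[OF g, of "f []" ws] A.act_closed[OF g, of "f []" "map \<phi> ws"] f ws
      by (simp add: pull_def[of f] del: diag_act.simps)
  next
    case (s m' n')
    obtain w ws' where w: "ws = w # ws'" "w \<in> carrier (space R')" "ws' \<in> tuples (m' + n) (space R')"
      using ws s by (auto elim: tuples_SucE)
    have t: "ws' \<in> tuples (m + n') (space R')" using w s by simp
    have g': "A.mlin m' (\<lambda>ys. g (\<phi> w # ys))" and f': "A.mlin n' (\<lambda>ys. f (\<phi> w # ys))"
      using multilinear_Cons[OF g[unfolded s]] multilinear_Cons[OF f[unfolded s]] w by simp_all
    have "A'.B m' n (\<lambda>ys. pull g (w # ys)) (pull f) ws' = h (A.B m' n (\<lambda>ys. g (\<phi> w # ys)) f (map \<phi> ws'))"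
      using less.hyps[OF _ g' f w(3)] s by (simp add: pull_Cons)
    moreover have "A'.B m n' (pull g) (\<lambda>ys. pull f (w # ys)) ws' = h (A.B m n' g (\<lambda>ys. f (\<phi> w # ys)) (map \<phi> ws'))"
      using less.hyps[OF _ g f' t] s by (simp add: pull_Cons)
    ultimately show ?thesis unfolding w(1) list.map rec_bracket_Cons[OF s]
      using A.rec_bracket_closed[OF g' f map_\<phi>_in_tuples[OF w(3)]]
        A.rec_bracket_closed[OF g f' map_\<phi>_in_tuples[OF t]]
      by (simp add: h_alt)
  qed
qed

theorem gla_hom_pull:
  "(\<lambda>n f. \<lambda>ws \<in> tuples n (space R'). h (f (map \<phi> ws))) \<in>
    gla_hom K (controlling_gla K G R) (controlling_gla K G' R')"
proof -
  let ?T = "\<lambda>n f. \<lambda>ws \<in> tuples n (space R'). h (f (map \<phi> ws))"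
  have T: "?T n f = restrict (pull f) (tuples n (space R'))" for n f
    by (simp add: pull_def fun_eq_iff restrict_def)
  have T_closed: "?T n f \<in> carrier (A'.H n)" if "f \<in> carrier (A.H n)" for n f
    unfolding T using that by (intro A'.restrict_in_hom_space mlin_pull) (simp add: A.carrier_hom_space)
  have "?T n \<in> module_hom K (A.H n) (A'.H n)" for n
    using T_closed A.hom_space_value[of _ n] 
    by (auto simp: module_hom_def A.hom_space_sel A'.hom_space_sel fun_eq_iff)
  moreover have "?T (m + n) (derived_bracket G R m n f g) = derived_bracket G' R' m n (?T m f) (?T n g)"
    if mn: "m \<ge> 1" "n \<ge> 1" and f: "f \<in> carrier (A.H m)" and g: "g \<in> carrier (A.H n)" for m n f g
  proof (rule A'.hom_space_eqI[OF T_closed[OF A.derived_bracket_closed[OF f g mn]]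
        A'.derived_bracket_closed[OF T_closed[OF f] T_closed[OF g] mn]])
    fix ws assume ws: "ws \<in> tuples (m + n) (space R')"
    then have ws': "ws \<in> tuples (n + m) (space R')" by (simp add: add.commute)
    have f': "A.mlin m f" and g': "A.mlin n g" using f g by (simp_all add: A.carrier_hom_space)
    have "derived_bracket G' R' m n (?T m f) (?T n g) ws = A'.B n m (?T n g) (?T m f) ws"
      using ws by (simp only: A'.derived_bracket_eq[OF T_closed[OF f] T_closed[OF g] mn] restrict_apply if_True)
    \<comment> \<open>The restricted maps agree with \<open>pull\<close> on tuples only, so the
      entries are replaced by congruence, one at a time.\<close>
    also have "\<dots> = A'.B n m (pull g) (?T m f) ws"
      using T_closed[OF f] by (intro A'.rec_bracket_cong_left[OF mlin_pull[OF g'] _ ws'])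
        (simp_all add: A'.carrier_hom_space pull_def)
    also have "\<dots> = A'.B n m (pull g) (pull f) ws"
      by (intro A'.rec_bracket_cong_right[OF mlin_pull[OF g'] mlin_pull[OF f'] ws']) (simp add: pull_def)
    also have "\<dots> = h (A.B n m g f (map \<phi> ws))"
      by (rule rec_bracket_pull[OF g' f' ws'])
    finally show "?T (m + n) (derived_bracket G R m n f g) ws = derived_bracket G' R' m n (?T m f) (?T n g) ws"
      using ws by (simp add: A.derived_bracket_eq[OF f g mn])
  qed
  ultimately show ?thesis by (simp add: gla_hom_def controlling_gla_def)
qed

end

section \<open>The Leibniz kernel and the quotient by it\<close>

context module
begin

lemma submodule_minus: "LinearCombinations.submodule R N M \<Longrightarrow> x \<in> N \<Longrightarrow> \<ominus>\<^bsub>M\<^esub> x \<in> N"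
  using submodule.smult_closed[of R N M "\<ominus> \<one>" x] submodule.subset[of R N M]
  by (auto simp: smult_l_minus)

lemma submodule_diff: "LinearCombinations.submodule R N M \<Longrightarrow> x \<in> N \<Longrightarrow> y \<in> N \<Longrightarrow> x \<ominus>\<^bsub>M\<^esub> y \<in> N"
  unfolding a_minus_def by (intro submodule.m_closed[of R N M] submodule_minus)

text \<open>By Zorn's lemma there is a maximal submodule \<open>C\<close> that meets
  \<open>I\<close> trivially. A vector outside C + I could be adjoined to \<open>C\<close> without
  creating an intersection, because nonzero scalars are invertible.\<close>

lemma exists_complement:
  assumes K: "field R" and I: "LinearCombinations.submodule R I M"
  obtains C where "LinearCombinations.submodule R C M" "C \<inter> I = {\<zero>\<^bsub>M\<^esub>}"
    "\<And>x. x \<in> carrier M \<Longrightarrow> \<exists>c\<in>C. x \<ominus>\<^bsub>M\<^esub> c \<in> I"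
proof -
  interpret K: field R by fact
  let ?A = "{C. LinearCombinations.submodule R C M \<and> C \<inter> I = {\<zero>\<^bsub>M\<^esub>}}"
  have I0: "\<zero>\<^bsub>M\<^esub> \<in> I" by (rule submodule.zero_closed[OF I])
  have "LinearCombinations.submodule R {\<zero>\<^bsub>M\<^esub>} M"
    by unfold_locales auto
  then have ne: "?A \<noteq> {}" using I0 by auto
  have "\<Union>\<C> \<in> ?A" if C: "\<C> \<noteq> {}" "subset.chain ?A \<C>" for \<C>
  proof -
    have sub: "LinearCombinations.submodule R S M" and XI: "S \<inter> I = {\<zero>\<^bsub>M\<^esub>}" if "S \<in> \<C>" for S
      using that C(2) by (auto simp: subset.chain_def)
    have tot: "S \<subseteq> T \<or> T \<subseteq> S" if "S \<in> \<C>" "T \<in> \<C>" for S T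
      using that C(2) by (auto simp: subset.chain_def)
    have "LinearCombinations.submodule R (\<Union>\<C>) M"
    proof unfold_locales
      show "\<Union>\<C> \<subseteq> carrier M" using submodule.subset[OF sub] by blast
      show "\<zero>\<^bsub>M\<^esub> \<in> \<Union>\<C>" using C(1) submodule.zero_closed[OF sub] by blast
      show "c \<odot>\<^bsub>M\<^esub> v \<in> \<Union>\<C>" if "c \<in> carrier R" "v \<in> \<Union>\<C>" for c v
        using that submodule.smult_closed[OF sub] by blast
      show "v \<oplus>\<^bsub>M\<^esub> w \<in> \<Union>\<C>" if "v \<in> \<Union>\<C>" "w \<in> \<Union>\<C>" for v w
      proof -
        obtain S T where "S \<in> \<C>" "T \<in> \<C>" "v \<in> S" "w \<in> T" using \<open>v \<in> _\<close> \<open>w \<in> _\<close> by auto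
        then obtain Z where "Z \<in> \<C>" "v \<in> Z" "w \<in> Z" using tot by blast
        then show ?thesis using submodule.m_closed[OF sub] by blast
      qed
    qed
    moreover have "\<Union>\<C> \<inter> I = {\<zero>\<^bsub>M\<^esub>}" using XI C(1) by blast
    ultimately show ?thesis by simp
  qed
  then have "\<exists>C\<in>?A. \<forall>S\<in>?A. C \<subseteq> S \<longrightarrow> S = C" by (rule subset_Zorn_nonempty[OF ne])
  then obtain C where CA: "C \<in> ?A" and max': "\<forall>S\<in>?A. C \<subseteq> S \<longrightarrow> S = C" by (rule bexE)
  have C: "LinearCombinations.submodule R C M" "C \<inter> I = {\<zero>\<^bsub>M\<^esub>}" using CA by simp_all
  have max: "S = C" if "S \<in> ?A" "C \<subseteq> S" for S by (rule mp[OF bspec[OF max' that(1)] that(2)])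
  have Cc: "c \<in> carrier M" if "c \<in> C" for c using submodule.subset[OF C(1)] that by auto
  have Ic: "c \<in> carrier M" if "c \<in> I" for c using submodule.subset[OF I] that by auto
  have "\<exists>c\<in>C. x \<ominus>\<^bsub>M\<^esub> c \<in> I" if x: "x \<in> carrier M" for x
  proof (rule ccontr)
    assume n: "\<not> (\<exists>c\<in>C. x \<ominus>\<^bsub>M\<^esub> c \<in> I)"
    \<comment> \<open>The span of \<open>C\<close> and \<open>x\<close>, which is to contradict
      maximality.\<close>
    let ?D = "{c \<oplus>\<^bsub>M\<^esub> k \<odot>\<^bsub>M\<^esub> x | c k. c \<in> C \<and> k \<in> carrier R}"
    have DI: "LinearCombinations.submodule R ?D M"
    proof unfold_locales
      show "?D \<subseteq> carrier M" using x Cc by auto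
      have "\<zero>\<^bsub>M\<^esub> = \<zero>\<^bsub>M\<^esub> \<oplus>\<^bsub>M\<^esub> \<zero> \<odot>\<^bsub>M\<^esub> x" using x by simp
      then show "\<zero>\<^bsub>M\<^esub> \<in> ?D" using submodule.zero_closed[OF C(1)] by blast
    next
      fix v w assume "v \<in> ?D" "w \<in> ?D"
      then obtain c k d l where v: "v = c \<oplus>\<^bsub>M\<^esub> k \<odot>\<^bsub>M\<^esub> x" "w = d \<oplus>\<^bsub>M\<^esub> l \<odot>\<^bsub>M\<^esub> x" 
        "c \<in> C" "d \<in> C" "k \<in> carrier R" "l \<in> carrier R" by auto
      have "v \<oplus>\<^bsub>M\<^esub> w = (c \<oplus>\<^bsub>M\<^esub> d) \<oplus>\<^bsub>M\<^esub> (k \<oplus> l) \<odot>\<^bsub>M\<^esub> x"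
        unfolding v(1,2) using v(3-) x Cc by (simp add: smult_l_distr M.a_ac)
      then show "v \<oplus>\<^bsub>M\<^esub> w \<in> ?D" using submodule.m_closed[OF C(1) v(3,4)] v(5,6) by blast
    next
      fix a v assume a: "a \<in> carrier R" and "v \<in> ?D"
      then obtain c k where v: "v = c \<oplus>\<^bsub>M\<^esub> k \<odot>\<^bsub>M\<^esub> x" "c \<in> C" "k \<in> carrier R" by auto
      have "a \<odot>\<^bsub>M\<^esub> v = a \<odot>\<^bsub>M\<^esub> c \<oplus>\<^bsub>M\<^esub> (a \<otimes> k) \<odot>\<^bsub>M\<^esub> x"
        unfolding v(1) using v(2-) x a Cc by (simp add: smult_r_distr smult_assoc1)
      then show "a \<odot>\<^bsub>M\<^esub> v \<in> ?D" using submodule.smult_closed[OF C(1) a v(2)] v(3) a by blast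
    qed
    have "?D \<inter> I \<subseteq> {\<zero>\<^bsub>M\<^esub>}"
    proof
      fix i assume "i \<in> ?D \<inter> I"
      then obtain c k where i: "i = c \<oplus>\<^bsub>M\<^esub> k \<odot>\<^bsub>M\<^esub> x" "c \<in> C" "k \<in> carrier R" "i \<in> I" by auto
      \<comment> \<open>For invertible k, dividing i = c + kx by k makes x congruent modulo
        \<open>I\<close> to -(1/k) c, an element of \<open>C\<close>.\<close>
      have "k = \<zero>"
      proof (rule ccontr)
        assume k: "k \<noteq> \<zero>"
        then have u: "k \<in> Units R" using i(3) by (simp add: K.field_Units)
        let ?l = "inv\<^bsub>R\<^esub> k"
        have l: "?l \<in> carrier R" "?l \<otimes> k = \<one>" using u by auto
        let ?c = "\<ominus>\<^bsub>M\<^esub> (?l \<odot>\<^bsub>M\<^esub> c)"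
        have "?c \<in> C" by (intro submodule_minus[OF C(1)] submodule.smult_closed[OF C(1)] l i)
        moreover have "x \<ominus>\<^bsub>M\<^esub> ?c = ?l \<odot>\<^bsub>M\<^esub> i"
          unfolding i(1) using i(2,3) l x Cc
          by (simp add: a_minus_def smult_r_distr smult_assoc1[symmetric] M.a_comm)
        moreover have "?l \<odot>\<^bsub>M\<^esub> i \<in> I" by (rule submodule.smult_closed[OF I l(1) i(4)])
        ultimately show False using n by auto
      qed
      then have "i = c" using i(1,2) x Cc by simp
      then show "i \<in> {\<zero>\<^bsub>M\<^esub>}" using C(2) i by auto
    qed
    then have "?D \<in> ?A" using DI I0 submodule.zero_closed[OF DI] by blast
    moreover have "C \<subseteq> ?D"
    proof
      fix c assume c: "c \<in> C"
      then have "c = c \<oplus>\<^bsub>M\<^esub> \<zero> \<odot>\<^bsub>M\<^esub> x" using x Cc by simp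
      then show "c \<in> ?D" using c by blast
    qed
    ultimately have "?D = C" by (rule max)
    moreover have "x = \<zero>\<^bsub>M\<^esub> \<oplus>\<^bsub>M\<^esub> \<one> \<odot>\<^bsub>M\<^esub> x" using x by simp
    then have "x \<in> ?D" using submodule.zero_closed[OF C(1)] by blast
    ultimately have "x \<in> C" by simp
    moreover have "x \<ominus>\<^bsub>M\<^esub> x \<in> I" using I0 x by (simp add: a_minus_def M.r_neg)
    ultimately show False using n by auto
  qed
  with C show thesis by (rule that)
qed

end

context antisym_rep
begin

section \<open>The Leibniz kernel as an ideal that acts by zero\<close>

abbreviation "I \<equiv> leib_kernel K G"
abbreviation "pr \<equiv> lie_proj K G"
abbreviation "Q \<equiv> lie_quotient K G"

lemma br_add:
  assumes "x \<in> carrier G" "y \<in> carrier G" "z \<in> carrier G"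
  shows "br (x \<oplus>\<^sub>G y) z = br x z \<oplus>\<^sub>G br y z" "br z (x \<oplus>\<^sub>G y) = br z x \<oplus>\<^sub>G br z y"
  using module_hom_add[OF br_hom(1)] module_hom_add[OF br_hom(2)] assms by auto

lemma br_smult:
  assumes "x \<in> carrier G" "z \<in> carrier G" "c \<in> carrier K"
  shows "br (c \<odot>\<^sub>G x) z = c \<odot>\<^sub>G br x z" "br z (c \<odot>\<^sub>G x) = c \<odot>\<^sub>G br z x"
  using module_hom_smult[OF br_hom(1)] module_hom_smult[OF br_hom(2)] assms by auto

lemma rho_add:
  assumes "x \<in> carrier G" "y \<in> carrier G" "v \<in> carrier V"
  shows "\<rho> (x \<oplus>\<^sub>G y) v = \<rho> x v \<oplus>\<^sub>V \<rho> y v"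
  using module_hom_add[OF rho_hom(2)] assms by auto

lemma rho_smult:
  assumes "x \<in> carrier G" "v \<in> carrier V" "c \<in> carrier K"
  shows "\<rho> (c \<odot>\<^sub>G x) v = c \<odot>\<^sub>V \<rho> x v"
  using module_hom_smult[OF rho_hom(2)] assms by auto

lemma square_in_kernel: 
  assumes "x \<in> carrier G" shows "br x x \<in> I"
proof -
  have "{br x x |x. x \<in> carrier G} \<subseteq> I"
    unfolding leib_kernel_def by (rule G.in_own_span) auto
  then show ?thesis using assms by auto
qed

lemma kernel_submodule: "LinearCombinations.submodule K I G"
  unfolding leib_kernel_def by (rule G.span_is_submodule) auto

lemma kernel_carrier [simp]: "x \<in> I \<Longrightarrow> x \<in> carrier G"
  using submodule.subset[OF kernel_submodule] by auto

text \<open>The induction principle for the kernel: a property that defines a submodule is checked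
  on squares.\<close>

lemma kernel_subset:
  assumes "LinearCombinations.submodule K N G" "\<And>x. x \<in> carrier G \<Longrightarrow> br x x \<in> N"
  shows "I \<subseteq> N"
  unfolding leib_kernel_def by (rule G.span_is_subset) (use assms in auto)

lemmas kernel_closed = submodule.m_closed[OF kernel_submodule] submodule.zero_closed[OF kernel_submodule]
  submodule.smult_closed[OF kernel_submodule] G.submodule_minus[OF kernel_submodule] G.submodule_diff[OF kernel_submodule]

text \<open>In the Leibniz identity for x, x, y the term [x, [x, y]] stands on both sides.\<close>

lemma br_square_left:
  assumes "x \<in> carrier G" "y \<in> carrier G" shows "br (br x x) y = \<zero>\<^sub>G"
proof -
  have "br x (br x y) = br (br x x) y \<oplus>\<^sub>G br x (br x y)"
    using assms by (intro bracket_leibniz)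
  then show ?thesis using assms by (metis G.M.add.r_cancel_one' br_closed)
qed

lemma br_kernel_left:
  assumes i: "i \<in> I" and y: "y \<in> carrier G" shows "br i y = \<zero>\<^sub>G"
proof -
  have "LinearCombinations.submodule K {x \<in> carrier G. br x y = \<zero>\<^sub>G} G"
    by unfold_locales (use y in \<open>auto simp: br_add br_smult\<close>)
  from kernel_subset[OF this] show ?thesis using i y by (auto simp: br_square_left)
qed

text \<open>With a = [y, x], the Leibniz identity gives [y, [x, x]] = [a, x] + [x, a], which is the
  polarisation [a + x, a + x] - [a, a] - [x, x], a combination of squares.\<close>

lemma br_kernel_right:
  assumes i: "i \<in> I" and y: "y \<in> carrier G" shows "br y i \<in> I"
proof -
  have "LinearCombinations.submodule K {x \<in> carrier G. br y x \<in> I} G"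
    by unfold_locales (use y in \<open>auto simp: br_add br_smult intro!: kernel_closed\<close>)
  moreover have "br y (br x x) \<in> I" if x: "x \<in> carrier G" for x
  proof -
    let ?a = "br y x"
    have a: "?a \<in> carrier G" using x y by simp
    have "br y (br x x) = br ?a x \<oplus>\<^sub>G br x ?a"
      using x y by (intro bracket_leibniz)
    also have "\<dots> = (br (?a \<oplus>\<^sub>G x) (?a \<oplus>\<^sub>G x) \<ominus>\<^sub>G br ?a ?a) \<ominus>\<^sub>G br x x"
    proof -
      have "p \<oplus>\<^sub>G q = (((r \<oplus>\<^sub>G p) \<oplus>\<^sub>G (q \<oplus>\<^sub>G s)) \<ominus>\<^sub>G r) \<ominus>\<^sub>G s"
        if "p \<in> carrier G" "q \<in> carrier G" "r \<in> carrier G" "s \<in> carrier G" for p q r s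
      proof -
        have "(((r \<oplus>\<^sub>G p) \<oplus>\<^sub>G (q \<oplus>\<^sub>G s)) \<ominus>\<^sub>G r) \<ominus>\<^sub>G s =
            (p \<oplus>\<^sub>G q) \<oplus>\<^sub>G ((r \<oplus>\<^sub>G \<ominus>\<^sub>G r) \<oplus>\<^sub>G (s \<oplus>\<^sub>G \<ominus>\<^sub>G s))"
          using that by (simp add: a_minus_def G.M.a_ac del: G.M.r_neg G.M.l_neg G.M.r_neg1 G.M.r_neg2)
        then show ?thesis using that by (simp add: G.M.r_neg)
      qed
      note id = this
      have "br (?a \<oplus>\<^sub>G x) (?a \<oplus>\<^sub>G x) = (br ?a ?a \<oplus>\<^sub>G br ?a x) \<oplus>\<^sub>G (br x ?a \<oplus>\<^sub>G br x x)"
        using a x by (simp add: br_add G.M.a_ac)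
      then show ?thesis by (simp only:) (rule id; use a x in simp)
    qed
    also have "\<dots> \<in> I"
      using a x by (intro kernel_closed square_in_kernel G.M.a_closed)
    finally show ?thesis .
  qed
  ultimately show ?thesis using kernel_subset i y by blast
qed

text \<open>A square acts by the commutator of \<open>\<rho> x\<close> with itself, and the elements
  that annihilate \<open>v\<close> form a submodule.\<close>

lemma rho_kernel:
  assumes i: "i \<in> I" and v: "v \<in> carrier V" shows "\<rho> i v = \<zero>\<^sub>V"
proof -
  have "LinearCombinations.submodule K {x \<in> carrier G. \<rho> x v = \<zero>\<^sub>V} G"
    by unfold_locales (use v in \<open>auto simp: rho_add rho_smult\<close>)
  from kernel_subset[OF this] show ?thesis using i v by (auto simp: rhoL_bracket a_minus_def V.M.r_neg)
qed

section \<open>Cosets of the kernel and the induced operations\<close>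

lemma lie_proj_eq: "x \<in> carrier G \<Longrightarrow> pr x = {y \<in> carrier G. y \<ominus>\<^sub>G x \<in> I}"
proof safe
  fix y assume x: "x \<in> carrier G" and "y \<in> pr x"
  then obtain i where i: "i \<in> I" "y = i \<oplus>\<^sub>G x" by (auto simp: lie_proj_def a_r_coset_def')
  then show "y \<in> carrier G" "y \<ominus>\<^sub>G x \<in> I"
    using x by (auto simp: a_minus_def G.M.a_assoc G.M.r_neg)
next
  fix y assume "x \<in> carrier G" "y \<in> carrier G" "y \<ominus>\<^sub>G x \<in> I"
  moreover from this have "y = (y \<ominus>\<^sub>G x) \<oplus>\<^sub>G x" by (simp add: a_minus_def G.M.a_assoc G.M.l_neg)
  ultimately show "y \<in> pr x" by (auto simp: lie_proj_def a_r_coset_def')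
qed

lemma lie_proj_self: "x \<in> carrier G \<Longrightarrow> x \<in> pr x"
  by (simp add: lie_proj_eq a_minus_def G.M.r_neg kernel_closed)

lemma diff_swap: "x \<in> carrier G \<Longrightarrow> y \<in> carrier G \<Longrightarrow> x \<ominus>\<^sub>G y = \<ominus>\<^sub>G (y \<ominus>\<^sub>G x)"
  by (simp add: a_minus_def G.M.minus_add G.M.a_comm)

lemma diff_trans: "x \<in> carrier G \<Longrightarrow> y \<in> carrier G \<Longrightarrow> z \<in> carrier G \<Longrightarrow>
    x \<ominus>\<^sub>G z = (x \<ominus>\<^sub>G y) \<oplus>\<^sub>G (y \<ominus>\<^sub>G z)"
  by (simp add: a_minus_def G.M.a_assoc G.M.r_neg1 G.M.r_neg2)

lemma lie_proj_eq_iff: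
  assumes "x \<in> carrier G" "y \<in> carrier G" shows "pr x = pr y \<longleftrightarrow> x \<ominus>\<^sub>G y \<in> I"
proof
  assume "pr x = pr y"
  then show "x \<ominus>\<^sub>G y \<in> I" using lie_proj_self[OF assms(1)] assms(2) by (simp add: lie_proj_eq)
next
  assume xy: "x \<ominus>\<^sub>G y \<in> I"
  then have yx: "y \<ominus>\<^sub>G x \<in> I" using assms by (simp add: diff_swap[of y x] kernel_closed)
  have "pr a \<subseteq> pr b" if "a \<in> carrier G" "b \<in> carrier G" "a \<ominus>\<^sub>G b \<in> I" for a b
  proof
    fix z assume "z \<in> pr a"
    then have z: "z \<in> carrier G" "z \<ominus>\<^sub>G a \<in> I" using that by (simp_all add: lie_proj_eq)
    have "z \<ominus>\<^sub>G b = (z \<ominus>\<^sub>G a) \<oplus>\<^sub>G (a \<ominus>\<^sub>G b)" by (rule diff_trans[OF z(1) that(1,2)])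
    then show "z \<in> pr b" using z that kernel_closed(1)[OF z(2) that(3)] by (simp add: lie_proj_eq)
  qed
  then show "pr x = pr y" using assms xy yx by blast
qed

lemma lie_proj_kernel: 
  assumes i: "i \<in> I" shows "pr i = I"
proof -
  have "y \<in> I \<longleftrightarrow> y \<in> carrier G \<and> y \<ominus>\<^sub>G i \<in> I" for y
  proof
    assume y: "y \<in> carrier G \<and> y \<ominus>\<^sub>G i \<in> I"
    then have "(y \<ominus>\<^sub>G i) \<oplus>\<^sub>G i \<in> I" using i by (intro kernel_closed(1)) auto
    then show "y \<in> I" using y i by (simp add: a_minus_def G.M.a_assoc G.M.l_neg)
  qed (use i kernel_closed(5) in auto)
  then show ?thesis using lie_proj_eq[OF kernel_carrier[OF i]] by blast
qed

lemma carrier_Q: "carrier Q = pr ` carrier G"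
  by (auto simp: lie_quotient_def Let_def A_RCOSETS_def' lie_proj_def)

lemma zero_Q: "\<zero>\<^bsub>Q\<^esub> = pr \<zero>\<^sub>G"
  using lie_proj_kernel[OF kernel_closed(2)] by (simp add: lie_quotient_def Let_def)

lemma add_Q:
  assumes "x \<in> carrier G" "y \<in> carrier G" shows "pr x \<oplus>\<^bsub>Q\<^esub> pr y = pr (x \<oplus>\<^sub>G y)"
proof -
  have "pr x \<oplus>\<^bsub>Q\<^esub> pr y = (\<Union>h\<in>pr x. \<Union>k\<in>pr y. {h \<oplus>\<^sub>G k})"
    by (simp add: lie_quotient_def Let_def set_add_def')
  also have "\<dots> = pr (x \<oplus>\<^sub>G y)"
  proof (intro subset_antisym subsetI)
    fix z assume "z \<in> (\<Union>h\<in>pr x. \<Union>k\<in>pr y. {h \<oplus>\<^sub>G k})"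
    then obtain h k where h: "h \<in> carrier G" "h \<ominus>\<^sub>G x \<in> I" "k \<in> carrier G" "k \<ominus>\<^sub>G y \<in> I" "z = h \<oplus>\<^sub>G k"
      using assms by (auto simp: lie_proj_eq)
    then have "z \<ominus>\<^sub>G (x \<oplus>\<^sub>G y) = (h \<ominus>\<^sub>G x) \<oplus>\<^sub>G (k \<ominus>\<^sub>G y)"
      using assms by (simp add: a_minus_def G.M.minus_add G.M.a_ac)
    then show "z \<in> pr (x \<oplus>\<^sub>G y)" using h assms by (simp add: lie_proj_eq kernel_closed)
  next
    fix z assume "z \<in> pr (x \<oplus>\<^sub>G y)"
    then have z: "z \<in> carrier G" "z \<ominus>\<^sub>G (x \<oplus>\<^sub>G y) \<in> I" using assms by (auto simp: lie_proj_eq)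
    then have "z \<ominus>\<^sub>G y \<in> pr x" 
      using assms by (simp add: lie_proj_eq a_minus_def G.M.minus_add G.M.a_ac)
    moreover have "z = (z \<ominus>\<^sub>G y) \<oplus>\<^sub>G y"
      using assms z(1) by (simp add: a_minus_def G.M.a_assoc G.M.l_neg)
    ultimately show "z \<in> (\<Union>h\<in>pr x. \<Union>k\<in>pr y. {h \<oplus>\<^sub>G k})" using lie_proj_self[OF assms(2)] by blast
  qed
  finally show ?thesis .
qed

lemma smult_Q:
  assumes "x \<in> carrier G" "c \<in> carrier K" shows "c \<odot>\<^bsub>Q\<^esub> pr x = pr (c \<odot>\<^sub>G x)"
proof -
  have "pr (c \<odot>\<^sub>G a) = pr (c \<odot>\<^sub>G x)" if "a \<in> pr x" for a
  proof -
    have a: "a \<in> carrier G" "a \<ominus>\<^sub>G x \<in> I" using that assms by (auto simp: lie_proj_eq)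
    have "c \<odot>\<^sub>G a \<ominus>\<^sub>G c \<odot>\<^sub>G x = c \<odot>\<^sub>G (a \<ominus>\<^sub>G x)"
      using a(1) assms by (simp add: a_minus_def G.smult_r_distr G.smult_r_minus)
    then show ?thesis using a assms by (simp add: lie_proj_eq_iff kernel_closed)
  qed
  then have "(\<Union>a\<in>pr x. pr (c \<odot>\<^sub>G a)) = pr (c \<odot>\<^sub>G x)" using lie_proj_self[OF assms(1)] by blast
  then show ?thesis by (simp add: lie_quotient_def Let_def lie_proj_def)
qed

text \<open>Changing the left representative alters the bracket by some [i, b] = 0, changing the
  right one by some [x, i], which lies in the kernel. So all members of the union are the same
  coset.\<close>

lemma bracket_Q:
  assumes "x \<in> carrier G" "y \<in> carrier G" shows "bracket Q (pr x) (pr y) = pr (br x y)"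
proof -
  have "pr (br a b) = pr (br x y)" if "a \<in> pr x" "b \<in> pr y" for a b
  proof -
    have a: "a \<in> carrier G" "a \<ominus>\<^sub>G x \<in> I" and b: "b \<in> carrier G" "b \<ominus>\<^sub>G y \<in> I"
      using that assms by (auto simp: lie_proj_eq)
    have e: "a = (a \<ominus>\<^sub>G x) \<oplus>\<^sub>G x" "b = (b \<ominus>\<^sub>G y) \<oplus>\<^sub>G y"
      using a b assms by (simp_all add: a_minus_def G.M.a_assoc G.M.l_neg)
    have "br a b = br x b"
      by (subst e(1)) (use a b assms in \<open>simp add: br_add br_kernel_left\<close>)
    also have "\<dots> = br x (b \<ominus>\<^sub>G y) \<oplus>\<^sub>G br x y"
      by (subst e(2)) (use b assms in \<open>simp add: br_add\<close>)
    finally have "br a b \<ominus>\<^sub>G br x y = br x (b \<ominus>\<^sub>G y)"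
      using b assms by (simp add: a_minus_def G.M.a_assoc G.M.r_neg)
    then show ?thesis using a(1) b assms by (simp add: lie_proj_eq_iff br_kernel_right)
  qed
  then have "(\<Union>a\<in>pr x. \<Union>b\<in>pr y. pr (br a b)) = pr (br x y)"
    using lie_proj_self[OF assms(1)] lie_proj_self[OF assms(2)] by blast
  then show ?thesis by (simp add: lie_quotient_def Let_def lie_proj_def)
qed

text \<open>Representatives of a coset differ by kernel elements, which act by zero; the image set
  is thus a singleton and \<open>the_elem\<close> picks its element.\<close>

lemma theta_lie_proj:
  assumes "x \<in> carrier G" "v \<in> carrier V" shows "theta R (pr x) v = \<rho> x v"
proof -
  have "\<rho> y v = \<rho> x v" if "y \<in> pr x" for y
  proof -
    have y: "y \<in> carrier G" "y \<ominus>\<^sub>G x \<in> I" using that assms by (auto simp: lie_proj_eq)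
    have "y = (y \<ominus>\<^sub>G x) \<oplus>\<^sub>G x" using y assms by (simp add: a_minus_def G.M.a_assoc G.M.l_neg)
    then have "\<rho> y v = \<rho> ((y \<ominus>\<^sub>G x) \<oplus>\<^sub>G x) v" by simp
    then show ?thesis using y assms by (simp add: rho_add rho_kernel)
  qed
  then have "(\<lambda>x. \<rho> x v) ` pr x = (\<lambda>_. \<rho> x v) ` pr x" by (intro image_cong refl)
  also have "\<dots> = {\<rho> x v}" by (rule image_constant[OF lie_proj_self[OF assms(1)]])
  finally have "(\<lambda>x. \<rho> x v) ` pr x = {\<rho> x v}" .
  then show ?thesis by (simp add: theta_def)
qed

lemma pr_closed: "x \<in> carrier G \<Longrightarrow> pr x \<in> carrier Q"
  by (simp add: carrier_Q)

lemma carrier_QE: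
  assumes "A \<in> carrier Q" obtains x where "A = pr x" "x \<in> carrier G"
  using assms by (auto simp: carrier_Q)

lemma module_Q: "module K Q"
proof (rule moduleI)
  show "cring K" by (rule G.R.is_cring)
  show "abelian_group Q"
  proof (rule abelian_groupI)
    fix A assume "A \<in> carrier Q"
    then obtain x where x: "A = pr x" "x \<in> carrier G" by (rule carrier_QE)
    then have "pr (\<ominus>\<^sub>G x) \<oplus>\<^bsub>Q\<^esub> A = \<zero>\<^bsub>Q\<^esub>" by (simp add: add_Q zero_Q G.M.l_neg)
    then show "\<exists>B \<in> carrier Q. B \<oplus>\<^bsub>Q\<^esub> A = \<zero>\<^bsub>Q\<^esub>" using x pr_closed by blast
  qed (auto simp: zero_Q add_Q pr_closed G.M.a_ac elim!: carrier_QE)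
qed (auto simp: add_Q smult_Q pr_closed G.smult_l_distr G.smult_r_distr G.smult_assoc1 elim!: carrier_QE)

section \<open>The kernel and the quotient as instances, and a linear section\<close>

lemma antisym_rep_Q: "antisym_rep K Q (obj_map P_a R)"
proof (rule antisym_rep.intro[OF module_Q _ antisym_rep_axioms.intro])
  show "module K (space (obj_map P_a R))" using V.module_axioms by (simp add: P_a_def)
  show "bilinear_on K Q Q Q (bracket Q)"
    by (auto simp: bilinear_on_def module_hom_def bracket_Q add_Q smult_Q br_add br_smult pr_closed elim!: carrier_QE)
  show "bilinear_on K Q (space (obj_map P_a R)) (space (obj_map P_a R)) (rhoL (obj_map P_a R))"
    using module_hom_add[OF rho_hom(1)] module_hom_smult[OF rho_hom(1)]
    by (auto simp: bilinear_on_def module_hom_def P_a_def theta_lie_proj add_Q smult_Q rho_add rho_smult elim!: carrier_QE)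
qed (auto simp: bracket_Q add_Q bracket_leibniz[symmetric] P_a_def theta_lie_proj rhoL_bracket elim!: carrier_QE)

lemma leib_algebra_sel [simp]:
  "carrier (leib_algebra K G) = I" "\<zero>\<^bsub>leib_algebra K G\<^esub> = \<zero>\<^sub>G" "add (leib_algebra K G) = add G"
  "smult (leib_algebra K G) = smult G" "bracket (leib_algebra K G) = br"
  by (simp_all add: leib_algebra_def)

lemma module_leib_algebra: "module K (leib_algebra K G)"
  unfolding leib_algebra_def by (rule G.submodule_is_module[OF kernel_submodule])

lemma I_a_sel [simp]:
  "space (obj_map (I_a K G) R) = V" "i \<in> I \<Longrightarrow> rhoL (obj_map (I_a K G) R) i = \<rho> i"
  "rhoR (obj_map (I_a K G) R) i v = \<zero>\<^sub>V"
  by (simp_all add: I_a_def leib_incl_def fun_eq_iff)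

lemma antisym_rep_leib_algebra: "antisym_rep K (leib_algebra K G) (obj_map (I_a K G) R)"
proof (rule antisym_rep.intro[OF module_leib_algebra _ antisym_rep_axioms.intro])
  show "module K (space (obj_map (I_a K G) R))" using V.module_axioms by simp
  show "bilinear_on K (leib_algebra K G) (leib_algebra K G) (leib_algebra K G) (bracket (leib_algebra K G))"
    by (auto simp: bilinear_on_def module_hom_def br_add br_smult br_kernel_right)
  show "bilinear_on K (leib_algebra K G) (space (obj_map (I_a K G) R)) (space (obj_map (I_a K G) R))
      (rhoL (obj_map (I_a K G) R))"
    using module_hom_add[OF rho_hom(1)] module_hom_smult[OF rho_hom(1)]
    by (auto simp: bilinear_on_def module_hom_def rho_add rho_smult kernel_closed)
qed (auto simp: br_kernel_right rhoL_bracket intro: bracket_leibniz)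

lemma antisym_rep_hom_leib_incl:
  "antisym_rep_hom K (leib_algebra K G) (obj_map (I_a K G) R) G R (leib_incl K G) (\<lambda>v. v)"
proof (rule antisym_rep_hom.intro[OF antisym_rep_leib_algebra antisym_rep_axioms antisym_rep_hom_axioms.intro])
qed (auto simp: module_hom_def leib_incl_def kernel_closed br_kernel_right)

lemma antisym_rep_hom_lie_proj:
  "antisym_rep_hom K G R Q (obj_map P_a R) pr (\<lambda>v. v)"
proof (rule antisym_rep_hom.intro[OF antisym_rep_axioms antisym_rep_Q antisym_rep_hom_axioms.intro])
qed (auto simp: module_hom_def add_Q smult_Q bracket_Q pr_closed P_a_def theta_lie_proj)

text \<open>Every coset has exactly one representative in a complement of the kernel. Choosing it is
  linear by uniqueness, since sums and multiples of chosen representatives stay in the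
  complement.\<close>

lemma exists_linear_section:
  assumes "field K"
  obtains s where "s \<in> module_hom K Q G" "\<And>A. A \<in> carrier Q \<Longrightarrow> pr (s A) = A"
proof -
  obtain C where C: "LinearCombinations.submodule K C G" "C \<inter> I = {\<zero>\<^sub>G}"
    "\<And>x. x \<in> carrier G \<Longrightarrow> \<exists>c\<in>C. x \<ominus>\<^sub>G c \<in> I"
    using G.exists_complement[OF assms kernel_submodule] by metis
  have Cc: "c \<in> carrier G" if "c \<in> C" for c using submodule.subset[OF C(1)] that by auto
  have inj: "c = d" if "c \<in> C" "d \<in> C" "pr c = pr d" for c d
  proof -
    have "c \<ominus>\<^sub>G d \<in> C \<inter> I"
      using that Cc by (auto simp: lie_proj_eq_iff intro: G.submodule_diff[OF C(1)])
    then have "c \<ominus>\<^sub>G d = \<zero>\<^sub>G" using C(2) by auto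
    then show ?thesis using that Cc by simp
  qed
  have ex: "\<exists>c\<in>C. pr c = A" if "A \<in> carrier Q" for A
  proof -
    from that obtain x where x: "A = pr x" "x \<in> carrier G" by (rule carrier_QE)
    then obtain c where "c \<in> C" "x \<ominus>\<^sub>G c \<in> I" using C(3) by blast
    then show ?thesis using x Cc lie_proj_eq_iff[of x c] by auto
  qed
  then obtain s where s: "\<And>A. A \<in> carrier Q \<Longrightarrow> s A \<in> C \<and> pr (s A) = A" by metis
  have "s (A \<oplus>\<^bsub>Q\<^esub> D) = s A \<oplus>\<^sub>G s D" if "A \<in> carrier Q" "D \<in> carrier Q" for A D
  proof (rule inj)
    have AD: "A \<oplus>\<^bsub>Q\<^esub> D \<in> carrier Q" using that module_Q by (simp add: module_def abelian_group.axioms abelian_monoid.a_closed)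
    show "s (A \<oplus>\<^bsub>Q\<^esub> D) \<in> C" "s A \<oplus>\<^sub>G s D \<in> C" using s AD that submodule.m_closed[OF C(1)] by auto
    show "pr (s (A \<oplus>\<^bsub>Q\<^esub> D)) = pr (s A \<oplus>\<^sub>G s D)"
      using s[OF AD] s[OF that(1)] s[OF that(2)] Cc add_Q[of "s A" "s D"] by simp
  qed
  moreover have "s (c \<odot>\<^bsub>Q\<^esub> A) = c \<odot>\<^sub>G s A" if "c \<in> carrier K" "A \<in> carrier Q" for c A
  proof (rule inj)
    have cA: "c \<odot>\<^bsub>Q\<^esub> A \<in> carrier Q" using that module_Q by (simp add: module.smult_closed)
    show "s (c \<odot>\<^bsub>Q\<^esub> A) \<in> C" "c \<odot>\<^sub>G s A \<in> C" using s cA that submodule.smult_closed[OF C(1)] by auto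
    show "pr (s (c \<odot>\<^bsub>Q\<^esub> A)) = pr (c \<odot>\<^sub>G s A)"
      using s[OF cA] s[OF that(2)] Cc smult_Q[of "s A" c] that by simp
  qed
  ultimately have "s \<in> module_hom K Q G" using s Cc by (auto simp: module_hom_def)
  moreover have "pr (s A) = A" if "A \<in> carrier Q" for A using s[OF that] by simp
  ultimately show thesis by (rule that)
qed

end

section \<open>Functors, natural transformations and the exact sequence\<close>

lemma antisym_repI:
  assumes "leibniz_algebra K G" "antisymmetric_rep K G R"
  shows "antisym_rep K G R"
proof (rule antisym_rep.intro[OF _ _ antisym_rep_axioms.intro])
  show "module K G" "module K (space R)"
    using assms
    by (auto simp: leibniz_algebra_def antisymmetric_rep_def leibniz_rep_def fd_vectorspace_def vectorspace_def)
qed (use assms(1)[unfolded leibniz_algebra_def] assms(2)[unfolded antisymmetric_rep_def leibniz_rep_def]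
    in blast)+

text \<open>Arrows are extensional on the carrier, which lets the unit laws hold as equalities of
  functions.\<close>

lemma is_category_antisym_reps:
  fixes K :: "('k, 'c) ring_scheme" and G :: "('k, 'g) leibniz"
  shows "is_category (antisym_reps K G :: (('k, 'g, 'v) representation, 'v \<Rightarrow> 'v) category)"
proof -
  have closed: "rhoL A x v \<in> carrier (space A)" "rhoR A x v \<in> carrier (space A)"
    if "antisymmetric_rep K G A" "x \<in> carrier G" "v \<in> carrier (space A)" for A :: "('k, 'g, 'v) representation" and x v
  proof -
    have "(\<lambda>v. rhoL A x v) \<in> module_hom K (space A) (space A)" "(\<lambda>v. rhoR A x v) \<in> module_hom K (space A) (space A)"
      using that(1,2) unfolding antisymmetric_rep_def leibniz_rep_def bilinear_on_def by blast+
    then show "rhoL A x v \<in> carrier (space A)" "rhoR A x v \<in> carrier (space A)"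
      using that(3) by (auto dest!: module_hom_closed)
  qed
  have mod: "module K (space A)" if "antisymmetric_rep K G A" for A :: "('k, 'g, 'v) representation"
    using that by (simp add: antisymmetric_rep_def leibniz_rep_def fd_vectorspace_def vectorspace_def)
  have homc: "f v \<in> carrier (space B)" if "f \<in> rep_hom K G A B" "v \<in> carrier (space A)"
    for A B :: "('k, 'g, 'v) representation" and f v
    using that by (auto simp: rep_hom_def module_hom_def)
  have ide: "(\<lambda>v \<in> carrier (space A). v) \<in> rep_hom K G A A" if "antisymmetric_rep K G A"
    for A :: "('k, 'g, 'v) representation"
  proof -
    interpret A: module K "space A" by (rule mod[OF that])
    show ?thesis using closed[OF that] by (auto simp: rep_hom_def module_hom_def)
  qed
  have cmp: "compose (carrier (space A)) g f \<in> rep_hom K G A D"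
    if "antisymmetric_rep K G A" "f \<in> rep_hom K G A B" "g \<in> rep_hom K G B D"
    for A B D :: "('k, 'g, 'v) representation" and f g
  proof -
    interpret A: module K "space A" by (rule mod[OF that(1)])
    show ?thesis
      using closed[OF that(1)] that(2,3) homc[OF that(2)]
      by (auto simp: rep_hom_def module_hom_def compose_def Pi_iff)
  qed
  have unit: "compose (carrier (space A)) f (\<lambda>v \<in> carrier (space A). v) = f"
    "compose (carrier (space A)) (\<lambda>v \<in> carrier (space B). v) f = f"
    if "f \<in> rep_hom K G A B" for A B :: "('k, 'g, 'v) representation" and f
    using that homc[OF that] by (auto simp: rep_hom_def compose_def extensional_def fun_eq_iff)
  have assoc: "compose (carrier (space A)) h (compose (carrier (space A)) g f) =
      compose (carrier (space A)) (compose (carrier (space B)) h g) f"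
    if "f \<in> rep_hom K G A B" for A B :: "('k, 'g, 'v) representation" and f g h
    using homc[OF that] by (auto simp: compose_def fun_eq_iff)
  show ?thesis
    unfolding is_category_def antisym_reps_def category.simps mem_Collect_eq
    by (intro conjI ballI) (simp_all add: ide cmp unit assoc)
qed

text \<open>All three functors of the theorem arise from an object map \<open>T\<close> that keeps
  the underlying space and all arrows: the identity, \<open>I_a\<close> and \<open>P_a\<close>. What
  distinguishes them is the algebra \<open>G'\<close> and the equivariance of arrows under its left
  action.\<close>

lemma contravariant_gla_functorI:
  fixes K :: "('k, 'c) ring_scheme" and G :: "('k, 'g) leibniz" and G' :: "('k, 'h) leibniz"
    and T :: "('k, 'g, 'v) representation \<Rightarrow> ('k, 'h, 'v) representation"
  assumes K: "field K"
    and T: "\<And>A. antisymmetric_rep K G A \<Longrightarrow> antisym_rep K G' (T A)"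
    and space: "\<And>A. space (T A) = space A"
    and equivariant: "\<And>A B f x v. antisymmetric_rep K G A \<Longrightarrow> antisymmetric_rep K G B \<Longrightarrow>
      f \<in> rep_hom K G A B \<Longrightarrow> x \<in> carrier G' \<Longrightarrow> v \<in> carrier (space A) \<Longrightarrow>
      f (rhoL (T A) x v) = rhoL (T B) x (f v)"
    and obj: "\<And>A. obj_map F A = controlling_gla K G' (T A)"
    and arr: "\<And>A B f. arr_map F A B f = (\<lambda>n g. \<lambda>ws \<in> tuples n (space A). g (map f ws))"
  shows "contravariant_gla_functor K (antisym_reps K G) F"
proof -
  have homc: "map f ws \<in> tuples n (space B)" if "f \<in> rep_hom K G A B" "ws \<in> tuples n (space A)"
    for A B :: "('k, 'g, 'v) representation" and f n ws
    using that by (auto simp: rep_hom_def module_hom_def tuples_def)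
  have "arr_map F A B f \<in> gla_hom K (obj_map F B) (obj_map F A)"
    if A: "antisymmetric_rep K G A" and B: "antisymmetric_rep K G B" and f: "f \<in> rep_hom K G A B" for A B f
  proof -
    interpret TB: antisym_rep K G' "T B" by (rule T[OF B])
    interpret TA: antisym_rep K G' "T A" by (rule T[OF A])
    \<comment> \<open>Pullback along \<open>f\<close> reverses direction, so \<open>T B\<close> is
      the source and \<open>T A\<close> the target, with the identity on the algebra.\<close>
    interpret antisym_rep_hom K G' "T B" G' "T A" "\<lambda>x. x" f
    proof
      show "f \<in> module_hom K (space (T A)) (space (T B))" using f by (simp add: rep_hom_def space)
    qed (use equivariant[OF A B f] in \<open>auto simp: module_hom_def space\<close>)
    show ?thesis using gla_hom_pull by (simp add: arr obj space)
  qed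
  moreover have "graded_lie_algebra K (obj_map F A)" if "antisymmetric_rep K G A" for A
    unfolding obj by (rule antisym_rep.graded_lie_algebra_controlling[OF T[OF that] K])
  moreover have "arr_map F A A (\<lambda>v \<in> carrier (space A). v) n a = a"
    if "a \<in> carrier (component (obj_map F A) n)" for A n a
  proof -
    have a: "a \<in> extensional (tuples n (space A))"
      using that by (simp add: obj controlling_gla_def hom_space_def multilinear_maps_iff space)
    have "map (\<lambda>v \<in> carrier (space A). v) ws = ws" if "ws \<in> tuples n (space A)" for ws
      using that by (intro map_idI) (auto simp: tuples_def)
    then show ?thesis using a by (auto simp: arr fun_eq_iff extensional_def)
  qed
  moreover have "arr_map F A D (compose (carrier (space A)) g f) n a = arr_map F A B f n (arr_map F B D g n a)"
    if "f \<in> rep_hom K G A B" for A B D f g n a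
  proof -
    have "map (compose (carrier (space A)) g f) ws = map g (map f ws)" if "ws \<in> tuples n (space A)" for ws
      using that by (auto simp: tuples_def compose_def)
    then show ?thesis using homc[OF that] unfolding arr by (intro ext) (simp del: map_map)
  qed
  ultimately show ?thesis
    using is_category_antisym_reps[of K G]
    by (simp add: contravariant_gla_functor_def antisym_reps_def)
qed

lemma in_hom_space_iff:
  "f \<in> carrier (hom_space K n E F) \<longleftrightarrow> multilinear K n E F f \<and> f \<in> extensional (tuples n E)"
  by (simp add: hom_space_def multilinear_maps_iff)

lemma multilinear_compose:
  assumes "multilinear K n E F f" "s \<in> module_hom K F F'"
  shows "multilinear K n E F' (\<lambda>xs. s (f xs))"
  using assms unfolding multilinear_def by (auto simp: module_hom_def Pi_iff)

lemma multilinear_sub: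
  assumes f: "multilinear K n E F f" and I: "\<And>xs. xs \<in> tuples n E \<Longrightarrow> f xs \<in> I"
  shows "multilinear K n E (F\<lparr>carrier := I\<rparr>) f"
  using f I list_update_in_tuples[of _ n E] unfolding multilinear_def by (auto simp: module_hom_def)

section \<open>Exactness of the sequence\<close>

context antisym_rep
begin

lemma alpha_value: "xs \<in> tuples n V \<Longrightarrow> f \<in> carrier (hom_space K n V (leib_algebra K G)) \<Longrightarrow>
    alpha K G R n f xs = f xs"
  using multilinear_closed[of K n V "leib_algebra K G" f xs]
  by (simp add: alpha_def compose_def leib_incl_def in_hom_space_iff)

text \<open>The projection annihilates \<open>g\<close> exactly when all values of \<open>g\<close>
  lie in the kernel, and then \<open>g\<close>, with its codomain shrunk, is its own
  preimage.\<close>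

lemma image_alpha:
  "alpha K G R n ` carrier (hom_space K n V (leib_algebra K G)) =
    {f \<in> carrier (H n). beta K G R n f = \<zero>\<^bsub>hom_space K n V Q\<^esub>}" (is "?l = ?r")
proof (intro subset_antisym subsetI)
  fix g assume "g \<in> ?l"
  then obtain f where g: "g = alpha K G R n f" and f: "f \<in> carrier (hom_space K n V (leib_algebra K G))" by auto
  have f': "multilinear K n V (leib_algebra K G) f" using f by (simp add: in_hom_space_iff)
  have "leib_incl K G \<in> module_hom K (leib_algebra K G) G"
    using antisym_rep_hom_leib_incl by (rule antisym_rep_hom.h_hom)
  then have "g \<in> carrier (H n)"
    unfolding g alpha_def compose_def by (intro restrict_in_hom_space multilinear_compose[OF f'])
  moreover have "beta K G R n g = \<zero>\<^bsub>hom_space K n V Q\<^esub>"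
  proof
    fix xs
    show "beta K G R n g xs = \<zero>\<^bsub>hom_space K n V Q\<^esub> xs"
    proof (cases "xs \<in> tuples n V")
      case True
      then have "f xs \<in> I" using multilinear_closed[OF f'] by simp
      then have "pr (f xs) = \<zero>\<^bsub>Q\<^esub>" by (simp add: zero_Q lie_proj_kernel kernel_closed)
      then show ?thesis using True f by (simp add: beta_def compose_def g alpha_value hom_space_def)
    qed (simp add: beta_def compose_def hom_space_def)
  qed
  ultimately show "g \<in> ?r" by simp
next
  fix g assume "g \<in> ?r"
  then have g: "mlin n g" "g \<in> extensional (tuples n V)" and b: "beta K G R n g = \<zero>\<^bsub>hom_space K n V Q\<^esub>"
    by (auto simp: carrier_hom_space)
  have gI: "g xs \<in> I" if xs: "xs \<in> tuples n V" for xs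
  proof -
    have "pr (g xs) = \<zero>\<^bsub>Q\<^esub>"
      using fun_cong[OF b, of xs] xs by (simp add: beta_def compose_def hom_space_def)
    then have "pr (g xs) = I" by (simp add: zero_Q lie_proj_kernel kernel_closed)
    then show ?thesis using lie_proj_self[OF multilinear_closed[OF g(1) xs]] by simp
  qed
  have "g \<in> carrier (hom_space K n V (leib_algebra K G))"
    unfolding in_hom_space_iff leib_algebra_def using multilinear_sub[OF g(1) gI] g(2) by simp
  moreover from this have "alpha K G R n g = g"
    using alpha_value[of _ n g] g(2) by (auto simp: fun_eq_iff extensional_def alpha_def compose_def)
  ultimately show "g \<in> ?l" by force
qed

text \<open>Composing with a linear section lifts a map and keeps it multilinear, which a mere
  choice of representatives would not ensure.\<close>

lemma image_beta:
  assumes "field K"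
  shows "beta K G R n ` carrier (H n) = carrier (hom_space K n V Q)"
proof (intro subset_antisym subsetI)
  fix g assume "g \<in> beta K G R n ` carrier (H n)"
  then obtain f where g: "g = beta K G R n f" and f: "mlin n f" by (auto simp: carrier_hom_space)
  interpret QR: antisym_rep K Q "obj_map P_a R" by (rule antisym_rep_Q)
  have s: "space (obj_map P_a R) = V" by (simp add: P_a_def)
  have "pr \<in> module_hom K G Q"
    using antisym_rep_hom_lie_proj by (rule antisym_rep_hom.h_hom)
  then have "multilinear K n V Q (\<lambda>xs. pr (f xs))" by (rule multilinear_compose[OF f])
  then show "g \<in> carrier (hom_space K n V Q)"
    unfolding g beta_def compose_def
    using QR.restrict_in_hom_space[of n "\<lambda>xs. pr (f xs)"] by (simp add: s)
next
  fix g assume g: "g \<in> carrier (hom_space K n V Q)"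
  obtain s where s: "s \<in> module_hom K Q G" "\<And>A. A \<in> carrier Q \<Longrightarrow> pr (s A) = A"
    using exists_linear_section[OF assms] by metis
  let ?f = "\<lambda>xs \<in> tuples n V. s (g xs)"
  have g': "multilinear K n V Q g" "g \<in> extensional (tuples n V)" using g by (simp_all add: in_hom_space_iff)
  have "?f \<in> carrier (H n)"
    by (intro restrict_in_hom_space multilinear_compose[OF g'(1) s(1)])
  moreover have "beta K G R n ?f = g"
    using s(2)[OF multilinear_closed[OF g'(1)]] g'(2)
    by (auto simp: fun_eq_iff beta_def compose_def extensional_def)
  ultimately show "g \<in> beta K G R n ` carrier (H n)" by (metis imageI)
qed

lemma alpha_gla_hom:
  "alpha K G R \<in> gla_hom K (controlling_gla K (leib_algebra K G) (obj_map (I_a K G) R)) (controlling_gla K G R)"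
proof -
  \<comment> \<open>Inserting the trivial \<open>map\<close> gives \<alpha> the shape of
    \<open>gla_hom_pull\<close>, with the identity on \<open>V\<close>.\<close>
  have "alpha K G R = (\<lambda>n f. \<lambda>ws \<in> tuples n V. leib_incl K G (f (map (\<lambda>v. v) ws)))"
    by (simp add: fun_eq_iff alpha_def compose_def)
  then show ?thesis using antisym_rep_hom.gla_hom_pull[OF antisym_rep_hom_leib_incl] by simp
qed

lemma beta_gla_hom:
  "beta K G R \<in> gla_hom K (controlling_gla K G R) (controlling_gla K Q (obj_map P_a R))"
proof -
  have "beta K G R = (\<lambda>n f. \<lambda>ws \<in> tuples n (space (obj_map P_a R)). pr (f (map (\<lambda>v. v) ws)))"
    by (simp add: fun_eq_iff beta_def compose_def P_a_def)
  then show ?thesis using antisym_rep_hom.gla_hom_pull[OF antisym_rep_hom_lie_proj] by simp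
qed

lemma short_exact:
  assumes "field K"
  shows "gla_short_exact K (controlling_gla K (leib_algebra K G) (obj_map (I_a K G) R))
    (controlling_gla K G R) (controlling_gla K Q (obj_map P_a R)) (alpha K G R) (beta K G R)"
proof -
  have s: "space (obj_map P_a R) = V" by (simp add: P_a_def)
  have "inj_on (alpha K G R n) (carrier (hom_space K n V (leib_algebra K G)))" for n
  proof (rule inj_onI)
    fix f g assume f: "f \<in> carrier (hom_space K n V (leib_algebra K G))"
      and g: "g \<in> carrier (hom_space K n V (leib_algebra K G))" and e: "alpha K G R n f = alpha K G R n g"
    have "f xs = g xs" if "xs \<in> tuples n V" for xs
      using fun_cong[OF e, of xs] alpha_value[OF that f] alpha_value[OF that g] by simp
    then show "f = g" using f g unfolding in_hom_space_iff by (auto intro: extensionalityI)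
  qed
  then show ?thesis
    unfolding gla_short_exact_def
    using antisym_rep.graded_lie_algebra_controlling[OF antisym_rep_leib_algebra assms]
      graded_lie_algebra_controlling[OF assms]
      antisym_rep.graded_lie_algebra_controlling[OF antisym_rep_Q assms]
      alpha_gla_hom beta_gla_hom image_alpha image_beta[OF assms]
    by (simp add: controlling_gla_def s)
qed

end

theorem theorem3p8:
  fixes K :: "('k, 'c) ring_scheme" and G :: "('k, 'g) leibniz"
  assumes "algebraically_closed K" and "char_zero K" and "leibniz_algebra K G"
  shows "gla_natural_transformation K
           (antisym_reps K G :: (('k, 'g, 'v) representation, 'v \<Rightarrow> 'v) category)
           (C_functor K (leib_algebra K G) \<circ>\<^sub>F I_a K G) (C_functor K G) (alpha K G)
       \<and> gla_natural_transformation K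
           (antisym_reps K G :: (('k, 'g, 'v) representation, 'v \<Rightarrow> 'v) category)
           (C_functor K G) (C_functor K (lie_quotient K G) \<circ>\<^sub>F P_a) (beta K G)
       \<and> (\<forall>V :: ('k, 'g, 'v) representation. antisymmetric_rep K G V \<longrightarrow>
            gla_short_exact K
              (obj_map (C_functor K (leib_algebra K G) \<circ>\<^sub>F I_a K G) V)
              (obj_map (C_functor K G) V)
              (obj_map (C_functor K (lie_quotient K G) \<circ>\<^sub>F P_a) V)
              (alpha K G V) (beta K G V))"
proof -
  have K: "field K" using assms(1) by (rule algebraically_closed.axioms)
  let ?C = "antisym_reps K G :: (('k, 'g, 'v) representation, 'v \<Rightarrow> 'v) category"
  let ?L = "C_functor K (leib_algebra K G) \<circ>\<^sub>F I_a K G" and ?Q = "C_functor K (lie_quotient K G) \<circ>\<^sub>F P_a"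
  note rep = antisym_repI[OF assms(3)]
  have obj: "obj_map ?L A = controlling_gla K (leib_algebra K G) (obj_map (I_a K G) A)"
    "obj_map (C_functor K G) A = controlling_gla K G A"
    "obj_map ?Q A = controlling_gla K (lie_quotient K G) (obj_map P_a A)"
    for A :: "('k, 'g, 'v) representation"
    by (simp_all add: C_functor_def functor_comp_def)
  have sp: "space (obj_map (I_a K G) A) = space A" "space (obj_map P_a A) = space A"
    for A :: "('k, 'g, 'v) representation"
    by (simp_all add: I_a_def P_a_def)
  have arr: "arr_map ?L A B f = (\<lambda>n g. \<lambda>ws \<in> tuples n (space A). g (map f ws))"
    "arr_map (C_functor K G) A B f = (\<lambda>n g. \<lambda>ws \<in> tuples n (space A). g (map f ws))"
    "arr_map ?Q A B f = (\<lambda>n g. \<lambda>ws \<in> tuples n (space A). g (map f ws))"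
    for A B :: "('k, 'g, 'v) representation" and f
    by (simp_all add: C_functor_def functor_comp_def I_a_def P_a_def)
  have FC: "contravariant_gla_functor K ?C (C_functor K G)"
    by (rule contravariant_gla_functorI[where T = "\<lambda>A. A", OF K rep])
      (auto simp: obj arr rep_hom_def)
  have FL: "contravariant_gla_functor K ?C ?L"
  proof (rule contravariant_gla_functorI[where T = "obj_map (I_a K G)", OF K _ sp(1) _ obj(1) arr(1)])
    show "antisym_rep K (leib_algebra K G) (obj_map (I_a K G) A)" if "antisymmetric_rep K G A"
      for A :: "('k, 'g, 'v) representation"
      using rep[OF that] by (rule antisym_rep.antisym_rep_leib_algebra)
    show "f (rhoL (obj_map (I_a K G) A) x v) = rhoL (obj_map (I_a K G) B) x (f v)"
      if A: "antisymmetric_rep K G A" and "f \<in> rep_hom K G A B" "x \<in> carrier (leib_algebra K G)" "v \<in> carrier (space A)"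
      for A B :: "('k, 'g, 'v) representation" and f x v
    proof -
      interpret antisym_rep K G A by (rule rep[OF A])
      show ?thesis using that by (simp add: I_a_def leib_incl_def rep_hom_def)
    qed
  qed
  have FQ: "contravariant_gla_functor K ?C ?Q"
  proof (rule contravariant_gla_functorI[where T = "obj_map P_a", OF K _ sp(2) _ obj(3) arr(3)])
    show "antisym_rep K (lie_quotient K G) (obj_map P_a A)" if "antisymmetric_rep K G A"
      for A :: "('k, 'g, 'v) representation"
      using rep[OF that] by (rule antisym_rep.antisym_rep_Q)
    show "f (rhoL (obj_map P_a A) x v) = rhoL (obj_map P_a B) x (f v)"
      if A: "antisymmetric_rep K G A" and B: "antisymmetric_rep K G B"
        and f: "f \<in> rep_hom K G A B" and x: "x \<in> carrier (lie_quotient K G)" and v: "v \<in> carrier (space A)"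
      for A B :: "('k, 'g, 'v) representation" and f x v
    proof -
      interpret A: antisym_rep K G A by (rule rep[OF A])
      interpret B: antisym_rep K G B by (rule rep[OF B])
      \<comment> \<open>Once \<open>x\<close> is written as a coset, both \<open>theta\<close> maps
        become the original left actions, which \<open>f\<close> intertwines.\<close>
      obtain y where y: "x = lie_proj K G y" "y \<in> carrier G" using x by (rule A.carrier_QE)
      have "f v \<in> carrier (space B)" using f v by (auto simp: rep_hom_def module_hom_def)
      then show ?thesis using f v y by (simp add: P_a_def A.theta_lie_proj B.theta_lie_proj rep_hom_def)
    qed
  qed
  have map_tuples: "map f ws \<in> tuples n (space B)" if "f \<in> rep_hom K G A B" "ws \<in> tuples n (space A)"
    for A B :: "('k, 'g, 'v) representation" and f n ws
    using that by (auto simp: rep_hom_def module_hom_def tuples_def)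
  \<comment> \<open>Naturality is associativity of composition: \<alpha> composes on the side of the
    values, the functor on the side of the arguments. The same holds for \<beta>.\<close>
  have "gla_natural_transformation K ?C ?L (C_functor K G) (alpha K G)"
    unfolding gla_natural_transformation_def
    using FL FC antisym_rep.alpha_gla_hom[OF rep] map_tuples
    by (auto simp: antisym_reps_def obj arr alpha_def compose_def fun_eq_iff)
  moreover have "gla_natural_transformation K ?C (C_functor K G) ?Q (beta K G)"
    unfolding gla_natural_transformation_def
    using FQ FC antisym_rep.beta_gla_hom[OF rep] map_tuples
    by (auto simp: antisym_reps_def obj arr beta_def compose_def fun_eq_iff)
  moreover have "gla_short_exact K (obj_map ?L V) (obj_map (C_functor K G) V) (obj_map ?Q V) (alpha K G V) (beta K G V)"
    if "antisymmetric_rep K G V" for V :: "('k, 'g, 'v) representation"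
    unfolding obj using antisym_rep.short_exact[OF rep[OF that] K] .
  ultimately show ?thesis by blast
qed

end
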